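(* Let $n\ge 2$ be an integer, and put $d=\frac{n^2-3n+4}{2}$ and $C=\binom{\frac{n^2-n}{2}}{n-2}$. If $\mathrm{CA}_{n,0}$ holds but the prime number $p$ is a bad prime for $n$, then $$p< C!\prod_{i=1}^{n-1}\binom{i+n-2}{n-2}^{\binom{d-i+n-2}{n-2}}.$$
   Context: Let $K$ be a field and $f=x^n+a_1x^{n-1}+\dots+a_n\in K[x]$ a monic univariate polynomial of degree $n$; put $a_0=1$. For $i\in\{1,\dots,n-1\}$ the $i$-th Hasse derivative of $f$ is $H_i(f)=\sum_{k=0}^{n-i}\binom{n-k}{i}a_k x^{n-k-i}$. The polynomial $f$ is a Casas--Alvero polynomial if for each $i\in\{1,\dots,n-1\}$ it has a non-constant common factor with $H_i(f)$. For $p$ a prime or $p=0$, $\mathrm{CA}_{n,p}$ is the statement: for every algebraically closed field $K$ of characteristic $p$, every monic Casas--Alvero polynomial $f\in K[x]$ of degree $n$ is of the form $f(x)=(x-b)^n$ with $b\in K$. A prime number $p$ is a bad prime for $n$ if $\mathrm{CA}_{n,p}$ is false. *)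

theory Defs
  imports "HOL-Algebra.Algebraic_Closure" "HOL-Computational_Algebra.Primes"
begin

(* Univariate polynomials over K are elements of poly_ring K: lists of coefficients, leading
   coefficient first, without leading zeros.  Hence f ! k is the coefficient a_k of x^(n-k)
   when f has degree n. *)

definition has_char :: "('a, 'b) ring_scheme \<Rightarrow> nat \<Rightarrow> bool" where
  "has_char K p \<longleftrightarrow> (\<forall>m::nat. [m] \<cdot>\<^bsub>K\<^esub> \<one>\<^bsub>K\<^esub> = \<zero>\<^bsub>K\<^esub> \<longleftrightarrow> p dvd m)"

definition monic_poly :: "('a, 'b) ring_scheme \<Rightarrow> 'a list \<Rightarrow> bool" where
  "monic_poly K f \<longleftrightarrow> f \<in> carrier (poly_ring K) \<and> f \<noteq> [] \<and> lead_coeff f = \<one>\<^bsub>K\<^esub>"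

(* Intended for f nonzero and i \<le> degree f.  The k-th entry of the mapped list is the coefficient
   of x^(degree f - i - k); normalize removes leading zeros, which do occur when K has
   positive characteristic (the result may even be the zero polynomial). *)
definition hasse_deriv :: "('a, 'b) ring_scheme \<Rightarrow> nat \<Rightarrow> 'a list \<Rightarrow> 'a list" where
  "hasse_deriv K i f =
     ring.normalize K
       (map (\<lambda>k. [((degree f - k) choose i)] \<cdot>\<^bsub>K\<^esub> (f ! k)) [0..<degree f - i + 1])"

definition casas_alvero :: "('a, 'b) ring_scheme \<Rightarrow> 'a list \<Rightarrow> bool" where
  "casas_alvero K f \<longleftrightarrow>
     (\<forall>i\<in>{1..degree f - 1}.
        \<exists>g\<in>carrier (poly_ring K).
          degree g \<ge> 1 \<and> g pdivides\<^bsub>K\<^esub> f \<and> g pdivides\<^bsub>K\<^esub> hasse_deriv K i f)"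

(* HOL cannot quantify over types inside a formula, so the fields K range over all
   algebraically closed fields whose carrier is a set of elements of the type 'u, which is a
   parameter of the statement and plays the role of a universe. *)
definition CA :: "'u itself \<Rightarrow> nat \<Rightarrow> nat \<Rightarrow> bool" where
  "CA U n p \<longleftrightarrow>
     (\<forall>K :: 'u ring. algebraically_closed K \<and> has_char K p \<longrightarrow>
        (\<forall>f. monic_poly K f \<and> degree f = n \<and> casas_alvero K f \<longrightarrow>
           (\<exists>b\<in>carrier K. f = [\<one>\<^bsub>K\<^esub>, \<ominus>\<^bsub>K\<^esub> b] [^]\<^bsub>poly_ring K\<^esub> n)))"

definition bad_prime :: "'u itself \<Rightarrow> nat \<Rightarrow> nat \<Rightarrow> bool" where
  "bad_prime U n p \<longleftrightarrow> Factorial_Ring.prime p \<and> \<not> CA U n p"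

end

theory Submission
  imports Defs "Jordan_Normal_Form.Determinant" "HOL-Library.Poly_Mapping"
    "HOL-Library.Countable_Set" "HOL-Algebra.Algebraic_Closure_Type"
begin

text \<open>
  Translate a monic polynomial of degree \<open>n\<close> so that one of its roots is \<open>0\<close>. Evaluating the Hasse
  derivatives at chosen roots gives \<open>n - 1\<close> integer forms of degrees \<open>1, \<dots>, n - 1\<close> in the
  remaining \<open>n - 1\<close> roots, and the polynomial is Casas--Alvero iff these forms vanish for some
  choice of roots. If they have no nontrivial common zero in characteristic \<open>0\<close>, then by Macaulay
  they generate all monomials of degree \<open>d = 1 + (0 + \<dots> + (n - 2))\<close> over the algebraic numbers.
  Hence some maximal minor \<open>\<Delta>\<close> of the integer matrix of their monomial multiples of degree \<open>d\<close> is
  nonzero, and by Cramer's rule \<open>\<Delta>\<close> times any monomial of degree \<open>d\<close> is an integral combination of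
  the forms. A nontrivial common zero in characteristic \<open>p\<close> therefore forces \<open>p\<close> to divide \<open>\<Delta>\<close>,
  whose size is bounded by the Leibniz formula.

  Macaulay's theorem is proved with Bezoutians: writing \<open>x\<^sub>j\<^sup>N\<close> through the forms and the forms through
  the variables, the product of the two determinants has coefficient \<open>1\<close> at \<open>\<Prod> x\<^sub>j\<^sup>N\<^sup>-\<^sup>1\<close>, which yields
  a linear functional vanishing on the ideal; applied to one set of variables of the Bezoutian it
  turns a polynomial of degree at least \<open>d\<close> into an element of the ideal.
\<close>

text \<open>Which root is shared with each Hasse derivative is read off from one counterexample in
  characteristic p; characteristic 0 is then used for this choice only, so a single determinant
  suffices. Its vanishing modulo p can be tested because Cramer's rule is applied over the integers,
  and the resulting identity maps to any field. The constants count rows: in n - 1 variables there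
  are \<open>C\<close> monomials of degree d, and a form of degree i has
  \<open>(d - i + n - 2) choose (n - 2)\<close> monomial multiples of degree d. Each row contains
  coefficients of one form only. As it is unknown which rows make up the minor, the product runs
  over all of them. The coefficients are in fact at most \<open>(n - 1) choose i\<close>, so the
  stated bound is generous. Strictness holds because the right-hand side is 1 or divisible by 6,
  hence not a prime. \<open>CA\<close> speaks of fields carried by subsets of 'u, while the linear
  algebra takes place in types. Homomorphisms from \<open>int mpoly\<close> connect the two, and the
  counterexample itself shows that 'u is infinite, so that the countable field of algebraic numbers
  embeds into it.\<close>

type_synonym 'a mpoly = "(nat \<Rightarrow>\<^sub>0 nat) \<Rightarrow>\<^sub>0 'a"

abbreviation lookup :: "('a \<Rightarrow>\<^sub>0 'b::zero) \<Rightarrow> 'a \<Rightarrow> 'b" where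
  "lookup \<equiv> Poly_Mapping.lookup"

abbreviation keys :: "('a \<Rightarrow>\<^sub>0 'b::zero) \<Rightarrow> 'a set" where
  "keys \<equiv> Poly_Mapping.keys"

abbreviation term_of :: "(nat \<Rightarrow>\<^sub>0 nat) \<Rightarrow> 'a::zero \<Rightarrow> 'a mpoly" where
  "term_of \<equiv> Poly_Mapping.single"

abbreviation var :: "nat \<Rightarrow> 'a::comm_ring_1 mpoly" where
  "var i \<equiv> term_of (Poly_Mapping.single i (Suc 0)) 1"

abbreviation cst :: "'a::comm_ring_1 \<Rightarrow> 'a mpoly" where
  "cst c \<equiv> term_of 0 c"

abbreviation monom_of :: "(nat \<Rightarrow>\<^sub>0 nat) \<Rightarrow> 'a::comm_ring_1 mpoly" where
  "monom_of m \<equiv> term_of m 1"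

section \<open>Polynomials as sums of terms\<close>

lemma poly_mapping_eq_sum:
  fixes p :: "'k \<Rightarrow>\<^sub>0 'a::comm_monoid_add"
  shows "p = (\<Sum>m\<in>keys p. Poly_Mapping.single m (lookup p m))"
  by (rule poly_mapping_eqI)
     (auto simp: lookup_sum lookup_single when_def not_in_keys_iff_lookup_eq_zero)

lemma mpoly_induct [case_names single add]:
  fixes p :: "'a::comm_monoid_add mpoly"
  assumes "\<And>m c. P (term_of m c)" and "\<And>p q. P p \<Longrightarrow> P q \<Longrightarrow> P (p + q)"
  shows "P p"
proof -
  have "P (\<Sum>m\<in>S. term_of m (lookup p m))" if "finite S" for S
    using that
  proof (induction S)
    case empty
    show ?case using assms(1)[of 0 0] by simp
  qed (auto intro: assms)
  from this[OF finite_keys[of p]] show ?thesis by (simp flip: poly_mapping_eq_sum)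
qed

lemma comm_ring_homI:
  assumes "h 0 = 0" "h 1 = 1" "\<And>a b. h (a + b) = h a + h b" "\<And>a b. h (a * b) = h a * h b"
  shows "comm_ring_hom h"
  by unfold_locales (simp_all add: assms)

lemma additive_mpoly_eqI:
  fixes p :: "'a::comm_monoid_add mpoly"
  assumes "\<And>p q. f (p + q) = f p + f q" "\<And>p q. g (p + q) = g p + g q"
    and "\<And>m c. f (term_of m c) = g (term_of m c)"
  shows "f p = g p"
  by (induction p rule: mpoly_induct) (simp_all add: assms)

subsection \<open>Evaluation\<close>

definition xmono :: "(nat \<Rightarrow> 'b) \<Rightarrow> (nat \<Rightarrow>\<^sub>0 nat) \<Rightarrow> 'b::comm_ring_1" where
  "xmono x m = (\<Prod>i\<in>keys m. x i ^ lookup m i)"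

lemma xmono_superset: "finite S \<Longrightarrow> keys m \<subseteq> S \<Longrightarrow> xmono x m = (\<Prod>i\<in>S. x i ^ lookup m i)"
  unfolding xmono_def by (rule prod.mono_neutral_left) (auto simp: in_keys_iff)

lemma xmono_0 [simp]: "xmono x 0 = 1"
  by (simp add: xmono_def)

lemma xmono_single [simp]: "xmono x (Poly_Mapping.single i k) = x i ^ k"
  by (simp add: xmono_def)

lemma xmono_add: "xmono x (m + m') = xmono x m * xmono x m'"
proof -
  let ?S = "keys m \<union> keys m'"
  have "keys (m + m') \<subseteq> ?S" by (rule keys_add)
  then show ?thesis
    by (simp add: xmono_superset[of ?S] lookup_add power_add prod.distrib)
qed

definition ev :: "('a \<Rightarrow> 'b) \<Rightarrow> (nat \<Rightarrow> 'b) \<Rightarrow> 'a::comm_ring_1 mpoly \<Rightarrow> 'b::comm_ring_1" where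
  "ev h x p = (\<Sum>m\<in>keys p. h (lookup p m) * xmono x m)"

context comm_ring_hom
begin

lemma ev_superset: "finite S \<Longrightarrow> keys p \<subseteq> S \<Longrightarrow> ev hom x p = (\<Sum>m\<in>S. hom (lookup p m) * xmono x m)"
  unfolding ev_def by (rule sum.mono_neutral_left) (auto simp: in_keys_iff)

lemma ev_term [simp]: "ev hom x (term_of m c) = hom c * xmono x m"
  by (simp add: ev_def)

lemma ev_add: "ev hom x (p + q) = ev hom x p + ev hom x q"
proof -
  let ?S = "keys p \<union> keys q"
  have "keys (p + q) \<subseteq> ?S" by (rule keys_add)
  then show ?thesis
    by (simp add: ev_superset[of ?S] lookup_add hom_distribs algebra_simps sum.distrib)
qed

lemma ev_mult: "ev hom x (p * q) = ev hom x p * ev hom x q"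
proof (induction p rule: mpoly_induct)
  case (single m c)
  show ?case
    by (induction q rule: mpoly_induct)
       (simp_all add: mult_single hom_distribs xmono_add ev_add algebra_simps)
qed (simp_all add: ev_add algebra_simps)

lemma ev_hom: "comm_ring_hom (ev hom x)"
proof (rule comm_ring_homI)
  show "ev hom x 0 = 0" by (simp add: ev_def)
  show "ev hom x 1 = 1" using ev_term[of x 0 1] by simp
qed (auto simp: ev_add ev_mult)

end

text \<open>Writes a monomial as a product of powers inside the ring, so that the value of a
  homomorphism on it is determined by the values at the variables.\<close>

lemma monom_of_eq_xmono: "monom_of m = xmono var m"
proof -
  have *: "(var i :: 'a mpoly) ^ k = term_of (Poly_Mapping.single i k) 1" for i k
    by (induction k) (auto simp: mult_single simp flip: single_add)
  have "(\<Prod>i\<in>S. (var i :: 'a mpoly) ^ lookup m i) = term_of (\<Sum>i\<in>S. Poly_Mapping.single i (lookup m i)) 1"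
    if "finite S" for S
    using that by (induction S) (simp only: prod.empty sum.empty single_one, simp only: prod.insert sum.insert sum.empty * mult_single, simp_all add: mult_single)
  from this[OF finite_keys[of m]] show ?thesis
    by (simp add: xmono_def flip: poly_mapping_eq_sum[of m])
qed

subsection \<open>Monomials occurring in a polynomial\<close>

definition mdeg :: "(nat \<Rightarrow>\<^sub>0 nat) \<Rightarrow> nat" where
  "mdeg m = (\<Sum>i\<in>keys m. lookup m i)"

lemma mdeg_superset: "finite S \<Longrightarrow> keys m \<subseteq> S \<Longrightarrow> mdeg m = (\<Sum>i\<in>S. lookup m i)"
  unfolding mdeg_def by (rule sum.mono_neutral_left) (auto simp: in_keys_iff)

lemma mdeg_add [simp]: "mdeg (m + m') = mdeg m + mdeg m'"
proof -
  let ?S = "keys m \<union> keys m'"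
  have "keys (m + m') \<subseteq> ?S" by (rule keys_add)
  then show ?thesis
    by (simp add: mdeg_superset[of ?S] lookup_add sum.distrib)
qed

lemma mdeg_0 [simp]: "mdeg 0 = 0"
  by (simp add: mdeg_def)

lemma mdeg_single [simp]: "mdeg (Poly_Mapping.single i k) = k"
  by (simp add: mdeg_def)

definition in_vars :: "nat set \<Rightarrow> 'a::zero mpoly \<Rightarrow> bool" where
  "in_vars V p \<longleftrightarrow> (\<forall>m\<in>keys p. keys m \<subseteq> V)"

definition homog :: "nat \<Rightarrow> 'a::zero mpoly \<Rightarrow> bool" where
  "homog d p \<longleftrightarrow> (\<forall>m\<in>keys p. mdeg m = d)"

text \<open>A lower bound on degrees is all that is needed where a coefficient must vanish for
  degree reasons; unlike \<open>homog\<close> it survives multiplication by arbitrary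
  polynomials.\<close>

definition order_ge :: "nat \<Rightarrow> 'a::zero mpoly \<Rightarrow> bool" where
  "order_ge d p \<longleftrightarrow> (\<forall>m\<in>keys p. d \<le> mdeg m)"

lemma in_keys_add: "m \<in> keys (p + q) \<Longrightarrow> m \<in> keys p \<or> m \<in> keys q"
  using keys_add[of p q] by auto

lemma in_keys_diff:
  fixes p q :: "'k \<Rightarrow>\<^sub>0 'a::ab_group_add"
  shows "m \<in> keys (p - q) \<Longrightarrow> m \<in> keys p \<or> m \<in> keys q"
  by (auto simp: in_keys_iff lookup_minus)

lemma in_keys_mult:
  "m \<in> keys (p * q) \<Longrightarrow> \<exists>a b. m = a + b \<and> a \<in> keys p \<and> b \<in> keys q"
  using keys_mult[of p q] by auto

lemma in_vars_term [simp]: "in_vars V (term_of m c) \<longleftrightarrow> c = 0 \<or> keys m \<subseteq> V"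
  by (auto simp: in_vars_def)

lemma in_vars_0 [simp]: "in_vars V 0" and in_vars_1 [simp]: "in_vars V (1::'a::comm_ring_1 mpoly)"
  by (auto simp: in_vars_def)

lemma in_vars_add: "in_vars V p \<Longrightarrow> in_vars V q \<Longrightarrow> in_vars V (p + q)"
  unfolding in_vars_def by (metis in_keys_add)

lemma in_vars_diff: "in_vars V p \<Longrightarrow> in_vars V q \<Longrightarrow> in_vars V (p - q :: 'a::comm_ring_1 mpoly)"
  unfolding in_vars_def by (metis in_keys_diff)

lemma in_vars_mult: "in_vars V p \<Longrightarrow> in_vars V q \<Longrightarrow> in_vars V (p * q)"
  unfolding in_vars_def
proof
  fix m assume "\<forall>m\<in>keys p. keys m \<subseteq> V" "\<forall>m\<in>keys q. keys m \<subseteq> V" "m \<in> keys (p * q)"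
  then obtain a b where "m = a + b" "keys a \<subseteq> V" "keys b \<subseteq> V"
    using in_keys_mult by blast
  then show "keys m \<subseteq> V" using keys_add[of a b] by blast
qed

lemma in_vars_sum: "(\<And>i. i \<in> A \<Longrightarrow> in_vars V (f i)) \<Longrightarrow> in_vars V (\<Sum>i\<in>A. f i)"
  by (induction A rule: infinite_finite_induct) (auto intro: in_vars_add)

lemma in_vars_prod:
  "(\<And>i. i \<in> A \<Longrightarrow> in_vars V (f i)) \<Longrightarrow> in_vars V (\<Prod>i\<in>A. f i :: 'a::comm_ring_1 mpoly)"
  by (induction A rule: infinite_finite_induct) (auto intro: in_vars_mult)

lemma in_vars_power: "in_vars V p \<Longrightarrow> in_vars V (p ^ k :: 'a::comm_ring_1 mpoly)"
  by (induction k) (auto intro: in_vars_mult)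

lemma homog_term [simp]: "homog d (term_of m c) \<longleftrightarrow> c = 0 \<or> mdeg m = d"
  by (auto simp: homog_def)

lemma homog_0 [simp]: "homog d 0"
  by (simp add: homog_def)

lemma homog_add: "homog d p \<Longrightarrow> homog d q \<Longrightarrow> homog d (p + q)"
  unfolding homog_def by (metis in_keys_add)

lemma homog_diff: "homog d p \<Longrightarrow> homog d q \<Longrightarrow> homog d (p - q :: 'a::comm_ring_1 mpoly)"
  unfolding homog_def by (metis in_keys_diff)

lemma homog_mult: "homog d p \<Longrightarrow> homog e q \<Longrightarrow> homog (d + e) (p * q)"
  unfolding homog_def by (metis in_keys_mult mdeg_add)

lemma order_ge_term [simp]: "order_ge d (term_of m c) \<longleftrightarrow> c = 0 \<or> d \<le> mdeg m"
  by (auto simp: order_ge_def)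

lemma order_ge_0 [simp]: "order_ge d 0" and order_ge_zero [simp]: "order_ge 0 p"
  by (auto simp: order_ge_def)

lemma homog_imp_order_ge: "homog d p \<Longrightarrow> order_ge d p"
  by (simp add: homog_def order_ge_def)

lemma order_ge_add: "order_ge d p \<Longrightarrow> order_ge d q \<Longrightarrow> order_ge d (p + q)"
  unfolding order_ge_def by (metis in_keys_add)

lemma order_ge_mult: "order_ge d p \<Longrightarrow> order_ge e q \<Longrightarrow> order_ge (d + e) (p * q)"
  unfolding order_ge_def by (metis in_keys_mult mdeg_add add_mono)

lemma order_ge_sum: "(\<And>i. i \<in> A \<Longrightarrow> order_ge d (f i)) \<Longrightarrow> order_ge d (\<Sum>i\<in>A. f i)"
  by (induction A rule: infinite_finite_induct) (auto intro: order_ge_add)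

lemma order_ge_prod:
  "(\<And>i. i \<in> A \<Longrightarrow> order_ge (d i) (f i)) \<Longrightarrow>
    order_ge (\<Sum>i\<in>A. d i) (\<Prod>i\<in>A. f i :: 'a::comm_ring_1 mpoly)"
  by (induction A rule: infinite_finite_induct) (auto intro: order_ge_mult)

subsection \<open>Homogeneous components\<close>

definition component :: "nat \<Rightarrow> 'a::zero mpoly \<Rightarrow> 'a mpoly" where
  "component d p = Poly_Mapping.mapp (\<lambda>m c. if mdeg m = d then c else 0) p"

lemma lookup_component: "lookup (component d p) m = (if mdeg m = d then lookup p m else 0)"
  by (auto simp: component_def lookup_mapp when_def in_keys_iff)

lemma component_add: "component d (p + q) = component d p + component d q"
  by (rule poly_mapping_eqI) (simp add: lookup_component lookup_add)

lemma component_0 [simp]: "component d 0 = 0"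
  by (rule poly_mapping_eqI) (simp add: lookup_component)

lemma component_sum: "component d (\<Sum>i\<in>A. f i) = (\<Sum>i\<in>A. component d (f i))"
  by (induction A rule: infinite_finite_induct) (auto simp: component_add)

lemma homog_component: "homog d (component d p)"
  by (auto simp: homog_def in_keys_iff lookup_component split: if_splits)

lemma in_vars_component: "in_vars V p \<Longrightarrow> in_vars V (component d p)"
  by (auto simp: in_vars_def in_keys_iff lookup_component split: if_splits)

lemma component_homog: "homog d p \<Longrightarrow> component d p = p"
  by (rule poly_mapping_eqI) (auto simp: homog_def lookup_component in_keys_iff)

lemma component_term: "component d (term_of m c) = (if mdeg m = d then term_of m c else 0)"
  by (rule poly_mapping_eqI) (auto simp: lookup_component lookup_single when_def)

text \<open>Multiplication by a homogeneous q shifts components by e. In an identity between forms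
  this cuts every cofactor down to a single degree; truncated subtraction forces the case
  distinction.\<close>

lemma component_mult_homog:
  fixes p q :: "'a::comm_ring_1 mpoly"
  assumes "homog e q"
  shows "component d (p * q) = (if e \<le> d then component (d - e) p * q else 0)"
proof (induction p rule: mpoly_induct)
  case (single m c)
  have *: "homog (mdeg m + e) (term_of m c * q)"
    by (rule homog_mult) (use assms in auto)
  show ?case
  proof (cases "mdeg m + e = d")
    case True
    then show ?thesis using component_homog[OF *] by (simp add: component_term)
  next
    case False
    have "component d (term_of m c * q) = 0"
    proof (rule poly_mapping_eqI)
      fix k show "lookup (component d (term_of m c * q)) k = lookup 0 k"
        using * False by (auto simp: lookup_component homog_def) (metis in_keys_iff)
    qed
    then show ?thesis using False by (auto simp: component_term)
  qed
qed (simp add: algebra_simps component_add)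

subsection \<open>Determinants\<close>

lemma sum_cofactor_mult:
  fixes A :: "'a::comm_ring_1 mat"
  assumes A: "A \<in> carrier_mat n n" and ij: "i < n" "j < n"
  shows "(\<Sum>k<n. cofactor A k i * A $$ (k, j)) = (if i = j then det A else 0)"
proof -
  have "(\<Sum>k<n. cofactor A k i * A $$ (k, j)) = (adj_mat A * A) $$ (i, j)"
    using A ij unfolding times_mat_def scalar_prod_def adj_mat_def
    by (auto simp: atLeast0LessThan intro!: sum.cong)
  also have "\<dots> = (if i = j then det A else 0)"
    using A ij by (subst adj_mat(3)) auto
  finally show ?thesis .
qed

text \<open>Cramer's rule without division, by multiplying the system with the adjugate. It serves
  three systems: the powers of the variables, the divided differences, and the integer matrix of
  multiples.\<close>

lemma det_times_solution:
  fixes A :: "'a::comm_ring_1 mat"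
  assumes A: "A \<in> carrier_mat n n" and j: "j < n"
    and eq: "\<And>i. i < n \<Longrightarrow> (\<Sum>l<n. A $$ (i, l) * v l) = u i"
  shows "det A * v j = (\<Sum>i<n. cofactor A i j * u i)"
proof -
  have "(\<Sum>i<n. cofactor A i j * u i) = (\<Sum>i<n. \<Sum>l<n. cofactor A i j * A $$ (i, l) * v l)"
    by (simp add: eq sum_distrib_left mult.assoc flip: eq)
  also have "\<dots> = (\<Sum>l<n. (\<Sum>i<n. cofactor A i j * A $$ (i, l)) * v l)"
    by (subst sum.swap) (simp add: sum_distrib_right)
  also have "\<dots> = (\<Sum>l<n. if j = l then det A * v l else 0)"
    by (rule sum.cong) (use A j in \<open>auto simp: sum_cofactor_mult\<close>)
  finally show ?thesis using j by simp
qed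

lemma dvd_det_column:
  fixes A :: "'a::comm_ring_1 mat"
  assumes "A \<in> carrier_mat n n" "j < n" "\<And>i. i < n \<Longrightarrow> a dvd A $$ (i, j)"
  shows "a dvd det A"
  using assms by (subst laplace_expansion_column[OF assms(1,2)]) (auto intro!: dvd_sum)

lemma det_scale_columns:
  fixes A :: "nat \<Rightarrow> nat \<Rightarrow> 'a::comm_ring_1"
  shows "det (mat n n (\<lambda>(i, j). A i j * x j)) = det (mat n n (\<lambda>(i, j). A i j)) * (\<Prod>j<n. x j)"
proof -
  have "(\<Prod>i<n. A i (p i) * x (p i)) = (\<Prod>i<n. A i (p i)) * (\<Prod>j<n. x j)" if "p permutes {0..<n}" for p
    using that prod.permute[of p "{..<n}" x] by (simp add: prod.distrib o_def atLeast0LessThan)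
  then show ?thesis
    by (subst (1 2) det_def'[of _ n])
       (auto simp: sum_distrib_right atLeast0LessThan permutes_in_image mult.assoc intro!: sum.cong)
qed

text \<open>Only the diagonal product survives modulo \<open>Q\<close>: this is the transformation law for
  Grothendieck residues in the special case needed here.\<close>
lemma det_row_sums_modulo:
  fixes B :: "nat \<Rightarrow> nat \<Rightarrow> 'a::comm_ring_1" and Q :: "'a set"
  assumes Q: "0 \<in> Q" "\<And>a b. a \<in> Q \<Longrightarrow> b \<in> Q \<Longrightarrow> a + b \<in> Q" "\<And>a c. a \<in> Q \<Longrightarrow> c * a \<in> Q"
    and gx: "\<And>k. k < n \<Longrightarrow> g k * x k \<in> Q"
    and dvd: "\<And>i j. i < n \<Longrightarrow> j < n \<Longrightarrow> x j dvd B i j"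
    and rows: "\<And>i. i < n \<Longrightarrow> h * ((\<Sum>j<n. B i j) - g i) \<in> Q"
  shows "h * (det (mat n n (\<lambda>(i, j). B i j)) - (\<Prod>i<n. g i)) \<in> Q"
  using gx dvd rows
proof (induction n arbitrary: h)
  case 0
  then show ?case using Q(1) by simp
next
  case (Suc n)
  have Qsum: "(\<Sum>i\<in>I. f i) \<in> Q" if "\<And>i. i \<in> I \<Longrightarrow> f i \<in> Q" for I :: "nat set" and f
    using that by (induction I rule: infinite_finite_induct) (auto intro: Q)
  define A where "A = mat (Suc n) (Suc n) (\<lambda>(i, j). B i j)"
  have A: "A \<in> carrier_mat (Suc n) (Suc n)" by (simp add: A_def)
  define c where "c k = cofactor A k n" for k
  \<comment> \<open>Adding all columns to the last one preserves the determinant and puts the row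
    sums there; this is the expansion along that column.\<close>
  have "(\<Sum>k<Suc n. (\<Sum>j<Suc n. B k j) * c k) = (\<Sum>j<Suc n. \<Sum>k<Suc n. c k * A $$ (k, j))"
    by (subst sum.swap)
       (auto simp: sum_distrib_left A_def mult.commute simp del: sum.lessThan_Suc intro!: sum.cong)
  also have "\<dots> = (\<Sum>j<Suc n. if n = j then det A else 0)"
    unfolding c_def by (intro sum.cong refl sum_cofactor_mult[OF A]) auto
  also have "\<dots> = det A" by simp
  finally have det: "det A = (\<Sum>k<Suc n. (\<Sum>j<Suc n. B k j) * c k)" ..
  have md: "mat_delete A n n = mat n n (\<lambda>(i, j). B i j)"
    by (rule eq_matI) (auto simp: mat_delete_def A_def)
  then have cn: "c n = det (mat n n (\<lambda>(i, j). B i j))"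
    by (simp add: c_def cofactor_def flip: mult_2)
  \<comment> \<open>Deleting row k and the last column leaves column k in place, so the minor is
    divisible by \<open>x k\<close>, and \<open>g k\<close> pushes it into Q.\<close>
  have "h * g k * c k \<in> Q" if "k < n" for k
  proof -
    have "x k dvd det (mat_delete A k n)"
      by (rule dvd_det_column[of _ n k])
         (use that Suc.prems in \<open>auto simp: mat_delete_def A_def\<close>)
    then obtain y where "det (mat_delete A k n) = x k * y" ..
    then have "h * g k * c k = (h * (- 1) ^ (k + n) * y) * (g k * x k)"
      by (simp add: c_def cofactor_def mult_ac)
    then show ?thesis using Q(3) Suc.prems(1)[of k] that by simp
  qed
  then have 1: "(\<Sum>k<n. h * g k * c k) \<in> Q" by (intro Qsum) auto
  have 2: "(\<Sum>k<Suc n. c k * (h * ((\<Sum>j<Suc n. B k j) - g k))) \<in> Q"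
    by (intro Qsum Q(3)[OF Suc.prems(3)]) auto
  \<comment> \<open>With the factor \<open>g n\<close>, the last entry of each remaining row falls
    into Q, so the smaller matrix has the right row sums. This is why the multiplier h is
    generalized in the induction.\<close>
  have 3: "(h * g n) * (det (mat n n (\<lambda>(i, j). B i j)) - (\<Prod>i<n. g i)) \<in> Q"
  proof (rule Suc.IH)
    fix i assume i: "i < n"
    obtain y where y: "B i n = x n * y" using Suc.prems(2)[of i n] i by auto
    have "h * g n * ((\<Sum>j<n. B i j) - g i) =
        g n * (h * ((\<Sum>j<Suc n. B i j) - g i)) + (- h * y) * (g n * x n)"
      by (simp add: y algebra_simps)
    then show "h * g n * ((\<Sum>j<n. B i j) - g i) \<in> Q"
      using i by (simp only:) (intro Q(2,3) Suc.prems(1,3), auto)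
  qed (use Suc.prems in auto)
  have "h * (det A - (\<Prod>i<Suc n. g i)) =
      (\<Sum>k<Suc n. c k * (h * ((\<Sum>j<Suc n. B k j) - g k))) + (\<Sum>k<n. h * g k * c k)
      + (h * g n) * (c n - (\<Prod>i<n. g i))"
  proof -
    have "(\<Sum>k<Suc n. c k * (h * ((\<Sum>j<Suc n. B k j) - g k))) = h * det A - (\<Sum>k<Suc n. h * g k * c k)"
      unfolding det sum_distrib_left sum_subtractf[symmetric]
      by (intro sum.cong refl) (simp only: algebra_simps)
    also have "(\<Sum>k<Suc n. h * g k * c k) = (\<Sum>k<n. h * g k * c k) + h * g n * c n" by simp
    finally show ?thesis by (simp add: algebra_simps)
  qed
  then show ?case using 1 2 3 Q(2) unfolding A_def cn by presburger
qed

lemma order_ge_det: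
  fixes A :: "'a::comm_ring_1 mpoly mat"
  assumes A: "A \<in> carrier_mat n n"
    and ord: "\<And>i j. i < n \<Longrightarrow> j < n \<Longrightarrow> order_ge (d j) (A $$ (i, j))"
  shows "order_ge (\<Sum>j<n. d j) (det A)"
proof -
  have sgn: "order_ge 0 (signof p :: 'a mpoly)" for p by simp
  have "order_ge (\<Sum>j<n. d j) (\<Prod>j<n. A $$ (p j, j))" if "p permutes {0..<n}" for p
    by (rule order_ge_prod) (use that ord in \<open>auto simp: permutes_in_image atLeast0LessThan\<close>)
  then have "order_ge (0 + (\<Sum>j<n. d j)) (signof p * (\<Prod>j<n. A $$ (p j, j)))"
    if "p permutes {0..<n}" for p
    by (intro order_ge_mult sgn) (use that in auto)
  then show ?thesis
    unfolding det_col[OF A] by (intro order_ge_sum) auto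
qed

section \<open>Homomorphisms out of polynomial rings, and coefficients of products\<close>

lemma term_of_eq: "term_of m c = cst c * monom_of m"
  by (simp add: mult_single)

lemma comm_ring_hom_cst: "comm_ring_hom (cst :: 'a::comm_ring_1 \<Rightarrow> _)"
  by (rule comm_ring_homI) (auto simp: single_add mult_single)

lemma comm_ring_hom_comp: "comm_ring_hom f \<Longrightarrow> comm_ring_hom g \<Longrightarrow> comm_ring_hom (\<lambda>x. f (g x))"
proof -
  assume "comm_ring_hom f" "comm_ring_hom g"
  then interpret f: comm_ring_hom f + g: comm_ring_hom g by auto
  show ?thesis by (rule comm_ring_homI) (auto simp: hom_distribs)
qed

lemma comm_ring_hom_id: "comm_ring_hom (\<lambda>x. x)"
  by (rule comm_ring_homI) auto

lemma mpoly_hom_eqI: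
  assumes "comm_ring_hom f" "comm_ring_hom g" and p: "in_vars V p"
    and c: "\<And>c. f (cst c) = g (cst c)" and v: "\<And>i. i \<in> V \<Longrightarrow> f (var i) = g (var i)"
  shows "f p = g p"
proof -
  interpret f: comm_ring_hom f by fact
  interpret g: comm_ring_hom g by fact
  have "f (term_of m a) = g (term_of m a)" if "keys m \<subseteq> V" for m a
    using v that unfolding term_of_eq[of m a] monom_of_eq_xmono[of m] xmono_def
    by (auto simp: f.hom_mult g.hom_mult f.hom_prod g.hom_prod f.hom_power g.hom_power c
        intro!: prod.cong arg_cong2[where f = "(*)"])
  then show ?thesis
    using p by (subst (1 2) poly_mapping_eq_sum[of p])
      (auto simp: f.hom_sum g.hom_sum in_vars_def intro!: sum.cong)
qed

lemma in_vars_UNIV [simp]: "in_vars UNIV p"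
  by (simp add: in_vars_def)

lemma in_vars_induct [consumes 1, case_names cst var add mult]:
  fixes p :: "'a::comm_ring_1 mpoly"
  assumes "in_vars V p" and c: "\<And>c. P (cst c)" and v: "\<And>i. i \<in> V \<Longrightarrow> P (var i)"
    and add: "\<And>p q. P p \<Longrightarrow> P q \<Longrightarrow> P (p + q)" and mult: "\<And>p q. P p \<Longrightarrow> P q \<Longrightarrow> P (p * q)"
  shows "P p"
proof -
  have 0: "P 0" using c[of 0] by simp
  have 1: "P 1" using c[of 1] by simp
  have pow: "P (var i ^ k)" if "i \<in> V" for i k
    by (induction k) (auto intro: 1 mult v that)
  have prod: "P (\<Prod>i\<in>S. var i ^ k i)" if "finite S" "S \<subseteq> V" for S k
    using that by (induction S) (auto intro: 1 mult pow)
  have "P (term_of m a)" if "keys m \<subseteq> V" for m a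
    unfolding term_of_eq[of m a] monom_of_eq_xmono[of m] xmono_def by (intro mult c prod finite_keys that)
  moreover have "P (\<Sum>m\<in>S. f m)" if "finite S" "\<And>m. m \<in> S \<Longrightarrow> P (f m)" for S :: "(nat \<Rightarrow>\<^sub>0 nat) set" and f
    using that by (induction S) (auto intro: 0 add)
  ultimately show ?thesis
    using assms(1) by (subst poly_mapping_eq_sum) (auto simp: in_vars_def)
qed

lemma lookup_term_mult: "lookup (term_of u c * p) (u + w) = c * lookup (p :: 'a::comm_ring_1 mpoly) w"
proof (induction p rule: mpoly_induct)
  case (single m c)
  show ?case
    by (auto simp: mult_single lookup_single when_def)
qed (simp add: lookup_add distrib_left)

lemma var_power: "var i ^ k = monom_of (Poly_Mapping.single i k)"
  unfolding monom_of_eq_xmono[of "Poly_Mapping.single i k"] by simp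

lemma single_Suc_neq_0 [simp]: "Poly_Mapping.single i (Suc k) \<noteq> 0"
  by (metis lookup_single_eq lookup_zero nat.distinct(1))

lemma lookup_mult_power_var:
  assumes "lookup w k < N"
  shows "lookup (q * var k ^ N :: 'a::comm_ring_1 mpoly) w = 0"
proof -
  have "w \<notin> keys (q * var k ^ N :: 'a mpoly)"
    using assms by (force dest: in_keys_mult simp: lookup_add var_power)
  then show ?thesis by (simp add: in_keys_iff)
qed

lemma mdeg_eq_0: "mdeg m = 0 \<longleftrightarrow> m = 0"
  by (auto simp: mdeg_def in_keys_iff poly_mapping_eq_iff fun_eq_iff)

subsection \<open>Polynomials in two sets of variables\<close>

text \<open>The coefficients of a polynomial of type \<^typ>\<open>'a mpoly mpoly\<close> are the polynomials in the
  first set of variables.\<close>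

abbreviation in_fst :: "'a::comm_ring_1 mpoly \<Rightarrow> 'a mpoly mpoly" where
  "in_fst \<equiv> cst"

definition in_snd :: "'a::comm_ring_1 mpoly \<Rightarrow> 'a mpoly mpoly" where
  "in_snd = ev (\<lambda>c. cst (cst c)) var"

text \<open>The specialization of the first variables to 0. Applied to divided differences of a form
  of positive degree, it gives cofactors that write the form through the variables.\<close>

definition zero_fst :: "'a::comm_ring_1 mpoly mpoly \<Rightarrow> 'a mpoly" where
  "zero_fst = ev (\<lambda>p. cst (ev (\<lambda>c. c) (\<lambda>_. 0) p)) var"

lemma comm_ring_hom_cst_cst: "comm_ring_hom (\<lambda>c. cst (cst c) :: 'a::comm_ring_1 mpoly mpoly)"
  by (rule comm_ring_hom_comp[OF comm_ring_hom_cst comm_ring_hom_cst])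

lemma comm_ring_hom_in_snd: "comm_ring_hom (in_snd :: 'a::comm_ring_1 mpoly \<Rightarrow> _)"
  unfolding in_snd_def by (intro comm_ring_hom.ev_hom comm_ring_hom_cst_cst)

lemma comm_ring_hom_ev_0: "comm_ring_hom (ev (\<lambda>c. c) (\<lambda>_. 0) :: 'a::comm_ring_1 mpoly \<Rightarrow> _)"
  by (intro comm_ring_hom.ev_hom comm_ring_hom_id)

lemma comm_ring_hom_cst_ev_0:
  "comm_ring_hom (\<lambda>p. cst (ev (\<lambda>c. c) (\<lambda>_. 0) p) :: 'a::comm_ring_1 mpoly)"
  by (rule comm_ring_hom_comp[OF comm_ring_hom_cst comm_ring_hom_ev_0])

lemma comm_ring_hom_zero_fst: "comm_ring_hom (zero_fst :: 'a::comm_ring_1 mpoly mpoly \<Rightarrow> _)"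
  unfolding zero_fst_def by (intro comm_ring_hom.ev_hom comm_ring_hom_cst_ev_0)

lemma in_snd_var [simp]: "in_snd (var i) = var i"
  unfolding in_snd_def by (subst comm_ring_hom.ev_term[OF comm_ring_hom_cst_cst]) simp

lemma in_snd_term: "in_snd (term_of m c) = term_of m (cst c)"
  unfolding in_snd_def
  by (subst comm_ring_hom.ev_term[OF comm_ring_hom_cst_cst])
     (simp add: mult_single flip: monom_of_eq_xmono)

lemma zero_fst_in_fst: "zero_fst (in_fst p) = cst (ev (\<lambda>c. c) (\<lambda>_. 0) p)"
  unfolding zero_fst_def by (subst comm_ring_hom.ev_term[OF comm_ring_hom_cst_ev_0]) simp

lemma zero_fst_var [simp]: "zero_fst (var i) = var i"
proof -
  interpret c: comm_ring_hom "\<lambda>p. cst (ev (\<lambda>c. c) (\<lambda>_. 0) p) :: 'a mpoly"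
    by (rule comm_ring_hom_cst_ev_0)
  show ?thesis unfolding zero_fst_def c.ev_term c.hom_one by simp
qed

lemma ev_0_eq: "ev (\<lambda>c. c) (\<lambda>_. 0) p = lookup p 0"
proof (rule additive_mpoly_eqI[where p = p])
  fix m :: "nat \<Rightarrow>\<^sub>0 nat" and c :: 'a
  show "ev (\<lambda>c. c) (\<lambda>_. 0) (term_of m c) = lookup (term_of m c) 0"
    by (subst comm_ring_hom.ev_term[OF comm_ring_hom_id])
       (auto simp: xmono_def lookup_single when_def power_0_left in_keys_iff)
qed (simp_all add: comm_ring_hom.ev_add[OF comm_ring_hom_id] lookup_add)

lemma zero_fst_in_snd: "zero_fst (in_snd p) = p"
  by (rule mpoly_hom_eqI[where V = UNIV])
     (auto intro!: comm_ring_hom_comp[OF comm_ring_hom_zero_fst comm_ring_hom_in_snd]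
       comm_ring_hom_id simp: in_snd_term[of 0] zero_fst_in_fst ev_0_eq)

text \<open>The property passes to sums, and to products by pq - p'q' = p(q - q') + q'(p - p'), so
  constants and variables suffice. The resulting \<theta> are the entries of the Bezoutian
  matrix.\<close>

lemma divided_differences:
  fixes p :: "'a::comm_ring_1 mpoly"
  assumes "in_vars {..<r} p"
  shows "\<exists>\<theta>. in_fst p - in_snd p = (\<Sum>j<r. \<theta> j * (in_fst (var j) - in_snd (var j)))"
  using assms
proof (induction rule: in_vars_induct)
  case (cst c)
  show ?case by (intro exI[of _ "\<lambda>_. 0"]) (simp add: in_snd_term)
next
  case (var i)
  have "in_fst (var i) - in_snd (var i :: 'a mpoly) =
    (\<Sum>j<r. if j = i then in_fst (var j) - in_snd (var j) else 0)" using var by simp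
  also have "\<dots> = (\<Sum>j<r. (if j = i then 1 else 0) * (in_fst (var j) - in_snd (var j)))"
    by (intro sum.cong) auto
  finally show ?case by (rule exI[of _ "\<lambda>j. if j = i then 1 else 0"])
next
  case (add p q)
  then obtain \<theta> \<theta>' where
    "in_fst p - in_snd p = (\<Sum>j<r. \<theta> j * (in_fst (var j) - in_snd (var j)))"
    "in_fst q - in_snd q = (\<Sum>j<r. \<theta>' j * (in_fst (var j) - in_snd (var j)))" by blast
  then have "in_fst (p + q) - in_snd (p + q) =
      (\<Sum>j<r. (\<theta> j + \<theta>' j) * (in_fst (var j) - in_snd (var j)))"
    unfolding distrib_right sum.distrib
    by (metis (no_types, lifting) add_diff_add single_add
        comm_ring_hom.ev_add[OF comm_ring_hom_cst_cst] in_snd_def)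
  then show ?case by (rule exI[of _ "\<lambda>j. \<theta> j + \<theta>' j"])
next
  case (mult p q)
  then obtain \<theta> \<theta>' where \<theta>:
    "in_fst p - in_snd p = (\<Sum>j<r. \<theta> j * (in_fst (var j) - in_snd (var j)))"
    "in_fst q - in_snd q = (\<Sum>j<r. \<theta>' j * (in_fst (var j) - in_snd (var j)))" by blast
  interpret i: comm_ring_hom "in_snd :: 'a mpoly \<Rightarrow> _" by (rule comm_ring_hom_in_snd)
  interpret c: comm_ring_hom "in_fst :: 'a mpoly \<Rightarrow> _" by (rule comm_ring_hom_cst)
  have "in_fst (p * q) - in_snd (p * q) =
      in_fst p * (in_fst q - in_snd q) + in_snd q * (in_fst p - in_snd p)"
    by (simp add: i.hom_mult c.hom_mult algebra_simps)
  also have "\<dots> = (\<Sum>j<r. (in_fst p * \<theta>' j + in_snd q * \<theta> j) * (in_fst (var j) - in_snd (var j)))"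
    unfolding \<theta> distrib_right sum.distrib sum_distrib_left mult.assoc ..
  finally show ?case by (rule exI[of _ "\<lambda>j. in_fst p * \<theta>' j + in_snd q * \<theta> j"])
qed

locale mpoly_functional =
  fixes l :: "'a::comm_ring_1 mpoly \<Rightarrow> 'a"
  assumes fadd: "l (p + q) = l p + l q" and fscale: "l (cst c * p) = c * l p"
begin

text \<open>The extension of \<open>l\<close> to polynomials in two sets of variables that is linear over the
  polynomials in the first set.\<close>
definition ext :: "'a mpoly mpoly \<Rightarrow> 'a mpoly" where
  "ext P = (\<Sum>m\<in>keys P. lookup P m * cst (l (monom_of m)))"

lemma ext_superset: "finite S \<Longrightarrow> keys P \<subseteq> S \<Longrightarrow> ext P = (\<Sum>m\<in>S. lookup P m * cst (l (monom_of m)))"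
  unfolding ext_def by (rule sum.mono_neutral_left) (auto simp: in_keys_iff)

lemma ext_add: "ext (P + Q) = ext P + ext Q"
proof -
  let ?S = "keys P \<union> keys Q"
  have "keys (P + Q) \<subseteq> ?S" by (rule keys_add)
  then show ?thesis
    by (simp add: ext_superset[of ?S] lookup_add algebra_simps sum.distrib)
qed

lemma ext_0 [simp]: "ext 0 = 0"
  by (simp add: ext_def)

lemma ext_diff: "ext (P - Q) = ext P - ext Q"
  using ext_add[of "P - Q" Q] by simp

lemma ext_sum: "ext (\<Sum>i\<in>A. f i) = (\<Sum>i\<in>A. ext (f i))"
  by (induction A rule: infinite_finite_induct) (auto simp: ext_add)

lemma ext_term: "ext (term_of m a) = a * cst (l (monom_of m))"
  by (simp add: ext_def)

lemma ext_in_fst: "ext (in_fst a * P) = a * ext P"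
  by (induction P rule: mpoly_induct) (simp_all add: mult_single ext_term ext_add algebra_simps)

lemma ext_in_snd: "ext (in_snd p) = cst (l p)"
proof (induction p rule: mpoly_induct)
  case (single m c)
  have "l (term_of m c) = c * l (monom_of m)"
    using fscale[of c "monom_of m"] by (simp flip: term_of_eq)
  then show ?case by (simp add: in_snd_term ext_term mult_single)
next
  case (add p q)
  then show ?case
    by (simp add: ext_add fadd single_add
        comm_ring_hom.ev_add[OF comm_ring_hom_cst_cst] in_snd_def)
qed

text \<open>Every term splits into a coefficient in the first variables, which \<open>ext\<close>
  lets through, and a polynomial in the second ones, where the hypothesis on l applies.\<close>

lemma ext_in_snd_mult_eq_0:
  assumes "\<And>h. l (p * h) = 0"
  shows "ext (in_snd p * P) = 0"
proof (induction P rule: mpoly_induct)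
  case (single m a)
  interpret i: comm_ring_hom "in_snd :: 'a mpoly \<Rightarrow> _" by (rule comm_ring_hom_in_snd)
  have "in_snd p * term_of m a = in_fst a * in_snd (p * monom_of m)"
    by (simp add: i.hom_mult in_snd_term term_of_eq[of m a] mult_ac)
  then show ?case using assms by (simp add: ext_in_fst ext_in_snd)
qed (simp add: distrib_left ext_add)

text \<open>Setting the first variables to 0 commutes with applying l to the second ones. This makes
  the constant term of an extended Bezoutian computable.\<close>

lemma lookup_ext_0: "lookup (ext P) 0 = l (zero_fst P)"
proof -
  interpret z: comm_ring_hom "zero_fst :: 'a mpoly mpoly \<Rightarrow> _" by (rule comm_ring_hom_zero_fst)
  show ?thesis
  proof (induction P rule: mpoly_induct)
    case (single m a)
    have "term_of m a = in_fst a * in_snd (monom_of m)"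
      by (simp add: in_snd_term mult_single)
    then have "zero_fst (term_of m a) = cst (lookup a 0) * monom_of m"
      by (simp only: z.hom_mult zero_fst_in_fst zero_fst_in_snd ev_0_eq)
    then show ?case
      using lookup_term_mult[of 0 "l (monom_of m)" a 0]
      by (simp add: ext_term fscale mult.commute[of a] mult.commute[of "lookup a 0"])
  next
    case (add P Q)
    then show ?case
      by (simp add: ext_add lookup_add fadd z.hom_add)
  qed
qed

end

subsection \<open>Macaulay's theorem\<close>

text \<open>The diagonal matrix with entries \<open>var i ^ (N - 1)\<close> solves the system and
  has the claimed coefficient. The preceding lemma on row sums shows that every other solution has
  the same one.\<close>

lemma det_solution_residue:
  fixes A :: "nat \<Rightarrow> nat \<Rightarrow> 'a::comm_ring_1 mpoly"
  assumes N: "N \<ge> 1" and eq: "\<And>i. i < r \<Longrightarrow> (\<Sum>j<r. A i j * var j) = var i ^ N"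
  shows "lookup (det (mat r r (\<lambda>(i, j). A i j))) (\<Sum>i<r. Poly_Mapping.single i (N - 1)) = 1"
proof -
  define w where "w = (\<Sum>i<r. Poly_Mapping.single i (N - 1))"
  define u where "u = (\<Sum>i<r. Poly_Mapping.single i (1::nat))"
  define W where "W = (\<Sum>i<r. Poly_Mapping.single i N)"
  have W: "W = u + w"
    unfolding W_def u_def w_def sum.distrib[symmetric] single_add[symmetric] using N by simp
  have lookup_W: "lookup W k \<le> N" for k
    by (simp add: W_def lookup_sum lookup_single when_def)
  have prod: "(\<Prod>i<r. var i ^ K :: 'a mpoly) = monom_of (\<Sum>i<r. Poly_Mapping.single i K)" for K
    by (induction r) (simp_all add: var_power mult_single)
  \<comment> \<open>The ideal generated by the powers \<open>var k ^ (N + 1)\<close>. The monomial W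
    has all exponents at most N, so its coefficient can be read modulo Q.\<close>
  define Q :: "'a mpoly set" where "Q = {p. \<forall>m\<in>keys p. \<exists>k. N < lookup m k}"
  have "1 * (det (mat r r (\<lambda>(i, j). A i j * var j)) - (\<Prod>i<r. var i ^ N)) \<in> Q"
  proof (rule det_row_sums_modulo[where x = var])
    show "0 \<in> Q" by (simp add: Q_def)
    show "a + b \<in> Q" if "a \<in> Q" "b \<in> Q" for a b
      using that unfolding Q_def by (auto dest!: in_keys_add)
    show "c * a \<in> Q" if "a \<in> Q" for a c
      using that unfolding Q_def by (fastforce dest!: in_keys_mult simp: lookup_add intro: trans_less_add2)
    show "var k ^ N * var k \<in> Q" for k
    proof -
      have "var k ^ N * var k = (monom_of (Poly_Mapping.single k (Suc N)) :: 'a mpoly)"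
        by (simp add: var_power mult_single flip: single_add)
      then show ?thesis by (auto simp: Q_def intro!: exI[of _ k])
    qed
    show "1 * ((\<Sum>j<r. A i j * var j) - var i ^ N) \<in> Q" if "i < r" for i
      using that by (simp add: eq Q_def)
  qed auto
  then have "\<exists>k. N < lookup W k" if "W \<in> keys (det (mat r r (\<lambda>(i, j). A i j * var j)) - (\<Prod>i<r. var i ^ N))"
    using that by (simp add: Q_def)
  then have "W \<notin> keys (det (mat r r (\<lambda>(i, j). A i j * var j)) - (\<Prod>i<r. var i ^ N))"
    using lookup_W by (meson not_less)
  then have "lookup (det (mat r r (\<lambda>(i, j). A i j * var j))) W = 1"
    by (simp add: in_keys_iff lookup_minus prod flip: W_def)
  also have "det (mat r r (\<lambda>(i, j). A i j * var j)) = monom_of u * det (mat r r (\<lambda>(i, j). A i j))"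
    unfolding det_scale_columns using prod[of 1] by (simp add: u_def mult.commute)
  finally show ?thesis
    unfolding W lookup_term_mult by (simp add: w_def)
qed

text \<open>The cofactors are required to be homogeneous and in the first r variables because they
  are later expanded into monomial multiples of the \<open>F i\<close>.\<close>

theorem macaulay:
  fixes F :: "nat \<Rightarrow> 'a::comm_ring_1 mpoly" and r :: nat and dg :: "nat \<Rightarrow> nat"
  assumes F: "\<And>i. i < r \<Longrightarrow> homog (dg i) (F i)" "\<And>i. i < r \<Longrightarrow> in_vars {..<r} (F i)"
    and dg: "\<And>i. i < r \<Longrightarrow> dg i \<ge> 1"
    and nil: "\<And>j. j < r \<Longrightarrow> \<exists>N h. var j ^ N = (\<Sum>i<r. h i * F i)"
    and m: "keys m \<subseteq> {..<r}" "(\<Sum>i<r. dg i - 1) < mdeg m"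
  shows "\<exists>h. (\<forall>i<r. homog (mdeg m - dg i) (h i) \<and> in_vars {..<r} (h i)) \<and>
    monom_of m = (\<Sum>i<r. h i * F i)"
proof -
  obtain N0 h0 where h0: "\<And>j. j < r \<Longrightarrow> var j ^ N0 j = (\<Sum>i<r. h0 j i * F i)"
    using nil by metis
  \<comment> \<open>One exponent for all variables, large enough for every given power and every
    degree, and positive so that N - 1 is a genuine predecessor.\<close>
  define N where "N = 1 + (\<Sum>j<r. N0 j) + (\<Sum>i<r. dg i)"
  have N: "N0 j \<le> N" "dg j \<le> N" if "j < r" for j
    using that member_le_sum[of j "{..<r}" N0] member_le_sum[of j "{..<r}" dg] by (auto simp: N_def)
  define M' where "M' j i = component (N - dg i) (var j ^ (N - N0 j) * h0 j i)" for j i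
  have M'_homog: "homog (N - dg i) (M' j i)" for i j
    by (simp add: M'_def homog_component)
  have M'F: "(\<Sum>i<r. M' j i * F i) = var j ^ N" if j: "j < r" for j
  proof -
    have "var j ^ N = (\<Sum>i<r. (var j ^ (N - N0 j) * h0 j i) * F i)"
      using N[OF j] by (simp add: mult.assoc flip: sum_distrib_left power_add h0[OF j])
    moreover have "homog N (var j ^ N :: 'a mpoly)"
      by (simp add: var_power)
    ultimately have "var j ^ N = component N (\<Sum>i<r. (var j ^ (N - N0 j) * h0 j i) * F i)"
      by (simp add: component_homog)
    also have "\<dots> = (\<Sum>i<r. M' j i * F i)"
      unfolding component_sum M'_def
      by (intro sum.cong refl) (use N in \<open>auto simp: component_mult_homog[OF F(1)]\<close>)
    finally show ?thesis ..
  qed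
  have "\<forall>i. \<exists>\<theta>. i < r \<longrightarrow> in_fst (F i) - in_snd (F i) = (\<Sum>j<r. \<theta> j * (in_fst (var j) - in_snd (var j)))"
    using divided_differences[OF F(2)] by blast
  from choice[OF this] obtain \<Theta> where
    \<Theta>: "\<And>i. i < r \<Longrightarrow> in_fst (F i) - in_snd (F i) = (\<Sum>j<r. \<Theta> i j * (in_fst (var j) - in_snd (var j)))"
    by blast
  \<comment> \<open>At first variables 0 the difference for \<open>F i\<close> becomes
    \<open>- F i\<close>, and that for \<open>var j\<close> becomes \<open>- var j\<close>; the
    signs cancel, and M writes the forms through the variables.\<close>
  define M where "M i j = zero_fst (\<Theta> i j)" for i j
  interpret z: comm_ring_hom "zero_fst :: 'a mpoly mpoly \<Rightarrow> _" by (rule comm_ring_hom_zero_fst)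
  interpret s: comm_ring_hom "in_snd :: 'a mpoly \<Rightarrow> _" by (rule comm_ring_hom_in_snd)
  have FM: "F i = (\<Sum>j<r. M i j * var j)" if i: "i < r" for i
  proof -
    have 0: "lookup (F i) 0 = 0"
      using F(1)[OF i] dg[OF i] by (force simp: homog_def in_keys_iff)
    have "zero_fst (in_fst (F i) - in_snd (F i)) = - F i"
      by (simp add: z.hom_minus zero_fst_in_fst zero_fst_in_snd ev_0_eq 0)
    moreover have "zero_fst (in_fst (var j) - in_snd (var j)) = - (var j :: 'a mpoly)" for j
      by (simp only: z.hom_minus zero_fst_in_fst zero_fst_in_snd ev_0_eq)
         (simp add: lookup_single when_def)
    ultimately show ?thesis
      unfolding \<Theta>[OF i] by (simp add: z.hom_sum z.hom_mult M_def sum_negf del: in_snd_var)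
  qed
  define A' where "A' = mat r r (\<lambda>(j, i). M' j i)"
  define A where "A = mat r r (\<lambda>(i, j). M i j)"
  have A: "A' \<in> carrier_mat r r" "A \<in> carrier_mat r r" by (simp_all add: A_def A'_def)
  define w :: "nat \<Rightarrow>\<^sub>0 nat" where "w = (\<Sum>i<r. Poly_Mapping.single i (N - 1))"
  have lookup_w: "lookup w k < N" if "k < r" for k
    using that N_def by (simp add: w_def lookup_sum lookup_single when_def)
  have mdeg_w: "mdeg w = (\<Sum>i<r. N - 1)"
    unfolding w_def by (induction r) auto
  \<comment> \<open>This functional plays the role of the residue with respect to the forms.\<close>
  define l where "l p = lookup (det A' * p) w" for p
  interpret mpoly_functional l
  proof
    show "l (p + q) = l p + l q" for p q
      by (simp add: l_def distrib_left lookup_add)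
    show "l (cst c * p) = c * l p" for c p
      using lookup_term_mult[of 0 c "det A' * p" w] by (simp add: l_def mult.left_commute)
  qed
  have l_F: "l (F i * h) = 0" if i: "i < r" for i h
  proof -
    \<comment> \<open>By Cramer the product lies in the ideal of the N-th powers, whose members have
      no coefficient at w, where all exponents are N - 1.\<close>
    have *: "det A' * F i = (\<Sum>k<r. cofactor A' k i * var k ^ N)"
      by (rule det_times_solution[OF A(1) i]) (use M'F in \<open>simp add: A'_def\<close>)
    have "(det A' * F i) * h = (\<Sum>k<r. (cofactor A' k i * h) * var k ^ N)"
      unfolding * sum_distrib_right by (intro sum.cong refl) (simp only: mult_ac)
    then show ?thesis
      by (simp add: l_def lookup_sum lookup_mult_power_var lookup_w flip: mult.assoc)
  qed
  have l_order: "l p = 0" if p: "order_ge (mdeg m) p" for p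
  proof -
    \<comment> \<open>Column i of A' has degree \<open>N - dg i\<close>. Since m has degree greater
      than the sum of the \<open>dg i - 1\<close>, the product only contains degrees above that of
      w.\<close>
    have "order_ge ((\<Sum>i<r. N - dg i) + mdeg m) (det A' * p)"
      by (intro order_ge_mult p order_ge_det[OF A(1)])
         (use M'_homog in \<open>auto simp: A'_def intro: homog_imp_order_ge\<close>)
    moreover have "(\<Sum>i<r. N - dg i) + (\<Sum>i<r. dg i - 1) = mdeg w"
      unfolding mdeg_w sum.distrib[symmetric] using N dg by (intro sum.cong) fastforce+
    ultimately show ?thesis
      using m(2) by (force simp: l_def order_ge_def in_keys_iff)
  qed
  have l_detM: "l (det A) = 1"
  proof -
    have "A' * A = mat r r (\<lambda>(i, j). \<Sum>k<r. M' i k * M k j)"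
      by (rule eq_matI) (auto simp: A_def A'_def scalar_prod_def atLeast0LessThan)
    moreover have "(\<Sum>j<r. (\<Sum>k<r. M' i k * M k j) * var j) = var i ^ N" if "i < r" for i
    proof -
      have "(\<Sum>j<r. (\<Sum>k<r. M' i k * M k j) * var j) = (\<Sum>k<r. M' i k * (\<Sum>j<r. M k j * var j))"
        unfolding sum_distrib_right sum_distrib_left mult.assoc by (rule sum.swap)
      then show ?thesis using FM M'F[OF that] by simp
    qed
    ultimately have "lookup (det (A' * A)) w = 1"
      unfolding w_def by (simp only:) (rule det_solution_residue, auto simp: N_def)
    then show ?thesis by (simp add: det_mult[OF A] l_def)
  qed
  define D where "D = det (mat r r (\<lambda>(i, j). \<Theta> i j))"
  have zD: "zero_fst D = det A"
    unfolding D_def A_def M_def z.hom_det[symmetric]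
    by (rule arg_cong[of _ _ det], rule eq_matI) auto
  define g :: "'a mpoly" where "g = monom_of m"
  obtain \<theta> where \<theta>: "in_fst g - in_snd g = (\<Sum>j<r. \<theta> j * (in_fst (var j) - in_snd (var j)))"
    using divided_differences[of r g] m(1) by (auto simp: g_def)
  define K where "K i = (\<Sum>j<r. \<theta> j * cofactor (mat r r (\<lambda>(i, j). \<Theta> i j)) i j)" for i
  \<comment> \<open>The Bezoutian determinant D exchanges the differences of variables for
    differences of the forms, by Cramer's rule.\<close>
  have "(in_fst g - in_snd g) * D = (\<Sum>j<r. \<theta> j * (D * (in_fst (var j) - in_snd (var j))))"
    unfolding \<theta> sum_distrib_right by (intro sum.cong) (simp_all only: mult_ac)
  also have "\<dots> = (\<Sum>j<r. \<theta> j * (\<Sum>i<r. cofactor (mat r r (\<lambda>(i, j). \<Theta> i j)) i j * (in_fst (F i) - in_snd (F i))))"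
    unfolding D_def by (intro sum.cong refl arg_cong2[where f = "(*)"] det_times_solution)
      (use \<Theta> in auto)
  also have "\<dots> = (\<Sum>i<r. K i * (in_fst (F i) - in_snd (F i)))"
    unfolding K_def sum_distrib_left sum_distrib_right mult.assoc by (rule sum.swap)
  finally have "ext (in_fst g * D) - ext (in_snd g * D) =
      (\<Sum>i<r. ext (in_fst (F i) * K i) - ext (in_snd (F i) * K i))"
    by (simp add: algebra_simps flip: ext_diff ext_sum)
  moreover have "ext (in_snd g * D) = 0"
    by (intro ext_in_snd_mult_eq_0 l_order)
       (use order_ge_mult[of "mdeg m" g 0] in \<open>simp add: g_def\<close>)
  moreover have "ext (in_snd (F i) * K i) = 0" if "i < r" for i
    by (intro ext_in_snd_mult_eq_0 l_F that)
  \<comment> \<open>Both contributions of the second variables are killed: g by its degree, the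
    forms because l vanishes on their ideal. Thus \<open>g * ext D\<close> lies in the
    ideal.\<close>
  ultimately have gL: "g * ext D = (\<Sum>i<r. F i * ext (K i))"
    by (simp add: ext_in_fst)
  \<comment> \<open>The cofactors given by \<open>nil\<close> may involve further variables; \<pi>
    sends these to 0 and fixes g and the forms.\<close>
  define \<pi> :: "'a mpoly \<Rightarrow> 'a mpoly" where "\<pi> = ev cst (\<lambda>i. if i < r then var i else 0)"
  interpret p: comm_ring_hom \<pi>
    unfolding \<pi>_def by (intro comm_ring_hom.ev_hom comm_ring_hom_cst)
  have \<pi>_cst: "\<pi> (cst c) = cst c" and \<pi>_var: "\<pi> (var i) = (if i < r then var i else 0)" for c i
    unfolding \<pi>_def comm_ring_hom.ev_term[OF comm_ring_hom_cst] by simp_all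
  have \<pi>_id: "\<pi> q = q" if "in_vars {..<r} q" for q
    by (rule mpoly_hom_eqI[OF p.comm_ring_hom_axioms comm_ring_hom_id that]) (auto simp: \<pi>_cst \<pi>_var)
  have \<pi>_vars: "in_vars {..<r} (\<pi> q)" for q
    unfolding \<pi>_def ev_def xmono_def by (intro in_vars_sum in_vars_mult in_vars_prod in_vars_power) auto
  have \<pi>_0: "lookup (\<pi> q) 0 = lookup q 0" for q
    using mpoly_hom_eqI[OF comm_ring_hom_comp[OF comm_ring_hom_ev_0 p.comm_ring_hom_axioms]
        comm_ring_hom_ev_0 in_vars_UNIV, of q]
    by (simp add: \<pi>_cst \<pi>_var ev_0_eq lookup_single when_def)
  have "\<pi> (ext D) * g = (\<Sum>i<r. \<pi> (ext (K i)) * F i)"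
    using arg_cong[OF gL, of \<pi>] m(1) F(2) by (simp add: p.hom_mult p.hom_sum \<pi>_id g_def mult.commute)
  \<comment> \<open>Since \<open>ext D\<close> has constant term \<open>l (det A) = 1\<close>, the
    part of degree \<open>mdeg m\<close> on the left is g itself.\<close>
  then have "component (mdeg m) (\<pi> (ext D) * g) = component (mdeg m) (\<Sum>i<r. \<pi> (ext (K i)) * F i)"
    by simp
  also have "component (mdeg m) (\<pi> (ext D) * g) = component 0 (\<pi> (ext D)) * g"
    by (subst component_mult_homog[of "mdeg m"]) (auto simp: g_def)
  also have "component 0 (\<pi> (ext D)) = 1"
    by (rule poly_mapping_eqI)
       (auto simp: lookup_component \<pi>_0 lookup_ext_0 zD l_detM lookup_one when_def mdeg_eq_0)
  finally have "g = (\<Sum>i<r. component (mdeg m) (\<pi> (ext (K i)) * F i))"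
    by (simp add: component_sum)
  also have "\<dots> = (\<Sum>i<r. (if dg i \<le> mdeg m then component (mdeg m - dg i) (\<pi> (ext (K i))) else 0) * F i)"
    by (intro sum.cong refl) (auto simp: component_mult_homog[OF F(1)])
  finally show ?thesis
    unfolding g_def
    by (rule exI[of _ "\<lambda>i. if dg i \<le> mdeg m then component (mdeg m - dg i) (\<pi> (ext (K i))) else 0", OF conjI, rotated])
       (auto simp: homog_component intro!: in_vars_component \<pi>_vars)
qed

subsection \<open>Zeros of ideals\<close>

definition is_ideal :: "'a::comm_ring_1 set \<Rightarrow> bool" where
  "is_ideal I \<longleftrightarrow> 0 \<in> I \<and> (\<forall>a\<in>I. \<forall>b\<in>I. a + b \<in> I) \<and> (\<forall>a\<in>I. \<forall>c. c * a \<in> I)"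

definition is_prime_ideal :: "'a::comm_ring_1 set \<Rightarrow> bool" where
  "is_prime_ideal I \<longleftrightarrow> is_ideal I \<and> 1 \<notin> I \<and> (\<forall>a b. a * b \<in> I \<longrightarrow> a \<in> I \<or> b \<in> I)"

lemma is_idealD:
  assumes "is_ideal I"
  shows "0 \<in> I" "a \<in> I \<Longrightarrow> b \<in> I \<Longrightarrow> a + b \<in> I" "a \<in> I \<Longrightarrow> c * a \<in> I" "a \<in> I \<Longrightarrow> a * c \<in> I"
    "a \<in> I \<Longrightarrow> b \<in> I \<Longrightarrow> a - b \<in> I"
proof -
  show "0 \<in> I" "a \<in> I \<Longrightarrow> b \<in> I \<Longrightarrow> a + b \<in> I" "a \<in> I \<Longrightarrow> c * a \<in> I" for a b c
    using assms unfolding is_ideal_def by blast+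
  then show "a \<in> I \<Longrightarrow> a * c \<in> I" "a \<in> I \<Longrightarrow> b \<in> I \<Longrightarrow> a - b \<in> I"
    by (metis mult.commute, metis diff_conv_add_uminus mult_minus1)
qed

lemma is_ideal_sum: "is_ideal I \<Longrightarrow> (\<And>i. i \<in> A \<Longrightarrow> f i \<in> I) \<Longrightarrow> (\<Sum>i\<in>A. f i) \<in> I"
  by (induction A rule: infinite_finite_induct) (auto simp: is_idealD)

lemma is_prime_ideal_power:
  assumes "is_prime_ideal I" "a \<notin> I"
  shows "a ^ k \<notin> I"
  using assms by (induction k) (auto simp: is_prime_ideal_def)

text \<open>An ideal maximal among those that contain I and avoid the powers of x is prime: two
  elements outside it each put a power of x into the enlarged ideal, and the product of these powers
  would lie in it if the product of the elements did.\<close>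

lemma exists_prime_ideal:
  assumes I: "is_ideal I" and x: "\<And>k. x ^ k \<notin> I"
  shows "\<exists>P. is_prime_ideal P \<and> I \<subseteq> P \<and> x \<notin> P"
proof -
  define \<C> where "\<C> = {J. is_ideal J \<and> I \<subseteq> J \<and> (\<forall>k. x ^ k \<notin> J)}"
  have "\<exists>M\<in>\<C>. \<forall>J\<in>\<C>. M \<subseteq> J \<longrightarrow> J = M"
  proof (rule subset_Zorn_nonempty)
    show "\<C> \<noteq> {}" using I x by (auto simp: \<C>_def)
    fix C assume C: "C \<noteq> {}" "subset.chain \<C> C"
    have tot: "J \<subseteq> J' \<or> J' \<subseteq> J" if "J \<in> C" "J' \<in> C" for J J'
      using C(2) that by (auto simp: subset.chain_def)
    have CC: "C \<subseteq> \<C>" using C(2) by (simp add: subset.chain_def)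
    have "is_ideal (\<Union>C)"
      unfolding is_ideal_def
    proof (intro conjI ballI allI)
      show "0 \<in> \<Union>C"
      proof -
        obtain J where "J \<in> C" using C(1) by auto
        then show ?thesis using CC is_idealD(1)[of J] by (auto simp: \<C>_def)
      qed
      show "c * a \<in> \<Union>C" if "a \<in> \<Union>C" for a c
        using that CC by (auto simp: \<C>_def intro: is_idealD(3))
      show "a + b \<in> \<Union>C" if "a \<in> \<Union>C" "b \<in> \<Union>C" for a b
      proof -
        obtain J J' where J: "J \<in> C" "a \<in> J" "J' \<in> C" "b \<in> J'" using \<open>a \<in> \<Union>C\<close> \<open>b \<in> \<Union>C\<close> by auto
        then obtain K where "K \<in> C" "a \<in> K" "b \<in> K" using tot[of J J'] by blast
        moreover from this(1) have "is_ideal K" using CC by (auto simp: \<C>_def)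
        ultimately show ?thesis using is_idealD(2) by blast
      qed
    qed
    then show "\<Union>C \<in> \<C>" using C CC by (auto simp: \<C>_def)
  qed
  then obtain M where M: "is_ideal M" "I \<subseteq> M" "\<And>k. x ^ k \<notin> M"
    and max: "\<And>J. is_ideal J \<Longrightarrow> M \<subseteq> J \<Longrightarrow> (\<And>k. x ^ k \<notin> J) \<Longrightarrow> J = M"
    by (auto simp: \<C>_def)
  have grow: "\<exists>k m c. m \<in> M \<and> x ^ k = m + c * a" if a: "a \<notin> M" for a
  proof (rule ccontr)
    assume contra: "\<not> ?thesis"
    define J where "J = {m + c * a |m c. m \<in> M}"
    have "is_ideal J"
      unfolding is_ideal_def
    proof (intro conjI ballI allI)
      show "0 \<in> J" using is_idealD(1)[OF M(1)] by (force simp: J_def intro: exI[of _ 0])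
      show "p + q \<in> J" if pq: "p \<in> J" "q \<in> J" for p q
      proof -
        obtain m c m' c' where *: "p = m + c * a" "q = m' + c' * a" "m \<in> M" "m' \<in> M"
          using pq by (auto simp: J_def)
        then have "p + q = (m + m') + (c + c') * a" by (simp add: algebra_simps)
        then show ?thesis using is_idealD(2)[OF M(1) *(3,4)] unfolding J_def by blast
      qed
      show "d * p \<in> J" if p: "p \<in> J" for p d
      proof -
        obtain m c where *: "p = m + c * a" "m \<in> M" using p by (auto simp: J_def)
        then have "d * p = d * m + (d * c) * a" by (simp add: algebra_simps)
        then show ?thesis using is_idealD(3)[OF M(1) *(2)] unfolding J_def by blast
      qed
    qed
    moreover have "M \<subseteq> J" by (force simp: J_def intro: exI[of _ 0])
    ultimately have "J = M" by (rule max) (use contra in \<open>auto simp: J_def\<close>)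
    moreover have "a \<in> J" using is_idealD(1)[OF M(1)] by (force simp: J_def intro: exI[of _ 0] exI[of _ 1])
    ultimately show False using a by simp
  qed
  have "is_prime_ideal M"
    unfolding is_prime_ideal_def
  proof (intro conjI allI impI)
    show "1 \<notin> M" using M(3)[of 0] by simp
    show "a \<in> M \<or> b \<in> M" if ab: "a * b \<in> M" for a b
    proof (rule ccontr)
      assume "\<not> ?thesis"
      then obtain k m c k' m' c' where *: "m \<in> M" "x ^ k = m + c * a" "m' \<in> M" "x ^ k' = m' + c' * b"
        using grow by metis
      then have "x ^ (k + k') = (m' + c' * b) * m + (c * a) * m' + (c * c') * (a * b)"
        by (simp add: power_add algebra_simps)
      then have "x ^ (k + k') \<in> M" using * ab is_idealD(2,3)[OF M(1)] by metis
      then show False using M(3) by blast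
    qed
  qed (fact M(1))
  moreover have "x \<notin> M" using M(3)[of 1] by simp
  ultimately show ?thesis using M(2) by blast
qed

section \<open>Extending a homomorphism by one element modulo a prime ideal\<close>

lemma (in comm_ring_hom) hom_poly: "hom (poly p x) = poly (map_poly hom p) (hom x)"
  by (induction p) (simp_all add: map_poly_pCons hom_distribs)

text \<open>The argument concerns the domain A modulo P. Instead of forming this quotient, elements
  of the ambient ring are kept and "nonzero" is expressed as "outside P".\<close>

locale prime_over_subring =
  fixes A P :: "'a::comm_ring_1 set"
  assumes A: "0 \<in> A" "1 \<in> A" "\<And>a b. a \<in> A \<Longrightarrow> b \<in> A \<Longrightarrow> a - b \<in> A"
      "\<And>a b. a \<in> A \<Longrightarrow> b \<in> A \<Longrightarrow> a + b \<in> A" "\<And>a b. a \<in> A \<Longrightarrow> b \<in> A \<Longrightarrow> a * b \<in> A"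
    and P: "is_prime_ideal P"
begin

lemma ideal: "is_ideal P"
  using P by (simp add: is_prime_ideal_def)

lemmas idealD = is_idealD[OF ideal]

definition polys :: "'a set \<Rightarrow> 'a poly set" where
  "polys S = {p. \<forall>i. poly.coeff p i \<in> S}"

lemma A_sum: "(\<And>i. i \<in> I \<Longrightarrow> f i \<in> A) \<Longrightarrow> (\<Sum>i\<in>I. f i) \<in> A"
  by (induction I rule: infinite_finite_induct) (auto simp: A)

lemma A_power: "a \<in> A \<Longrightarrow> a ^ k \<in> A"
  by (induction k) (auto simp: A)

lemma polys_A:
  "0 \<in> polys A" "p \<in> polys A \<Longrightarrow> q \<in> polys A \<Longrightarrow> p - q \<in> polys A"
  "p \<in> polys A \<Longrightarrow> q \<in> polys A \<Longrightarrow> p + q \<in> polys A"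
  "p \<in> polys A \<Longrightarrow> q \<in> polys A \<Longrightarrow> p * q \<in> polys A"
  "c \<in> A \<Longrightarrow> monom c k \<in> polys A" "c \<in> A \<Longrightarrow> p \<in> polys A \<Longrightarrow> smult c p \<in> polys A"
  "c \<in> A \<Longrightarrow> [:c:] \<in> polys A"
  by (auto simp: polys_def A coeff_mult coeff_pCons intro!: A_sum split: nat.split)

lemma is_ideal_polys: "is_ideal (polys P)"
  unfolding is_ideal_def polys_def coeff_mult
  by (auto simp: coeff_mult intro!: idealD(1,2,3) is_ideal_sum[OF ideal])

lemma poly_in_P: "p \<in> polys P \<Longrightarrow> poly p x \<in> P"
  unfolding poly_altdef polys_def by (auto intro!: idealD is_ideal_sum[OF ideal])

text \<open>Division with remainder in the ideal W over the domain A modulo P. The leading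
  coefficient of g need not be invertible, hence the power of it; by minimality of g the remainder
  vanishes modulo P.\<close>

lemma pseudo_division:
  assumes W: "W \<subseteq> polys A" "\<And>p q. p \<in> W \<Longrightarrow> q \<in> W \<Longrightarrow> p - q \<in> W"
      "\<And>p q. p \<in> polys A \<Longrightarrow> q \<in> W \<Longrightarrow> p * q \<in> W" "polys A \<inter> polys P \<subseteq> W"
    and g: "g \<in> W" and min: "\<And>p. p \<in> W \<Longrightarrow> lead_coeff p \<notin> P \<Longrightarrow> Polynomial.degree g \<le> Polynomial.degree p"
    and p: "p \<in> W"
  shows "\<exists>e q. q \<in> polys A \<and> smult (lead_coeff g ^ e) p - q * g \<in> polys P"
proof -
  define a d where "a = lead_coeff g" and "d = Polynomial.degree g"
  have a: "a \<in> A" using g W(1) by (auto simp: a_def polys_def)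
  \<comment> \<open>Induction on a bound for the support: a top coefficient in P is removed by
    subtracting its monomial, which lies in W; any other one allows a division step.\<close>
  have main: "\<exists>e q. q \<in> polys A \<and> smult (a ^ e) p - q * g \<in> polys P"
    if "p \<in> W" "\<And>i. n \<le> i \<Longrightarrow> poly.coeff p i = 0" for n p
    using that
  proof (induction n arbitrary: p)
    case 0
    then have "p = 0" by (auto intro: poly_eqI)
    then show ?case
      using polys_A(1) is_idealD(1)[OF is_ideal_polys] by (intro exI[of _ 0] exI[of _ "0 :: 'a poly"]) auto
  next
    case (Suc n)
    define c where "c = poly.coeff p n"
    have c: "c \<in> A" using Suc.prems(1) W(1) by (auto simp: c_def polys_def)
    show ?case
    proof (cases "c \<in> P")
      case True
      then have mP: "monom c n \<in> polys P" by (auto simp: polys_def idealD)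
      then have "p - monom c n \<in> W"
        using W(4) c by (intro W(2) Suc.prems(1)) (auto simp: polys_A)
      moreover have "poly.coeff (p - monom c n) i = 0" if "n \<le> i" for i
        using that Suc.prems(2)[of i] by (cases "i = n") (auto simp: c_def)
      ultimately obtain e q where q: "q \<in> polys A" "smult (a ^ e) (p - monom c n) - q * g \<in> polys P"
        using Suc.IH by metis
      have "smult (a ^ e) p - q * g = (smult (a ^ e) (p - monom c n) - q * g) + [:a ^ e:] * monom c n"
        by (simp add: smult_diff_right)
      then show ?thesis
        using q mP is_idealD(2,3)[OF is_ideal_polys] by metis
    next
      case False
      then have "c \<noteq> 0" using idealD(1) by auto
      then have "Polynomial.degree p = n"
        using Suc.prems(2) by (intro antisym degree_le le_degree) (auto simp: c_def)
      with False have dn: "d \<le> n" using min[OF Suc.prems(1)] by (auto simp: c_def d_def)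
      define m where "m = monom c (n - d)"
      have m: "m \<in> polys A" by (simp add: m_def polys_A c)
      have "[:a:] * p - m * g \<in> W"
        by (intro W(2,3) g m Suc.prems(1) polys_A a)
      moreover have "poly.coeff ([:a:] * p - m * g) i = 0" if "n \<le> i" for i
      proof (cases "i = n")
        case True
        then show ?thesis using dn by (simp add: m_def coeff_monom_mult c_def a_def d_def)
      next
        case False
        then have "poly.coeff g (i - (n - d)) = 0"
          using that dn by (intro coeff_eq_0) (auto simp: d_def)
        then show ?thesis
          using that dn False Suc.prems(2)[of i] by (simp add: m_def coeff_monom_mult)
      qed
      ultimately obtain e q where q: "q \<in> polys A" "smult (a ^ e) ([:a:] * p - m * g) - q * g \<in> polys P"
        using Suc.IH by metis
      have "smult (a ^ Suc e) p - (smult (a ^ e) m + q) * g = smult (a ^ e) ([:a:] * p - m * g) - q * g"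
        by (simp add: smult_diff_right algebra_simps)
      moreover have "smult (a ^ e) m + q \<in> polys A"
        by (intro polys_A q m A_power a)
      ultimately show ?thesis using q(2) by metis
    qed
  qed
  show ?thesis
    unfolding a_def[symmetric]
    by (rule main[OF p, of "Suc (Polynomial.degree p)"]) (auto intro: coeff_eq_0)
qed

lemma exists_min_degree:
  assumes "p \<in> W" "lead_coeff p \<notin> P"
  obtains g where "g \<in> W" "lead_coeff g \<notin> P"
    "\<And>q. q \<in> W \<Longrightarrow> lead_coeff q \<notin> P \<Longrightarrow> Polynomial.degree g \<le> Polynomial.degree q"
  using ex_has_least_nat[of "\<lambda>p. p \<in> W \<and> lead_coeff p \<notin> P" p Polynomial.degree] assms by blast

text \<open>Atiyah--Macdonald, Proposition 5.23, for the extension \<open>A[b]\<close> of \<open>A\<close> modulo \<open>P\<close>.\<close>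
lemma extend_hom:
  assumes V: "V \<in> polys A" "poly V b \<notin> P"
  shows "\<exists>u\<in>A - P. \<forall>\<phi> :: 'a \<Rightarrow> 'k::{alg_closed_field, field_char_0}. comm_ring_hom \<phi> \<longrightarrow>
    (\<forall>q\<in>A \<inter> P. \<phi> q = 0) \<longrightarrow> \<phi> u \<noteq> 0 \<longrightarrow>
    (\<exists>\<beta>. (\<forall>p\<in>polys A. poly p b \<in> P \<longrightarrow> poly (map_poly \<phi> p) \<beta> = 0) \<and> poly (map_poly \<phi> V) \<beta> \<noteq> 0)"
proof -
  \<comment> \<open>W0 consists of the relations satisfied by b modulo P, W1 of the polynomials
    whose value at b is a multiple of that of V.\<close>
  define W0 where "W0 = {p \<in> polys A. poly p b \<in> P}"
  define W1 where "W1 = {p \<in> polys A. \<exists>c\<in>polys A. poly p b - poly c b * poly V b \<in> P}"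
  have prime: "x \<in> P \<or> y \<in> P" if "x * y \<in> P" for x y
    using P that by (auto simp: is_prime_ideal_def)
  have pow: "x ^ k \<notin> P" if "x \<notin> P" for x k
    using is_prime_ideal_power[OF P that] .
  have W0: "W0 \<subseteq> polys A" "p \<in> W0 \<Longrightarrow> q \<in> W0 \<Longrightarrow> p - q \<in> W0"
      "p \<in> polys A \<Longrightarrow> q \<in> W0 \<Longrightarrow> p * q \<in> W0" "polys A \<inter> polys P \<subseteq> W0" for p q
    by (auto simp: W0_def polys_A idealD poly_in_P)
  have W1: "W1 \<subseteq> polys A" "p \<in> W1 \<Longrightarrow> q \<in> W1 \<Longrightarrow> p - q \<in> W1"
      "p \<in> polys A \<Longrightarrow> q \<in> W1 \<Longrightarrow> p * q \<in> W1" "polys A \<inter> polys P \<subseteq> W1" for p q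
  proof -
    show "W1 \<subseteq> polys A" by (auto simp: W1_def)
    show "p - q \<in> W1" if pq: "p \<in> W1" "q \<in> W1"
    proof -
      obtain c c' where c: "c \<in> polys A" "poly p b - poly c b * poly V b \<in> P"
        "c' \<in> polys A" "poly q b - poly c' b * poly V b \<in> P" using pq by (auto simp: W1_def)
      have "poly (p - q) b - poly (c - c') b * poly V b =
        (poly p b - poly c b * poly V b) - (poly q b - poly c' b * poly V b)" by (simp add: algebra_simps)
      moreover have "\<dots> \<in> P" by (rule idealD(5)[OF c(2,4)])
      ultimately have "poly (p - q) b - poly (c - c') b * poly V b \<in> P" by (simp only:)
      then show ?thesis
        using pq c polys_A(2) unfolding W1_def by blast
    qed
    show "p * q \<in> W1" if pq: "p \<in> polys A" "q \<in> W1"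
    proof -
      obtain c where c: "c \<in> polys A" "poly q b - poly c b * poly V b \<in> P" using pq by (auto simp: W1_def)
      have "poly (p * q) b - poly (p * c) b * poly V b = poly p b * (poly q b - poly c b * poly V b)"
        by (simp add: algebra_simps)
      moreover have "\<dots> \<in> P" by (rule idealD(3)[OF c(2)])
      ultimately have "poly (p * q) b - poly (p * c) b * poly V b \<in> P" by (simp only:)
      then show ?thesis
        using pq c polys_A(4) unfolding W1_def by blast
    qed
    show "polys A \<inter> polys P \<subseteq> W1"
      by (auto simp: W1_def poly_in_P polys_A intro!: bexI[of _ 0])
  qed
  show ?thesis
  proof (cases "\<exists>g\<in>W0. lead_coeff g \<notin> P")
    \<comment> \<open>b is transcendental over A modulo P: all its relations have coefficients in P.
      Any \<beta> outside the finitely many roots of the image of V will do, and this image is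
      nonzero if \<phi> does not kill a chosen coefficient of V.\<close>
    case False
    have all: "p \<in> polys P" if "p \<in> W0" for p
    proof -
      have main: "p \<in> polys P" if "p \<in> W0" "\<And>i. n \<le> i \<Longrightarrow> poly.coeff p i = 0" for n
        using that
      proof (induction n arbitrary: p)
        case 0
        then show ?case by (auto simp: polys_def idealD)
      next
        case (Suc n)
        define c where "c = poly.coeff p n"
        have "c \<in> P"
        proof (cases "c = 0")
          case False
          then have "Polynomial.degree p = n"
            using Suc.prems(2) by (intro antisym degree_le le_degree) (auto simp: c_def)
          then show ?thesis using \<open>\<not> (\<exists>g\<in>W0. lead_coeff g \<notin> P)\<close> Suc.prems(1) by (auto simp: c_def)
        qed (auto simp: idealD)
        then have mP: "monom c n \<in> polys P" by (auto simp: polys_def idealD)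
        moreover have "c \<in> A" using Suc.prems(1) by (auto simp: c_def W0_def polys_def)
        ultimately have "p - monom c n \<in> W0"
          using W0(4) by (intro W0(2) Suc.prems(1)) (auto simp: polys_A)
        then have "p - monom c n \<in> polys P"
        proof (rule Suc.IH)
          show "poly.coeff (p - monom c n) i = 0" if "n \<le> i" for i
            using that Suc.prems(2)[of i] by (cases "i = n") (auto simp: c_def)
        qed
        then show ?case using is_idealD(2)[OF is_ideal_polys _ mP] by force
      qed
      show ?thesis
        by (rule main[OF that, of "Suc (Polynomial.degree p)"]) (auto intro: coeff_eq_0)
    qed
    obtain i where i: "poly.coeff V i \<notin> P"
      using V(2) poly_in_P[of V] by (auto simp: polys_def)
    show ?thesis
    proof (intro bexI[of _ "poly.coeff V i"] allI impI)
      show "poly.coeff V i \<in> A - P" using V(1) i by (auto simp: polys_def)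
      fix \<phi> :: "'a \<Rightarrow> 'k"
      assume \<phi>: "comm_ring_hom \<phi>" "\<forall>q\<in>A \<inter> P. \<phi> q = 0" "\<phi> (poly.coeff V i) \<noteq> 0"
      interpret comm_ring_hom \<phi> by fact
      have "map_poly \<phi> V \<noteq> 0" using \<phi>(3) by (metis coeff_0 coeff_map_poly hom_zero)
      then obtain \<beta> where "poly (map_poly \<phi> V) \<beta> \<noteq> 0"
        using poly_roots_finite[of "map_poly \<phi> V"] infinite_UNIV_char_0[where 'a = 'k]
        by (metis (mono_tags, lifting) UNIV_eq_I mem_Collect_eq)
      moreover have "poly (map_poly \<phi> p) \<beta> = 0" if "p \<in> polys A" "poly p b \<in> P" for p
      proof -
        have "p \<in> polys P" using all that by (auto simp: W0_def)
        then have "map_poly \<phi> p = 0"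
          using that \<phi>(2) by (intro poly_eqI) (auto simp: coeff_map_poly polys_def)
        then show ?thesis by simp
      qed
      ultimately show "\<exists>\<beta>. (\<forall>p\<in>polys A. poly p b \<in> P \<longrightarrow> poly (map_poly \<phi> p) \<beta> = 0) \<and>
          poly (map_poly \<phi> V) \<beta> \<noteq> 0" by blast
    qed
  next
    \<comment> \<open>b is algebraic over A modulo P, with g playing the role of a minimal
      polynomial.\<close>
    case True
    then obtain g where g: "g \<in> W0" "lead_coeff g \<notin> P"
      and gmin: "\<And>q. q \<in> W0 \<Longrightarrow> lead_coeff q \<notin> P \<Longrightarrow> Polynomial.degree g \<le> Polynomial.degree q"
      using exists_min_degree by metis
    have "W0 \<subseteq> W1" using polys_A(1) by (force simp: W0_def W1_def)
    then obtain f where f: "f \<in> W1" "lead_coeff f \<notin> P"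
      and fmin: "\<And>q. q \<in> W1 \<Longrightarrow> lead_coeff q \<notin> P \<Longrightarrow> Polynomial.degree f \<le> Polynomial.degree q"
      using exists_min_degree[of g W1] g by blast
    have VW: "V \<in> W1"
      using V(1) polys_A(7)[OF A(2)] by (auto simp: W1_def idealD intro!: bexI[of _ 1] simp: one_pCons)
    \<comment> \<open>The value of V at b divides a nonzero constant. Otherwise dividing g by f
      would give a quotient vanishing at b, since f does not vanish there, and of smaller degree
      than g.\<close>
    have deg_f: "Polynomial.degree f = 0"
    proof (rule ccontr)
      assume df: "Polynomial.degree f \<noteq> 0"
      obtain e q where q: "smult (lead_coeff f ^ e) V - q * f \<in> polys P"
        using pseudo_division[OF W1 f(1) fmin VW] by blast
      have fP: "poly f b \<notin> P"
      proof
        assume "poly f b \<in> P"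
        then have "poly q b * poly f b \<in> P" by (rule idealD(3))
        moreover have "lead_coeff f ^ e * poly V b - poly q b * poly f b \<in> P"
          using poly_in_P[OF q, of b] by simp
        ultimately have "lead_coeff f ^ e * poly V b \<in> P" using idealD(2) by fastforce
        then show False using prime pow[OF f(2)] V(2) by fastforce
      qed
      obtain e q where qA: "q \<in> polys A" and q: "smult (lead_coeff f ^ e) g - q * f \<in> polys P"
        using pseudo_division[OF W1 f(1) fmin] g(1) \<open>W0 \<subseteq> W1\<close> by blast
      have "poly q b * poly f b \<in> P"
      proof -
        have "lead_coeff f ^ e * poly g b \<in> P"
          using g(1) by (intro idealD(3)) (auto simp: W0_def)
        moreover have "lead_coeff f ^ e * poly g b - poly q b * poly f b \<in> P"
          using poly_in_P[OF q, of b] by simp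
        ultimately show ?thesis using idealD(5) by fastforce
      qed
      then have qb: "poly q b \<in> P" using prime fP by blast
      define S where "S = {i. poly.coeff q i \<notin> P}"
      have "S \<subseteq> {..Polynomial.degree q}"
        using idealD(1) by (auto simp: S_def intro: le_degree)
      then have finS: "finite S" by (rule finite_subset) simp
      have "S \<noteq> {}"
      proof
        assume "S = {}"
        then have "q * f \<in> polys P"
          using is_idealD(4)[OF is_ideal_polys] by (auto simp: S_def polys_def)
        then have "(smult (lead_coeff f ^ e) g - q * f) + q * f \<in> polys P"
          using q is_idealD(2)[OF is_ideal_polys] by blast
        then have "lead_coeff f ^ e * lead_coeff g \<in> P" by (auto simp: polys_def)
        then show False using prime pow[OF f(2)] g(2) by blast
      qed
      \<comment> \<open>The degree of q modulo P; cutting q off above t gives an honest relation of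
        degree t, to which the minimality of g applies.\<close>
      define t where "t = Max S"
      have t: "poly.coeff q t \<notin> P" using Max_in[OF finS \<open>S \<noteq> {}\<close>] by (simp add: t_def S_def)
      have t': "poly.coeff q i \<in> P" if "t < i" for i
        using Max_ge[OF finS, of i] that by (auto simp: S_def t_def)
      define q' where "q' = poly_cutoff (Suc t) q"
      have q'A: "q' \<in> polys A" using qA A(1) by (auto simp: polys_def q'_def coeff_poly_cutoff)
      have "q - q' \<in> polys P" using t' by (auto simp: polys_def q'_def coeff_poly_cutoff idealD)
      then have "poly q b - poly q' b \<in> P"
        using poly_in_P[of "q - q'" b] by simp
      then have "poly q' b \<in> P" using idealD(5)[OF qb] by fastforce
      then have "q' \<in> W0" using q'A by (simp add: W0_def)
      moreover have dq': "Polynomial.degree q' = t"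
        using t idealD(1) by (intro antisym degree_le le_degree) (auto simp: q'_def coeff_poly_cutoff)
      ultimately have "Polynomial.degree g \<le> t"
        using gmin[of q'] t by (simp add: q'_def coeff_poly_cutoff)
      \<comment> \<open>Modulo P the top coefficient of \<open>q * f\<close> sits at s, but g has no
        coefficient there because s exceeds its degree.\<close>
      define s where "s = t + Polynomial.degree f"
      have "poly.coeff (q * f) s = (\<Sum>i\<le>s. poly.coeff q i * poly.coeff f (s - i))"
        by (simp add: coeff_mult)
      also have "\<dots> = poly.coeff q t * lead_coeff f + (\<Sum>i\<in>{..s} - {t}. poly.coeff q i * poly.coeff f (s - i))"
        by (subst sum.remove[of _ t]) (auto simp: s_def)
      finally have "poly.coeff q t * lead_coeff f =
          poly.coeff (q * f) s - (\<Sum>i\<in>{..s} - {t}. poly.coeff q i * poly.coeff f (s - i))" by simp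
      moreover have "(\<Sum>i\<in>{..s} - {t}. poly.coeff q i * poly.coeff f (s - i)) \<in> P"
      proof (rule is_ideal_sum[OF ideal])
        fix i assume i: "i \<in> {..s} - {t}"
        show "poly.coeff q i * poly.coeff f (s - i) \<in> P"
        proof (cases "i < t")
          case True
          then have "poly.coeff f (s - i) = 0" by (intro coeff_eq_0) (auto simp: s_def)
          then show ?thesis by (simp add: idealD)
        next
          case False
          then show ?thesis using i t'[of i] by (intro idealD(4)) auto
        qed
      qed
      moreover have "poly.coeff (q * f) s \<in> P"
      proof -
        have "poly.coeff g s = 0"
          using \<open>Polynomial.degree g \<le> t\<close> df by (intro coeff_eq_0) (auto simp: s_def)
        then have "- poly.coeff (q * f) s \<in> P" using q by (auto simp: polys_def dest: spec[of _ s])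
        then show ?thesis using idealD(3)[of _ "-1"] by force
      qed
      ultimately have "poly.coeff q t * lead_coeff f \<in> P" using idealD(5) by simp
      then show False using prime t f(2) by blast
    qed
    then obtain c where c: "f = [:c:]" by (metis degree_eq_zeroE)
    have cP: "c \<notin> P" using f(2) by (simp add: c)
    have cA: "c \<in> A" using subsetD[OF W1(1) f(1)] by (auto simp: c polys_def dest: spec[of _ "0::nat"])
    obtain w where w: "w \<in> polys A" "c - poly w b * poly V b \<in> P" using f(1) by (auto simp: W1_def c)
    define a where "a = lead_coeff g"
    have aA: "a \<in> A" using g(1) by (auto simp: a_def W0_def polys_def)
    show ?thesis
    \<comment> \<open>The factor a keeps the degree of g under \<phi>, so that a root \<beta>
      exists; the factor c prevents V from vanishing at \<beta>, as c is a multiple of V modulo the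
      relations.\<close>
    proof (intro bexI[of _ "a * c"] allI impI)
      show "a * c \<in> A - P" using aA cA cP g(2) prime A(5) by (auto simp: a_def)
      fix \<phi> :: "'a \<Rightarrow> 'k"
      assume \<phi>: "comm_ring_hom \<phi>" "\<forall>q\<in>A \<inter> P. \<phi> q = 0" "\<phi> (a * c) \<noteq> 0"
      interpret comm_ring_hom \<phi> by fact
      have \<phi>a: "\<phi> a \<noteq> 0" and \<phi>c: "\<phi> c \<noteq> 0" using \<phi>(3) by (auto simp: hom_mult)
      have mp: "map_poly \<phi> (p - q) = map_poly \<phi> p - map_poly \<phi> q"
        "map_poly \<phi> (p * q) = map_poly \<phi> p * map_poly \<phi> q"
        "map_poly \<phi> (smult x p) = smult (\<phi> x) (map_poly \<phi> p)" for p q x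
        by (auto intro!: poly_eqI simp: coeff_map_poly hom_distribs coeff_mult)
      have kill: "map_poly \<phi> p = 0" if "p \<in> polys A" "p \<in> polys P" for p
        using that \<phi>(2) by (intro poly_eqI) (auto simp: coeff_map_poly polys_def)
      have "Polynomial.degree g \<noteq> 0"
      proof
        assume "Polynomial.degree g = 0"
        then obtain x where "g = [:x:]" by (metis degree_eq_zeroE)
        then show False using g by (simp add: W0_def)
      qed
      moreover have "Polynomial.degree (map_poly \<phi> g) = Polynomial.degree g"
        using \<phi>a by (intro antisym degree_le le_degree) (auto simp: coeff_map_poly a_def coeff_eq_0)
      ultimately obtain \<beta> where \<beta>: "poly (map_poly \<phi> g) \<beta> = 0"
        using alg_closed_imp_poly_has_root[of "map_poly \<phi> g"] by auto
      \<comment> \<open>Up to a power of a, each relation is a multiple of g modulo P.\<close>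
      have zero: "poly (map_poly \<phi> p) \<beta> = 0" if p: "p \<in> W0" for p
      proof -
        obtain e q where q: "q \<in> polys A" "smult (a ^ e) p - q * g \<in> polys P"
          using pseudo_division[OF W0 g(1) gmin p] by (auto simp: a_def)
        have "smult (a ^ e) p - q * g \<in> polys A"
          using p g(1) by (intro polys_A q aA A_power) (auto simp: W0_def)
        then have "map_poly \<phi> (smult (a ^ e) p - q * g) = 0" using q kill by blast
        then have "\<phi> (a ^ e) * poly (map_poly \<phi> p) \<beta> = poly (map_poly \<phi> q) \<beta> * poly (map_poly \<phi> g) \<beta>"
          unfolding mp by (metis poly_0 poly_diff poly_mult poly_smult right_minus_eq)
        then show ?thesis using \<beta> \<phi>a by (simp add: hom_power)
      qed
      have "[:c:] - w * V \<in> W0"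
        using w cA V(1) by (auto simp: W0_def intro!: polys_A)
      from zero[OF this] have "\<phi> c = poly (map_poly \<phi> w) \<beta> * poly (map_poly \<phi> V) \<beta>"
        by (simp add: mp map_poly_pCons)
      then have "poly (map_poly \<phi> V) \<beta> \<noteq> 0" using \<phi>c by auto
      then show "\<exists>\<beta>. (\<forall>p\<in>polys A. poly p b \<in> P \<longrightarrow> poly (map_poly \<phi> p) \<beta> = 0) \<and>
          poly (map_poly \<phi> V) \<beta> \<noteq> 0" using zero by (auto simp: W0_def)
    qed
  qed
qed

end


section \<open>The Nullstellensatz, one variable at a time\<close>

lemma in_vars_Suc_poly:
  fixes p :: "'a::comm_ring_1 mpoly"
  assumes "in_vars {..<Suc n} p"
  shows "\<exists>q. (\<forall>i. in_vars {..<n} (poly.coeff q i)) \<and> p = poly q (var n)"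
  using assms
proof (induction rule: in_vars_induct)
  case (cst c)
  show ?case by (intro exI[of _ "[:cst c:]"]) (auto simp: coeff_pCons split: nat.split)
next
  case (var i)
  show ?case
  proof (cases "i = n")
    case True
    then show ?thesis by (intro exI[of _ "[:0, 1:]"]) (auto simp: coeff_pCons split: nat.split)
  next
    case False
    then show ?thesis using var
      by (intro exI[of _ "[:var i:]"]) (auto simp: coeff_pCons split: nat.split)
  qed
next
  case (add p q)
  then obtain p' q' where "\<forall>i. in_vars {..<n} (poly.coeff p' i)" "p = poly p' (var n)"
    "\<forall>i. in_vars {..<n} (poly.coeff q' i)" "q = poly q' (var n)" by blast
  then show ?case by (intro exI[of _ "p' + q'"]) (auto intro: in_vars_add)
next
  case (mult p q)
  then obtain p' q' where "\<forall>i. in_vars {..<n} (poly.coeff p' i)" "p = poly p' (var n)"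
    "\<forall>i. in_vars {..<n} (poly.coeff q' i)" "q = poly q' (var n)" by blast
  then show ?case
    by (intro exI[of _ "p' * q'"]) (auto simp: coeff_mult intro!: in_vars_sum in_vars_mult)
qed

text \<open>The polynomial v has to vary in the induction: \<open>extend_hom\<close> replaces it by
  some u in one variable fewer whose nonvanishing guarantees a suitable last coordinate. Without
  variables left, P contains no nonzero constant.\<close>

lemma prime_ideal_zero:
  fixes P :: "'k::{alg_closed_field, field_char_0} mpoly set"
  assumes P: "is_prime_ideal P" and v: "in_vars {..<n} v" "v \<notin> P"
  shows "\<exists>a. (\<forall>q\<in>P. in_vars {..<n} q \<longrightarrow> ev (\<lambda>c. c) a q = 0) \<and> ev (\<lambda>c. c) a v \<noteq> 0"
  using v
proof (induction n arbitrary: v)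
  case 0
  have const: "p = cst (lookup p 0)" if "in_vars {..<0} p" for p :: "'k mpoly"
    using that by (intro poly_mapping_eqI)
      (auto simp: in_vars_def lookup_single when_def in_keys_iff)
  have ev_const: "ev (\<lambda>c. c) (\<lambda>_. 0) p = lookup p 0" for p :: "'k mpoly"
    by (rule ev_0_eq)
  have "lookup q 0 = 0" if q: "q \<in> P" "in_vars {..<0} q" for q
  proof (rule ccontr)
    assume "lookup q 0 \<noteq> 0"
    then have "cst (inverse (lookup q 0)) * q = 1"
      by (subst const[OF q(2)]) (simp add: mult_single)
    then show False using P q(1) is_idealD(3)[of P q] unfolding is_prime_ideal_def by metis
  qed
  moreover have "lookup v 0 \<noteq> 0"
    using const[OF 0(1)] 0(2) P by (metis is_prime_ideal_def is_idealD(1) single_zero)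
  ultimately show ?case by (intro exI[of _ "\<lambda>_. 0"]) (auto simp: ev_const)
next
  case (Suc n)
  interpret prime_over_subring "{p. in_vars {..<n} p}" P
    by unfold_locales (auto intro: in_vars_add in_vars_diff in_vars_mult P)
  obtain V where V: "\<forall>i. in_vars {..<n} (poly.coeff V i)" "v = poly V (var n)"
    using in_vars_Suc_poly[OF Suc.prems(1)] by blast
  obtain u where u: "in_vars {..<n} u" "u \<notin> P" and ext: "\<And>\<phi> :: 'k mpoly \<Rightarrow> 'k. comm_ring_hom \<phi> \<Longrightarrow>
      \<forall>q\<in>P. in_vars {..<n} q \<longrightarrow> \<phi> q = 0 \<Longrightarrow> \<phi> u \<noteq> 0 \<Longrightarrow>
      \<exists>\<beta>. (\<forall>p\<in>polys {p. in_vars {..<n} p}. poly p (var n) \<in> P \<longrightarrow> poly (map_poly \<phi> p) \<beta> = 0) \<and>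
        poly (map_poly \<phi> V) \<beta> \<noteq> 0"
    using extend_hom[of V "var n", where 'k = 'k] V Suc.prems(2) by (auto simp: polys_def)
  obtain a where a: "\<forall>q\<in>P. in_vars {..<n} q \<longrightarrow> ev (\<lambda>c. c) a q = 0" "ev (\<lambda>c. c) a u \<noteq> 0"
    using Suc.IH[OF u] by blast
  have hom: "comm_ring_hom (ev (\<lambda>c. c) a :: 'k mpoly \<Rightarrow> 'k)" for a
    by (intro comm_ring_hom.ev_hom comm_ring_hom_id)
  obtain \<beta> where \<beta>: "\<And>p. p \<in> polys {p. in_vars {..<n} p} \<Longrightarrow> poly p (var n) \<in> P \<Longrightarrow>
      poly (map_poly (ev (\<lambda>c. c) a) p) \<beta> = 0" "poly (map_poly (ev (\<lambda>c. c) a) V) \<beta> \<noteq> 0"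
    using ext[OF hom a] by blast
  define a' where "a' = a(n := \<beta>)"
  have ev_id: "ev (\<lambda>c. c) a (cst c) = c" "ev (\<lambda>c. c) a (var i) = a i" for a i and c :: 'k
    by (simp_all add: comm_ring_hom.ev_term[OF comm_ring_hom_id])
  have agree: "ev (\<lambda>c. c) a' p = ev (\<lambda>c. c) a p" if "in_vars {..<n} p" for p
    by (rule mpoly_hom_eqI[OF hom hom that]) (simp_all add: ev_id a'_def)
  have ev_poly: "ev (\<lambda>c. c) a' (poly p (var n)) = poly (map_poly (ev (\<lambda>c. c) a) p) \<beta>"
    if "\<forall>i. in_vars {..<n} (poly.coeff p i)" for p
  proof -
    interpret h: comm_ring_hom "ev (\<lambda>c. c) a' :: 'k mpoly \<Rightarrow> 'k" by (rule hom)
    interpret h': comm_ring_hom "ev (\<lambda>c. c) a :: 'k mpoly \<Rightarrow> 'k" by (rule hom)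
    have "map_poly (ev (\<lambda>c. c) a') p = map_poly (ev (\<lambda>c. c) a) p"
      by (rule poly_eqI) (simp add: coeff_map_poly agree that)
    moreover have "ev (\<lambda>c. c) a' (var n) = \<beta>" by (simp add: ev_id a'_def)
    ultimately show ?thesis unfolding h.hom_poly by simp
  qed
  show ?case
  proof (intro exI[of _ a'] conjI ballI impI)
    show "ev (\<lambda>c. c) a' v \<noteq> 0" using \<beta>(2) V by (simp add: ev_poly)
    fix q assume q: "q \<in> P" "in_vars {..<Suc n} q"
    obtain p where "\<forall>i. in_vars {..<n} (poly.coeff p i)" "q = poly p (var n)"
      using in_vars_Suc_poly[OF q(2)] by blast
    then show "ev (\<lambda>c. c) a' q = 0" using \<beta>(1)[of p] q(1) by (simp add: ev_poly polys_def)
  qed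
qed

text \<open>If no power of variable j were in the ideal of the forms, a prime ideal above it would
  avoid that variable, and hence have a zero with nonzero coordinate j.\<close>

theorem nullstellensatz_powers:
  fixes F :: "nat \<Rightarrow> 'k::{alg_closed_field, field_char_0} mpoly"
  assumes F: "\<And>i. i < r \<Longrightarrow> in_vars {..<n} (F i)" and j: "j < n"
    and zero: "\<And>a. (\<And>i. i < r \<Longrightarrow> ev (\<lambda>c. c) a (F i) = 0) \<Longrightarrow> a j = 0"
  shows "\<exists>N h. var j ^ N = (\<Sum>i<r. h i * F i)"
proof (rule ccontr)
  assume contra: "\<not> ?thesis"
  define I where "I = {p. \<exists>h. p = (\<Sum>i<r. h i * F i)}"
  have "is_ideal I"
    unfolding is_ideal_def
  proof (intro conjI ballI allI)
    show "0 \<in> I" unfolding I_def mem_Collect_eq by (intro exI[of _ "\<lambda>_. 0"]) simp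
    show "p + q \<in> I" if pq: "p \<in> I" "q \<in> I" for p q
    proof -
      obtain h h' where "p = (\<Sum>i<r. h i * F i)" "q = (\<Sum>i<r. h' i * F i)" using pq by (auto simp: I_def)
      then have "p + q = (\<Sum>i<r. (h i + h' i) * F i)" by (simp add: algebra_simps sum.distrib)
      then show ?thesis unfolding I_def mem_Collect_eq by (rule exI[of _ "\<lambda>i. h i + h' i"])
    qed
    show "c * p \<in> I" if p: "p \<in> I" for p c
    proof -
      obtain h where "p = (\<Sum>i<r. h i * F i)" using p by (auto simp: I_def)
      then have "c * p = (\<Sum>i<r. (c * h i) * F i)" by (simp add: sum_distrib_left mult.assoc)
      then show ?thesis unfolding I_def mem_Collect_eq by (rule exI[of _ "\<lambda>i. c * h i"])
    qed
  qed
  moreover have "var j ^ k \<notin> I" for k using contra by (auto simp: I_def)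
  ultimately obtain P where P: "is_prime_ideal P" "I \<subseteq> P" "var j \<notin> P"
    using exists_prime_ideal by blast
  obtain a where a: "\<forall>q\<in>P. in_vars {..<n} q \<longrightarrow> ev (\<lambda>c. c) a q = 0" "ev (\<lambda>c. c) a (var j) \<noteq> 0"
    using prime_ideal_zero[OF P(1) _ P(3), of n] j by auto
  have "F i \<in> I" if "i < r" for i
  proof -
    have "F i = (\<Sum>k<r. (if k = i then 1 else 0) * F k)"
      using that by (simp add: if_distrib[of "\<lambda>x. x * _"] cong: if_cong)
    then show ?thesis unfolding I_def mem_Collect_eq by (rule exI[of _ "\<lambda>k. if k = i then 1 else 0"])
  qed
  then have "ev (\<lambda>c. c) a (F i) = 0" if "i < r" for i using a(1) P(2) F that by blast
  then have "a j = 0" by (rule zero)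
  then show False using a(2) by (simp add: comm_ring_hom.ev_term[OF comm_ring_hom_id])
qed

subsection \<open>Monomials of a given degree\<close>

definition monomials :: "nat \<Rightarrow> nat \<Rightarrow> (nat \<Rightarrow>\<^sub>0 nat) set" where
  "monomials r d = {m. keys m \<subseteq> {..<r} \<and> mdeg m = d}"

text \<open>Exponent lists turn the counting of monomials into stars and bars.\<close>

lemma bij_betw_monomials:
  "bij_betw (\<lambda>m. map (lookup m) [0..<r]) (monomials r d) {l. length l = r \<and> sum_list l = d}"
proof (rule bij_betw_byWitness[where f' = Poly_Mapping.nth])
  have mdeg: "mdeg m = (\<Sum>i<r. lookup m i)" if "keys m \<subseteq> {..<r}" for m
    using that by (rule mdeg_superset[rotated]) simp
  have keys_nth': "keys (Poly_Mapping.nth l) \<subseteq> {..<length l}" for l :: "nat list"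
    by (auto simp: in_keys_iff nth_default_def simp del: keys_nth split: if_splits)
  show "\<forall>m\<in>monomials r d. Poly_Mapping.nth (map (lookup m) [0..<r]) = m"
    by (auto simp: monomials_def nth_default_def in_keys_iff intro!: poly_mapping_eqI)
  show "\<forall>l\<in>{l. length l = r \<and> sum_list l = d}. map (lookup (Poly_Mapping.nth l)) [0..<r] = l"
    by (auto simp: nth_default_def intro!: nth_equalityI)
  show "(\<lambda>m. map (lookup m) [0..<r]) ` monomials r d \<subseteq> {l. length l = r \<and> sum_list l = d}"
    by (auto simp: monomials_def mdeg interv_sum_list_conv_sum_set_nat atLeast0LessThan)
  show "Poly_Mapping.nth ` {l. length l = r \<and> sum_list l = d} \<subseteq> monomials r d"
    using keys_nth' mdeg_superset[OF finite_lessThan keys_nth']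
    by (auto simp: monomials_def nth_default_def sum_list_sum_nth atLeast0LessThan simp del: keys_nth)
qed

lemma card_monomials: "card (monomials (Suc r) d) = (d + r) choose r"
  using bij_betw_same_card[OF bij_betw_monomials[of "Suc r" d]] card_length_sum_list[of "Suc r" d]
    binomial_symmetric[of d "d + r"] by simp

lemma finite_monomials: "finite (monomials r d)"
proof (cases r)
  case 0
  then show ?thesis by (auto simp: monomials_def intro: finite_subset[of _ "{0}"])
next
  case (Suc r')
  have "0 < (d + r') choose r'" by simp
  then show ?thesis using card_monomials[of r' d] Suc by (metis card.infinite less_irrefl)
qed

lemma homog_eq_sum_monomials:
  assumes "homog d p" "in_vars {..<r} p"
  shows "p = (\<Sum>m\<in>monomials r d. term_of m (lookup p m))"
  by (subst poly_mapping_eq_sum, rule sum.mono_neutral_left)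
     (use assms in \<open>auto simp: homog_def in_vars_def monomials_def in_keys_iff finite_monomials[unfolded monomials_def]\<close>)

subsection \<open>Integer polynomials over another ring\<close>

definition of_int_mpoly :: "int mpoly \<Rightarrow> 'a::comm_ring_1 mpoly" where
  "of_int_mpoly = ev (\<lambda>c. cst (of_int c)) var"

lemma comm_ring_hom_of_int: "comm_ring_hom (of_int :: int \<Rightarrow> 'a::comm_ring_1)"
  by (rule comm_ring_homI) auto

lemma comm_ring_hom_cst_of_int: "comm_ring_hom (\<lambda>c. cst (of_int c :: 'a::comm_ring_1))"
  by (rule comm_ring_hom_comp[OF comm_ring_hom_cst comm_ring_hom_of_int])

lemma comm_ring_hom_of_int_mpoly: "comm_ring_hom (of_int_mpoly :: int mpoly \<Rightarrow> 'a::comm_ring_1 mpoly)"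
  unfolding of_int_mpoly_def by (rule comm_ring_hom.ev_hom[OF comm_ring_hom_cst_of_int])

lemma of_int_mpoly_term [simp]: "of_int_mpoly (term_of m c) = term_of m (of_int c)"
  unfolding of_int_mpoly_def comm_ring_hom.ev_term[OF comm_ring_hom_cst_of_int]
  by (simp add: mult_single del: single_of_int flip: monom_of_eq_xmono)

lemma lookup_of_int_mpoly: "lookup (of_int_mpoly p) m = of_int (lookup p m)"
proof (rule additive_mpoly_eqI[where p = p])
  interpret comm_ring_hom "of_int_mpoly :: int mpoly \<Rightarrow> 'a mpoly" by (rule comm_ring_hom_of_int_mpoly)
  show "lookup (of_int_mpoly (p + q)) m = lookup (of_int_mpoly p) m + lookup (of_int_mpoly q :: 'a mpoly) m" for p q
    by (simp add: hom_add lookup_add)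
qed (simp_all add: lookup_add lookup_single when_def)

lemma keys_of_int_mpoly: "keys (of_int_mpoly p) \<subseteq> keys p"
  by (auto simp: in_keys_iff lookup_of_int_mpoly)

lemma ev_of_int_mpoly: "ev (\<lambda>c. c) a (of_int_mpoly p) = ev of_int a p"
proof (rule additive_mpoly_eqI[where p = p])
  interpret comm_ring_hom "of_int_mpoly :: int mpoly \<Rightarrow> 'a mpoly" by (rule comm_ring_hom_of_int_mpoly)
  show "ev (\<lambda>c. c) a (of_int_mpoly (p + q)) = ev (\<lambda>c. c) a (of_int_mpoly p) + ev (\<lambda>c. c) a (of_int_mpoly q)" for p q
    by (simp add: hom_add comm_ring_hom.ev_add[OF comm_ring_hom_id])
qed (simp_all add: comm_ring_hom.ev_term[OF comm_ring_hom_id] comm_ring_hom.ev_term[OF comm_ring_hom_of_int]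
    comm_ring_hom.ev_add[OF comm_ring_hom_of_int])

subsection \<open>An effective Nullstellensatz over the integers\<close>

lemma abs_det_le:
  fixes A :: "int mat"
  assumes A: "A \<in> carrier_mat n n" and le: "\<And>i j. i < n \<Longrightarrow> j < n \<Longrightarrow> \<bar>A $$ (i, j)\<bar> \<le> int (b i)"
  shows "\<bar>det A\<bar> \<le> int (fact n * (\<Prod>i<n. b i))"
proof -
  have "\<bar>det A\<bar> \<le> (\<Sum>p | p permutes {0..<n}. \<bar>signof p * (\<Prod>i = 0..<n. A $$ (i, p i))\<bar>)"
    unfolding det_def'[OF A] by (rule sum_abs)
  also have "\<dots> \<le> (\<Sum>p | p permutes {0..<n}. int (\<Prod>i<n. b i))"
  proof (rule sum_mono)
    fix p assume p: "p \<in> {p. p permutes {0..<n}}"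
    have "\<bar>signof p * (\<Prod>i = 0..<n. A $$ (i, p i))\<bar> = (\<Prod>i = 0..<n. \<bar>A $$ (i, p i)\<bar>)"
      by (simp add: abs_mult sign_def abs_prod)
    also have "\<dots> \<le> (\<Prod>i = 0..<n. int (b i))"
      using p le by (intro prod_mono) (auto simp: permutes_in_image)
    finally show "\<bar>signof p * (\<Prod>i = 0..<n. A $$ (i, p i))\<bar> \<le> int (\<Prod>i<n. b i)"
      by (simp add: atLeast0LessThan)
  qed
  also have "\<dots> = int (fact n * (\<Prod>i<n. b i))"
    by (simp add: card_permutations[OF refl] del: of_nat_prod)
  finally show ?thesis .
qed

text \<open>The hypothesis concerns one field of characteristic 0; the conclusion is an identity
  over the integers that can be carried to every commutative ring.\<close>

theorem effective_nullstellensatz: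
  fixes G :: "nat \<Rightarrow> int mpoly" and r d :: nat and dg b :: "nat \<Rightarrow> nat"
  assumes G: "\<And>t. t < r \<Longrightarrow> homog (dg t) (G t)" "\<And>t. t < r \<Longrightarrow> in_vars {..<r} (G t)"
    and b: "\<And>t m. t < r \<Longrightarrow> \<bar>lookup (G t) m\<bar> \<le> int (b t)" "\<And>t. t < r \<Longrightarrow> b t \<ge> 1"
    and dg: "\<And>t. t < r \<Longrightarrow> dg t \<ge> 1"
    and d: "d = Suc (\<Sum>t<r. dg t - 1)"
    and zero: "\<And>(a :: nat \<Rightarrow> 'k::{alg_closed_field, field_char_0}) j.
      (\<And>t. t < r \<Longrightarrow> ev of_int a (G t) = 0) \<Longrightarrow> j < r \<Longrightarrow> a j = 0"
  shows "\<exists>\<Delta> :: int. \<Delta> \<noteq> 0 \<and>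
    \<bar>\<Delta>\<bar> \<le> int (fact (card (monomials r d)) * (\<Prod>t<r. b t ^ card (monomials r (d - dg t)))) \<and>
    (\<forall>m\<in>monomials r d. \<exists>c. cst \<Delta> * monom_of m = (\<Sum>t<r. c t * G t))"
proof -
  interpret oi: comm_ring_hom "of_int_mpoly :: int mpoly \<Rightarrow> 'k mpoly" by (rule comm_ring_hom_of_int_mpoly)
  define F :: "nat \<Rightarrow> 'k mpoly" where "F t = of_int_mpoly (G t)" for t
  have F: "homog (dg t) (F t)" "in_vars {..<r} (F t)" if "t < r" for t
    using G[OF that] keys_of_int_mpoly unfolding F_def homog_def in_vars_def by blast+
  have nil: "\<exists>N h. var j ^ N = (\<Sum>i<r. h i * F i)" if "j < r" for j
    using F(2) that by (rule nullstellensatz_powers) (use zero that in \<open>auto simp: F_def ev_of_int_mpoly\<close>)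
  define C where "C = card (monomials r d)"
  \<comment> \<open>Rows are indexed by pairs, so that coinciding products of different origin
    remain separate.\<close>
  define R where "R = (SIGMA t:{..<r}. monomials r (d - dg t))"
  define row where "row x = monom_of (snd x) * G (fst x)" for x
  have d_ge: "dg t \<le> d" if "t < r" for t
    using member_le_sum[of t "{..<r}" "\<lambda>t. dg t - 1"] that by (auto simp: d)
  have row: "homog d (row x)" "in_vars {..<r} (row x)" if x: "x \<in> R" for x
  proof -
    have "homog ((d - dg (fst x)) + dg (fst x)) (row x)"
      unfolding row_def using x by (intro homog_mult G) (auto simp: R_def monomials_def)
    then show "homog d (row x)" using d_ge x by (auto simp: R_def)
    show "in_vars {..<r} (row x)"
      unfolding row_def using x by (intro in_vars_mult G) (auto simp: R_def monomials_def)
  qed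
  interpret vs: vector_space "\<lambda>c (p :: 'k mpoly). cst c * p"
    by unfold_locales (simp_all add: distrib_left distrib_right single_add mult_single flip: mult.assoc)
  define Mons :: "'k mpoly set" where "Mons = monom_of ` monomials r d"
  define W :: "'k mpoly set" where "W = (\<lambda>x. of_int_mpoly (row x)) ` R"
  have inj_mon: "inj_on (monom_of :: _ \<Rightarrow> 'k mpoly) M" for M
    by (rule inj_onI) (metis lookup_single_eq lookup_single_not_eq zero_neq_one)
  have cardMons: "card Mons = C" "finite Mons"
    using card_image[OF inj_mon] by (simp_all add: Mons_def C_def finite_monomials)
  have Mons_W: "Mons \<subseteq> vs.span W"
  proof
    fix p assume "p \<in> Mons"
    then obtain m where m: "m \<in> monomials r d" "p = monom_of m" by (auto simp: Mons_def)
    obtain h where h: "\<And>i. i < r \<Longrightarrow> homog (d - dg i) (h i)" "\<And>i. i < r \<Longrightarrow> in_vars {..<r} (h i)"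
      "monom_of m = (\<Sum>i<r. h i * F i)"
      using macaulay[of r dg F m, OF F dg nil] m(1) d by (auto simp: monomials_def)
    have "h i * F i \<in> vs.span W" if i: "i < r" for i
    proof -
      have "h i * F i = (\<Sum>m'\<in>monomials r (d - dg i). cst (lookup (h i) m') * of_int_mpoly (row (i, m')))"
        unfolding arg_cong[OF homog_eq_sum_monomials[OF h(1,2)[OF i]], of "\<lambda>p. p * F i"] sum_distrib_right
        by (intro sum.cong refl) (simp add: row_def F_def oi.hom_mult mult_single flip: mult.assoc)
      also have "\<dots> \<in> vs.span W"
        using i by (intro vs.span_sum vs.span_scale vs.span_base) (auto simp: W_def R_def)
      finally show ?thesis .
    qed
    then show "p \<in> vs.span W" unfolding m h(3) by (intro vs.span_sum) auto
  qed
  have W_Mons: "W \<subseteq> vs.span Mons"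
  proof
    fix p assume "p \<in> W"
    then obtain x where x: "x \<in> R" "p = of_int_mpoly (row x)" by (auto simp: W_def)
    have "row x = (\<Sum>m\<in>monomials r d. term_of m (lookup (row x) m))"
      by (rule homog_eq_sum_monomials[OF row[OF x(1)]])
    then have "p = of_int_mpoly (\<Sum>m\<in>monomials r d. term_of m (lookup (row x) m))"
      using x(2) by simp
    also have "\<dots> = (\<Sum>m\<in>monomials r d. cst (of_int (lookup (row x) m)) * monom_of m)"
      by (simp add: oi.hom_sum mult_single del: single_of_int)
    also have "\<dots> \<in> vs.span Mons"
      by (intro vs.span_sum vs.span_scale vs.span_base) (auto simp: Mons_def)
    finally show "p \<in> vs.span Mons" .
  qed
  have indep: "vs.independent Mons"
  proof (rule vs.independent_if_scalars_zero[OF cardMons(2)])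
    fix f :: "'k mpoly \<Rightarrow> 'k" and p
    assume 0: "(\<Sum>x\<in>Mons. cst (f x) * x) = 0" and "p \<in> Mons"
    then obtain m where m: "m \<in> monomials r d" "p = monom_of m" by (auto simp: Mons_def)
    have "0 = lookup (\<Sum>x\<in>Mons. cst (f x) * x) m" by (simp add: 0)
    also have "\<dots> = (\<Sum>m'\<in>monomials r d. if m' = m then f (monom_of m') else 0)"
      unfolding Mons_def
      by (subst sum.reindex[OF inj_mon])
         (auto simp: lookup_sum mult_single lookup_single when_def intro!: sum.cong)
    finally show "f p = 0" using m by (simp add: finite_monomials)
  qed
  \<comment> \<open>A basis selected among the rows over 'k. It has exactly C elements, since the
    rows and the monomials of degree d span the same space.\<close>
  obtain B where B: "B \<subseteq> W" "vs.independent B" "W \<subseteq> vs.span B"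
    using vs.maximal_independent_subset by blast
  have "finite B" "card B \<le> C"
    using vs.independent_span_bound[OF cardMons(2) B(2)] B(1) W_Mons cardMons by auto
  moreover have Mons_B: "Mons \<subseteq> vs.span B"
    by (rule subset_trans[OF Mons_W vs.span_minimal[OF B(3) vs.subspace_span]])
  then have "C \<le> card B"
    using vs.independent_span_bound[OF \<open>finite B\<close> indep] cardMons by auto
  ultimately have B': "finite B" "card B = C" by auto
  \<comment> \<open>Each basis vector is traced back to one integer row; distinct vectors have
    distinct rows.\<close>
  have "\<forall>x\<in>B. \<exists>y. y \<in> R \<and> of_int_mpoly (row y) = x"
  proof
    fix x assume "x \<in> B"
    then have "x \<in> (\<lambda>y. of_int_mpoly (row y)) ` R" using B(1) unfolding W_def by (rule rev_subsetD)
    then show "\<exists>y. y \<in> R \<and> of_int_mpoly (row y) = x"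
      by (rule imageE) (rule exI, rule conjI, assumption, rule sym)
  qed
  from bchoice[OF this] obtain \<rho> where \<rho>: "\<And>x. x \<in> B \<Longrightarrow> \<rho> x \<in> R \<and> of_int_mpoly (row (\<rho> x)) = x"
    by blast
  obtain \<beta> where \<beta>: "bij_betw \<beta> {..<C} B"
    using ex_bij_betw_nat_finite[OF B'(1)] B'(2) by (auto simp: atLeast0LessThan)
  obtain \<mu> where \<mu>: "bij_betw \<mu> {..<C} (monomials r d)"
    using ex_bij_betw_nat_finite[OF finite_monomials[of r d]] by (auto simp: atLeast0LessThan C_def)
  have \<beta>B: "\<beta> s \<in> B" if "s < C" for s using \<beta> that by (auto simp: bij_betw_def)
  have \<mu>M: "\<mu> q \<in> monomials r d" if "q < C" for q using \<mu> that by (auto simp: bij_betw_def)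
  define \<sigma> where "\<sigma> s = \<rho> (\<beta> s)" for s
  have \<sigma>R: "\<sigma> s \<in> R" if "s < C" for s using \<rho>[OF \<beta>B[OF that]] by (simp add: \<sigma>_def)
  have \<beta>_eq: "of_int_mpoly (row (\<sigma> s)) = \<beta> s" if "s < C" for s
    using \<rho>[OF \<beta>B[OF that]] by (simp add: \<sigma>_def)
  have inj_\<sigma>: "inj_on \<sigma> {..<C}"
  proof (rule inj_onI)
    fix s s' assume s: "s \<in> {..<C}" "s' \<in> {..<C}" and "\<sigma> s = \<sigma> s'"
    then have "\<beta> s = \<beta> s'" using \<beta>_eq[of s] \<beta>_eq[of s'] by simp
    then show "s = s'" using \<beta> s by (auto simp: bij_betw_def dest: inj_onD)
  qed
  define A where "A = mat C C (\<lambda>(s, q). lookup (row (\<sigma> s)) (\<mu> q))"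
  have A: "A \<in> carrier_mat C C" by (simp add: A_def)
  have det_A: "det A \<noteq> 0"
  proof -
    \<comment> \<open>The coefficients of the monomials in terms of the basis form a left inverse of
      the selected square matrix over 'k.\<close>
    have "\<exists>c. q < C \<longrightarrow> monom_of (\<mu> q) = (\<Sum>x\<in>B. cst (c x) * x)" for q
    proof (cases "q < C")
      case True
      have "(monom_of (\<mu> q) :: 'k mpoly) \<in> vs.span B"
        using Mons_B \<mu>M[OF True] by (auto simp: Mons_def)
      then show ?thesis unfolding vs.span_finite[OF B'(1)] by blast
    qed simp
    then have "\<forall>q. \<exists>c. q < C \<longrightarrow> monom_of (\<mu> q) = (\<Sum>x\<in>B. cst (c x) * x)" ..
    from choice[OF this] obtain c
      where c: "\<And>q. q < C \<Longrightarrow> monom_of (\<mu> q) = (\<Sum>x\<in>B. cst (c q x) * x)" by blast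
    define Ci where "Ci = mat C C (\<lambda>(q, s). c q (\<beta> s))"
    have Ci: "Ci \<in> carrier_mat C C" by (simp add: Ci_def)
    have "Ci * map_mat of_int A = 1\<^sub>m C"
    proof (rule eq_matI)
      fix q q' assume "q < dim_row (1\<^sub>m C :: 'k mat)" "q' < dim_col (1\<^sub>m C :: 'k mat)"
      then have q: "q < C" "q' < C" by auto
      have "of_int (lookup (row (\<sigma> s)) (\<mu> q')) = lookup (\<beta> s) (\<mu> q')" if "s < C" for s
        using \<beta>_eq[OF that] by (simp flip: lookup_of_int_mpoly)
      then have "(Ci * map_mat of_int A) $$ (q, q') = (\<Sum>s<C. c q (\<beta> s) * lookup (\<beta> s) (\<mu> q'))"
        using q by (auto simp: Ci_def A_def scalar_prod_def atLeast0LessThan intro!: sum.cong)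
      also have "\<dots> = (\<Sum>x\<in>B. c q x * lookup x (\<mu> q'))"
        by (rule sum.reindex_bij_betw[OF \<beta>])
      also have "\<dots> = lookup (\<Sum>x\<in>B. cst (c q x) * x) (\<mu> q')"
        by (simp add: lookup_sum lookup_term_mult[of 0, simplified])
      also have "\<dots> = lookup (monom_of (\<mu> q)) (\<mu> q')" by (simp add: c q)
      also have "\<dots> = 1\<^sub>m C $$ (q, q')"
        using q \<mu> by (auto simp: lookup_single when_def bij_betw_def dest: inj_onD)
      finally show "(Ci * map_mat of_int A) $$ (q, q') = 1\<^sub>m C $$ (q, q')" .
    qed (auto simp: Ci_def A_def)
    then have "det Ci * det (map_mat of_int A) = 1"
      using det_mult[OF Ci, of "map_mat of_int A"] A by simp
    then show ?thesis by (auto simp: comm_ring_hom.hom_det[OF comm_ring_hom_of_int])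
  qed
  have bound: "\<bar>det A\<bar> \<le> int (fact C * (\<Prod>t<r. b t ^ card (monomials r (d - dg t))))"
  proof -
    have "\<bar>lookup (row x) m\<bar> \<le> int (b (fst x))" if x: "x \<in> R" for x m
    proof (cases "m \<in> keys (row x)")
      case True
      then obtain w where "m = snd x + w"
        unfolding row_def using in_keys_mult[of m "monom_of (snd x)" "G (fst x)"] by auto
      then show ?thesis
        using b(1)[of "fst x" w] x lookup_term_mult[of "snd x" 1 "G (fst x)" w] by (auto simp: row_def R_def)
    qed (simp add: in_keys_iff)
    then have "\<bar>det A\<bar> \<le> int (fact C * (\<Prod>s<C. b (fst (\<sigma> s))))"
      using \<sigma>R by (intro abs_det_le[OF A]) (auto simp: A_def)
    also have "(\<Prod>s<C. b (fst (\<sigma> s))) = (\<Prod>x\<in>\<sigma> ` {..<C}. b (fst x))"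
      by (simp add: prod.reindex[OF inj_\<sigma>])
    \<comment> \<open>Passing from the selected rows to all rows only adds factors that are at least
      1.\<close>
    also have "\<dots> \<le> (\<Prod>x\<in>R. b (fst x))"
    proof -
      have "finite R" by (auto simp: R_def finite_monomials)
      moreover have "\<sigma> ` {..<C} \<subseteq> R" using \<sigma>R by blast
      ultimately have "(\<Prod>x\<in>R. b (fst x)) = (\<Prod>x\<in>R - \<sigma> ` {..<C}. b (fst x)) * (\<Prod>x\<in>\<sigma> ` {..<C}. b (fst x))"
        by (rule prod.subset_diff[rotated])
      moreover have "1 \<le> (\<Prod>x\<in>R - \<sigma> ` {..<C}. b (fst x))"
        using b(2) by (intro prod_ge_1) (auto simp: R_def)
      ultimately show ?thesis by simp
    qed
    also have "\<dots> = (\<Prod>t<r. b t ^ card (monomials r (d - dg t)))"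
      using prod.Sigma[of "{..<r}" "\<lambda>t. monomials r (d - dg t)" "\<lambda>t m. b t"]
      by (simp add: R_def finite_monomials case_prod_unfold)
    finally show ?thesis by simp
  qed
  have "\<exists>c. cst (det A) * monom_of m = (\<Sum>t<r. c t * G t)" if "m \<in> monomials r d" for m
  proof -
    obtain q where q: "q < C" "m = \<mu> q" using \<mu> \<open>m \<in> monomials r d\<close> by (auto simp: bij_betw_def)
    define A' where "A' = map_mat cst A"
    have A': "A' \<in> carrier_mat C C" using A by (simp add: A'_def)
    \<comment> \<open>The vector of monomials solves the system with matrix A' and the selected
      multiples as right-hand side; Cramer's rule then isolates m.\<close>
    have rows: "(\<Sum>q<C. A' $$ (s, q) * monom_of (\<mu> q)) = row (\<sigma> s)" if s: "s < C" for s
    proof -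
      have "row (\<sigma> s) = (\<Sum>m\<in>monomials r d. term_of m (lookup (row (\<sigma> s)) m))"
        by (rule homog_eq_sum_monomials[OF row[OF \<sigma>R[OF s]]])
      also have "\<dots> = (\<Sum>q<C. term_of (\<mu> q) (lookup (row (\<sigma> s)) (\<mu> q)))"
        by (rule sum.reindex_bij_betw[OF \<mu>, symmetric])
      also have "\<dots> = (\<Sum>q<C. A' $$ (s, q) * monom_of (\<mu> q))"
        using s by (intro sum.cong) (auto simp: A'_def A_def mult_single)
      finally show ?thesis ..
    qed
    have "cst (det A) * monom_of m = det A' * monom_of (\<mu> q)"
      by (simp add: A'_def q comm_ring_hom.hom_det[OF comm_ring_hom_cst])
    also have "\<dots> = (\<Sum>s<C. cofactor A' s q * row (\<sigma> s))"
      by (rule det_times_solution[OF A' q(1) rows])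
    also have "\<dots> = (\<Sum>s<C. \<Sum>t<r. if fst (\<sigma> s) = t then cofactor A' s q * monom_of (snd (\<sigma> s)) * G t else 0)"
    proof (intro sum.cong refl)
      fix s assume "s \<in> {..<C}"
      then have "\<sigma> s \<in> Sigma {..<r} (\<lambda>t. monomials r (d - dg t))" using \<sigma>R by (simp add: R_def)
      then have "fst (\<sigma> s) < r" by (rule SigmaE) simp
      then show "cofactor A' s q * row (\<sigma> s) =
          (\<Sum>t<r. if fst (\<sigma> s) = t then cofactor A' s q * monom_of (snd (\<sigma> s)) * G t else 0)"
        by (simp add: row_def mult.assoc)
    qed
    also have "\<dots> = (\<Sum>t<r. (\<Sum>s<C. if fst (\<sigma> s) = t then cofactor A' s q * monom_of (snd (\<sigma> s)) else 0) * G t)"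
      by (subst sum.swap) (auto simp: sum_distrib_right intro!: sum.cong)
    finally show ?thesis
      by (rule exI[of _ "\<lambda>t. \<Sum>s<C. if fst (\<sigma> s) = t then cofactor A' s q * monom_of (snd (\<sigma> s)) else 0"])
  qed
  then show ?thesis using det_A bound unfolding C_def by blast
qed

subsection \<open>Hasse derivatives at a root, as forms in the roots\<close>

text \<open>The second conjunct is carried along because \<open>card J - l\<close> is truncated:
  beyond the degree, only the zero coefficient is compatible with the induction.\<close>

lemma homog_coeff_prod_linear:
  fixes u :: "'i \<Rightarrow> 'a::comm_ring_1 mpoly"
  assumes "finite J" "\<And>j. j \<in> J \<Longrightarrow> homog 1 (u j)"
  shows "homog (card J - l) (poly.coeff (\<Prod>j\<in>J. [:u j, 1:]) l) \<and>
    (card J < l \<longrightarrow> poly.coeff (\<Prod>j\<in>J. [:u j, 1:]) l = 0)"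
  using assms
proof (induction J arbitrary: l)
  case empty
  then show ?case by (auto simp: homog_def coeff_pCons one_pCons split: nat.split)
next
  case (insert j J)
  let ?p = "\<Prod>j\<in>J. [:u j, 1:]"
  have IH: "homog (card J - l) (poly.coeff ?p l)" "card J < l \<Longrightarrow> poly.coeff ?p l = 0" for l
    using insert.IH[of l] insert.prems by auto
  have 1: "homog (Suc (card J) - l) (u j * poly.coeff ?p l)" for l
  proof (cases "l \<le> card J")
    case True
    then show ?thesis using homog_mult[OF insert.prems[of j] IH(1)[of l]] by (simp add: Suc_diff_le)
  qed (simp add: IH)
  show ?case
  proof (cases l)
    case 0
    then show ?thesis using insert.hyps 1[of 0] by simp
  next
    case (Suc l')
    then show ?thesis using insert.hyps 1[of l] IH(1)[of l'] IH(2)[of l] IH(2)[of l'] homog_add by auto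
  qed
qed

lemma in_vars_coeff_prod_linear:
  fixes u :: "'i \<Rightarrow> 'a::comm_ring_1 mpoly"
  assumes "\<And>j. j \<in> J \<Longrightarrow> in_vars V (u j)"
  shows "in_vars V (poly.coeff (\<Prod>j\<in>J. [:u j, 1:]) l)"
  using assms
proof (induction J arbitrary: l rule: infinite_finite_induct)
  case (insert j J)
  then show ?case
    by (auto simp: coeff_pCons intro!: in_vars_add in_vars_mult split: nat.split)
qed (auto simp: coeff_pCons one_pCons split: nat.split)

lemma abs_lookup_var_mult_le:
  fixes p :: "int mpoly"
  assumes "\<And>m. \<bar>lookup p m\<bar> \<le> B" "z = 0 \<or> z = var k"
  shows "\<bar>lookup (z * p) m\<bar> \<le> B"
proof -
  have B: "0 \<le> B" using assms(1)[of 0] by simp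
  show ?thesis
  proof (cases "z = var k \<and> m \<in> keys (var k * p)")
    case True
    then obtain w where "m = Poly_Mapping.single k (Suc 0) + w"
      using in_keys_mult[of m "var k" p] by auto
    then show ?thesis using True assms(1)[of w] by (simp add: lookup_term_mult)
  next
    case False
    then show ?thesis using B assms(2) by (auto simp: in_keys_iff)
  qed
qed

text \<open>A monomial containing the variable \<open>j\<close> just added only arises from \<open>w j\<close>, any other one
  only from \<open>z\<close> and \<open>Y\<close>; hence the coefficients obey Pascal's rule.\<close>
lemma abs_lookup_coeff_prod_linear_le:
  fixes w :: "nat \<Rightarrow> int mpoly"
  assumes "finite J" "k \<notin> J" "z = 0 \<or> z = var k" "\<And>j. w j = 0 \<or> w j = var j"
  shows "\<bar>lookup (poly.coeff (\<Prod>j\<in>J. [:z - w j, 1:]) l) m\<bar> \<le> int (card J choose l)"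
  using assms(1,2)
proof (induction J arbitrary: l m)
  case empty
  then show ?case by (auto simp: coeff_pCons one_pCons lookup_one when_def split: nat.split)
next
  case (insert j J)
  define p where "p = (\<Prod>j\<in>J. [:z - w j, 1:])"
  have IH: "\<bar>lookup (poly.coeff p l) m\<bar> \<le> int (card J choose l)" for l m
    using insert by (simp add: p_def)
  have vars: "in_vars (insert k J) (poly.coeff p l)" for l
    unfolding p_def
  proof (rule in_vars_coeff_prod_linear)
    fix i assume "i \<in> J"
    then show "in_vars (insert k J) (z - w i)"
      using assms(3) assms(4)[of i] by (intro in_vars_diff) auto
  qed
  have zvars: "in_vars (insert k J) z" using assms(3) by auto
  define q where "q = z * poly.coeff p l + (case l of 0 \<Rightarrow> 0 | Suc l' \<Rightarrow> poly.coeff p l')"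
  have q_vars: "in_vars (insert k J) q"
    unfolding q_def by (auto intro!: in_vars_add in_vars_mult vars zvars split: nat.split)
  have eq: "poly.coeff (\<Prod>j\<in>insert j J. [:z - w j, 1:]) l = q - w j * poly.coeff p l"
    using insert.hyps by (simp add: coeff_pCons q_def p_def left_diff_distrib split: nat.split)
  have z: "\<bar>lookup (z * poly.coeff p l) m\<bar> \<le> int (card J choose l)"
    by (rule abs_lookup_var_mult_le[OF IH assms(3)])
  have wj: "\<bar>lookup (w j * poly.coeff p l) m\<bar> \<le> int (card J choose l)"
    by (rule abs_lookup_var_mult_le[OF IH assms(4)])
  have q: "\<bar>lookup q m\<bar> \<le> int (Suc (card J) choose l)"
  proof (cases l)
    case 0
    then show ?thesis using z by (simp add: q_def)
  next
    case (Suc l')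
    then show ?thesis using z IH[of l' m] by (simp add: q_def lookup_add)
  qed
  have mono: "card J choose l \<le> Suc (card J) choose l" by (rule binomial_right_mono) simp
  have j: "j \<notin> insert k J" using insert by auto
  have "\<bar>lookup (q - w j * poly.coeff p l) m\<bar> \<le> int (Suc (card J) choose l)"
  proof (cases "lookup m j = 0")
    case True
    have "lookup (w j * poly.coeff p l) m = 0"
    proof (cases "w j = 0")
      case False
      then have "w j = var j" using assms(4) by auto
      then show ?thesis using True lookup_mult_power_var[of m j 1 "poly.coeff p l"]
        by (simp add: mult.commute)
    qed simp
    then show ?thesis using q by (simp add: lookup_minus)
  next
    case False
    then have "j \<in> keys m" by (simp add: in_keys_iff)
    then have "\<not> keys m \<subseteq> insert k J" using j by blast
    then have "lookup q m = 0" using q_vars by (auto simp: in_vars_def in_keys_iff)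
    then show ?thesis using wj mono by (simp add: lookup_minus)
  qed
  then show ?case using insert.hyps unfolding eq by simp
qed

text \<open>The roots are the variables \<open>0, \<dots>, r - 1\<close> and, normalizing by a translation, \<open>0\<close>.\<close>
definition root_var :: "nat \<Rightarrow> nat \<Rightarrow> int mpoly" where
  "root_var r j = (if j < r then var j else 0)"

text \<open>The i-th Taylor coefficient, at the k-th root, of the monic polynomial with these roots;
  this is the value of the i-th Hasse derivative there.\<close>

definition hasse_form :: "nat \<Rightarrow> nat \<Rightarrow> nat \<Rightarrow> int mpoly" where
  "hasse_form r i k = poly.coeff (\<Prod>j<Suc r. [:root_var r k - root_var r j, 1:]) i"

lemma hasse_form_props:
  assumes "k \<le> r" "1 \<le> i" "i \<le> r"
  shows "homog (Suc r - i) (hasse_form r i k)" "in_vars {..<r} (hasse_form r i k)"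
    "\<bar>lookup (hasse_form r i k) m\<bar> \<le> int (r choose (i - 1))"
proof -
  let ?J = "{..<Suc r} - {k}"
  have J: "finite ?J" "card ?J = r" "k \<notin> ?J" using assms by auto
  \<comment> \<open>The factor with j = k is the indeterminate itself, which lowers the index by one
    and leaves r linear factors.\<close>
  have "(\<Prod>j<Suc r. [:root_var r k - root_var r j, 1:]) =
      [:0, 1:] * (\<Prod>j\<in>?J. [:root_var r k - root_var r j, 1:])"
    using assms by (subst prod.remove[of _ k]) auto
  then have eq: "hasse_form r i k = poly.coeff (\<Prod>j\<in>?J. [:root_var r k - root_var r j, 1:]) (i - 1)"
    using assms by (simp add: hasse_form_def coeff_pCons split: nat.split)
  have rv: "root_var r j = 0 \<or> root_var r j = var j" "homog 1 (root_var r j)" "in_vars {..<r} (root_var r j)" for j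
    by (auto simp: root_var_def)
  show "homog (Suc r - i) (hasse_form r i k)"
    using homog_coeff_prod_linear[OF J(1) homog_diff[OF rv(2)[of k] rv(2)], THEN conjunct1, of "i - 1"] assms
    unfolding eq J(2) by (simp add: Suc_diff_le)
  show "in_vars {..<r} (hasse_form r i k)"
    unfolding eq by (intro in_vars_coeff_prod_linear in_vars_diff rv)
  show "\<bar>lookup (hasse_form r i k) m\<bar> \<le> int (r choose (i - 1))"
    using abs_lookup_coeff_prod_linear_le[OF J(1,3) rv(1)[of k], of "root_var r" "i - 1" m] rv(1) J(2)
    unfolding eq by simp
qed

text \<open>Forms are reindexed by degree: t stands for the form of degree t + 1, which comes from
  the Hasse derivative of order r - t. Summing degree minus one gives the value of d.\<close>

theorem hasse_forms_nullstellensatz: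
  fixes \<kappa> :: "nat \<Rightarrow> nat" and r d :: nat
  assumes r: "r = Suc r'" and \<kappa>: "\<And>i. 1 \<le> i \<Longrightarrow> i \<le> r \<Longrightarrow> \<kappa> i \<le> r" and d: "d = Suc (\<Sum>t<r. t)"
    and zero: "\<And>(a :: nat \<Rightarrow> 'k::{alg_closed_field, field_char_0}) j.
      (\<And>i. 1 \<le> i \<Longrightarrow> i \<le> r \<Longrightarrow> ev of_int a (hasse_form r i (\<kappa> i)) = 0) \<Longrightarrow> j < r \<Longrightarrow> a j = 0"
  shows "\<exists>\<Delta> :: int. \<Delta> \<noteq> 0 \<and>
    \<bar>\<Delta>\<bar> \<le> int (fact ((d + r') choose r') *
      (\<Prod>i = 1..r. ((i + r') choose r') ^ ((d - i + r') choose r'))) \<and>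
    (\<forall>m\<in>monomials r d. \<exists>c. cst \<Delta> * monom_of m = (\<Sum>t<r. c t * hasse_form r (r - t) (\<kappa> (r - t))))"
proof -
  define G where "G t = hasse_form r (r - t) (\<kappa> (r - t))" for t
  define b where "b t = ((Suc t + r') choose r')" for t
  have G: "homog (Suc t) (G t)" "in_vars {..<r} (G t)" "\<bar>lookup (G t) m\<bar> \<le> int (b t)" if t: "t < r" for t m
  proof -
    have i: "\<kappa> (r - t) \<le> r" "1 \<le> r - t" "r - t \<le> r" using t \<kappa> by auto
    show "homog (Suc t) (G t)" "in_vars {..<r} (G t)"
      using hasse_form_props(1,2)[OF i] t by (simp_all add: G_def Suc_diff_le)
    \<comment> \<open>The coefficient bound is enlarged here to the binomial of the final
      estimate.\<close>
    have "(r choose (r - t - 1)) = (r choose Suc t)"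
      using t binomial_symmetric[of "Suc t" r] by simp
    also have "\<dots> \<le> ((Suc t + r') choose Suc t)" using t r by (intro binomial_right_mono) simp
    also have "\<dots> = b t" using binomial_symmetric[of "Suc t" "Suc t + r'"] by (simp add: b_def)
    finally show "\<bar>lookup (G t) m\<bar> \<le> int (b t)"
      using hasse_form_props(3)[OF i, of m] unfolding G_def by linarith
  qed
  have "\<exists>\<Delta> :: int. \<Delta> \<noteq> 0 \<and>
    \<bar>\<Delta>\<bar> \<le> int (fact (card (monomials r d)) * (\<Prod>t<r. b t ^ card (monomials r (d - Suc t)))) \<and>
    (\<forall>m\<in>monomials r d. \<exists>c. cst \<Delta> * monom_of m = (\<Sum>t<r. c t * G t))"
  proof (rule effective_nullstellensatz[OF G])
    show "1 \<le> b t" for t by (simp add: b_def Suc_le_eq del: add_Suc)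
    show "a j = 0" if "\<And>t. t < r \<Longrightarrow> ev of_int a (G t) = 0" "j < r" for a :: "nat \<Rightarrow> 'k" and j
    proof (rule zero[OF _ that(2)])
      fix i assume i: "1 \<le> i" "i \<le> r"
      then have "r - (r - i) = i" by simp
      then show "ev of_int a (hasse_form r i (\<kappa> i)) = 0"
        using that(1)[of "r - i"] i by (simp add: G_def)
    qed
  qed (use d in auto)
  moreover have "(\<Prod>t<r. b t ^ card (monomials r (d - Suc t))) =
      (\<Prod>i = 1..r. ((i + r') choose r') ^ ((d - i + r') choose r'))"
    unfolding b_def r card_monomials
    using prod.atLeast1_atMost_eq[of "\<lambda>i. ((i + r') choose r') ^ ((d - i + r') choose r')" r'] by simp
  ultimately show ?thesis unfolding G_def r card_monomials by (simp only:)
qed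

subsection \<open>Homomorphisms from ring types into fields with a carrier\<close>

lemma lead_coeff_mult_monic:
  fixes p q :: "'a::comm_ring_1 poly"
  assumes "Polynomial.lead_coeff p = 1" "Polynomial.lead_coeff q = 1"
  shows "Polynomial.lead_coeff (p * q) = 1"
proof -
  have "poly.coeff (p * q) (Polynomial.degree p + Polynomial.degree q) = 1"
    using assms by (simp add: coeff_mult_degree_sum)
  moreover from this have "Polynomial.degree (p * q) = Polynomial.degree p + Polynomial.degree q"
    by (intro antisym degree_mult_le le_degree) auto
  ultimately show ?thesis by simp
qed

text \<open>Bridge from ring types to fields given by a carrier: computations with generic
  polynomials are done in the type and then pushed into K.\<close>

locale hom_to_field = field K for K (structure) +
  fixes h :: "'r::comm_ring_1 \<Rightarrow> 'a"
  assumes h_closed [simp, intro]: "h x \<in> carrier K"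
    and h_0 [simp]: "h 0 = \<zero>" and h_1 [simp]: "h 1 = \<one>"
    and h_add: "h (x + y) = h x \<oplus> h y" and h_mult: "h (x * y) = h x \<otimes> h y"
begin

lemma h_uminus: "h (- x) = \<ominus> h x"
  using h_add[of x "- x"] by (intro minus_equality[symmetric]) (auto simp: a_comm)

lemma h_diff: "h (x - y) = h x \<ominus> h y"
  using h_add[of x "- y"] by (simp add: h_uminus minus_eq)

lemma h_power: "h (x ^ n) = h x [^] n"
  by (induction n) (simp_all add: h_mult m_comm)

lemma h_of_nat: "h (of_nat n) = [n] \<cdot> \<one>"
  by (induction n) (simp_all add: h_add a_comm)

lemma h_of_nat_mult: "h (of_nat n * x) = [n] \<cdot> h x"
  by (simp add: h_mult h_of_nat add_pow_ldistr)

lemma h_sum: "finite I \<Longrightarrow> h (\<Sum>i\<in>I. f i) = (\<Oplus>i\<in>I. h (f i))"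
  by (induction I rule: finite_induct) (simp_all add: h_add)

lemma eval_map_rev: "eval (map h (rev cs)) (h z) = h (poly (Poly cs) z)"
proof (induction cs)
  case (Cons c cs)
  have "eval (map h (rev (c # cs))) (h z) = eval (map h (rev cs)) (h z) \<otimes> h z \<oplus> h c"
    using eval_append_aux[of "map h (rev cs)" "h c" "h z"] by auto
  also have "\<dots> = h (poly (Poly (c # cs)) z)"
    unfolding Cons.IH by (simp add: h_add h_mult m_comm a_comm)
  finally show ?case .
qed simp

text \<open>The list is not normalized, so it represents a polynomial only if h does not kill the
  leading coefficient. Monic polynomials are safe in every characteristic.\<close>

definition list_of :: "'r poly \<Rightarrow> 'a list" where
  "list_of p = map h (rev (coeffs p))"

lemma coeff_list_of: "coeff (list_of p) i = h (poly.coeff p i)"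
proof (cases "i < length (coeffs p)")
  case True
  then show ?thesis
    by (subst coeff_nth) (auto simp: list_of_def rev_nth nth_default_nth simp flip: nth_default_coeffs_eq)
next
  case False
  then show ?thesis
    by (subst coeff_length) (auto simp: list_of_def nth_default_def simp flip: nth_default_coeffs_eq)
qed

lemma polynomial_list_of:
  assumes "Polynomial.lead_coeff p = 1"
  shows "polynomial (carrier K) (list_of p)" "hd (list_of p) = \<one>" "list_of p \<noteq> []"
    "length (list_of p) = Suc (Polynomial.degree p)"
proof -
  have "p \<noteq> 0" using assms by auto
  then show ne: "list_of p \<noteq> []" and len: "length (list_of p) = Suc (Polynomial.degree p)"
    by (auto simp: list_of_def length_coeffs_degree)
  show hd: "hd (list_of p) = \<one>"
    using \<open>p \<noteq> 0\<close> assms by (simp add: list_of_def hd_map hd_rev last_coeffs_eq_coeff_degree)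
  show "polynomial (carrier K) (list_of p)"
    unfolding polynomial_def using hd by (auto simp: list_of_def)
qed

lemma list_of_mult:
  assumes "Polynomial.lead_coeff p = 1" "Polynomial.lead_coeff q = 1"
  shows "list_of (p * q) = list_of p \<otimes>\<^bsub>poly_ring K\<^esub> list_of q"
proof -
  have pq: "Polynomial.lead_coeff (p * q) = 1" by (rule lead_coeff_mult_monic[OF assms])
  have sub: "set (list_of x) \<subseteq> carrier K" for x by (auto simp: list_of_def)
  have "coeff (list_of (p * q)) = coeff (poly_mult (list_of p) (list_of q))"
    unfolding poly_mult_coeff[OF sub sub] by (simp add: coeff_list_of coeff_mult h_sum h_mult fun_eq_iff)
  moreover have "polynomial (carrier K) (poly_mult (list_of p) (list_of q))"
    using assms by (intro poly_mult_is_polynomial carrier_is_subring sub)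
  ultimately show ?thesis
    unfolding univ_poly_mult
    using coeff_iff_polynomial_cond[OF polynomial_list_of(1)[OF pq]] by blast
qed

lemma list_of_linear: "list_of [:- x, 1:] = [\<one>, \<ominus> h x]"
  by (simp add: list_of_def h_uminus)

text \<open>Taylor's formula: expanding F at z by the binomial theorem gives exactly the Hasse
  coefficients, without dividing by factorials.\<close>

lemma eval_hasse_deriv:
  assumes F: "Polynomial.lead_coeff F = 1" and i: "i \<le> Polynomial.degree F"
  shows "eval (hasse_deriv K i (list_of F)) (h z) = h (poly.coeff (F \<circ>\<^sub>p [:z, 1:]) i)"
proof -
  define n where "n = Polynomial.degree F"
  have len: "length (list_of F) - 1 = n" "F \<noteq> 0"
    using polynomial_list_of(4)[OF F] F by (auto simp: n_def)
  \<comment> \<open>The coefficients of the Hasse derivative in increasing order, before any of them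
    is annihilated by h.\<close>
  define cs where "cs = map (\<lambda>m. of_nat ((i + m) choose i) * poly.coeff F (i + m)) [0..<n - i + 1]"
  have "map (\<lambda>k. [((n - k) choose i)] \<cdot> (list_of F ! k)) [0..<n - i + 1] = map h (rev cs)"
  proof (rule nth_equalityI)
    fix k assume "k < length (map (\<lambda>k. [((n - k) choose i)] \<cdot> (list_of F ! k)) [0..<n - i + 1])"
    then have k: "k \<le> n - i" by simp
    have "i + (n - i - k) = n - k" using k i by (simp add: n_def)
    moreover have "list_of F ! k = h (poly.coeff F (n - k))"
      using k len(2) by (simp add: list_of_def rev_nth length_coeffs_degree coeffs_nth n_def)
    ultimately show "map (\<lambda>k. [((n - k) choose i)] \<cdot> (list_of F ! k)) [0..<n - i + 1] ! k = map h (rev cs) ! k"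
      using k nth_upt[of 0 "n - (i + k)" "Suc (n - i)"]
      by (simp add: cs_def rev_nth h_of_nat_mult del: upt_Suc)
  qed (simp add: cs_def)
  then have "hasse_deriv K i (list_of F) = normalize (map h (rev cs))"
    by (simp only: hasse_deriv_def len)
  then have "eval (hasse_deriv K i (list_of F)) (h z) = h (poly (Poly cs) z)"
    by (simp only:) (subst eval_normalize, auto simp: eval_map_rev)
  also have "poly (Poly cs) z = (\<Sum>m\<le>n - i. of_nat ((i + m) choose i) * poly.coeff F (i + m) * z ^ m)"
  proof -
    have "poly (Poly (map f [0..<N])) z = (\<Sum>m<N. f m * z ^ m)" for f :: "nat \<Rightarrow> 'r" and N
      by (induction N) (simp_all add: Poly_append poly_monom mult.commute)
    then show ?thesis unfolding cs_def by (simp only: Suc_eq_plus1[symmetric] lessThan_Suc_atMost)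
  qed
  also have "\<dots> = poly.coeff (F \<circ>\<^sub>p [:z, 1:]) i"
  proof -
    have "poly.coeff (F \<circ>\<^sub>p [:z, 1:]) i = (\<Sum>j\<le>n. poly.coeff F j * poly.coeff ([:z, 1:] ^ j) i)"
      by (simp add: pcompose_altdef poly_altdef coeff_sum coeff_map_poly n_def degree_map_poly)
    also have "\<dots> = (\<Sum>j\<in>{i..n}. poly.coeff F j * poly.coeff ([:z, 1:] ^ j) i)"
    proof (rule sum.mono_neutral_right)
      have "poly.coeff ([:z, 1:] ^ j) i = 0" if "j < i" for j
        by (rule coeff_eq_0) (use that in \<open>simp add: degree_linear_power\<close>)
      then show "\<forall>j\<in>{..n} - {i..n}. poly.coeff F j * poly.coeff ([:z, 1:] ^ j) i = 0" by auto
    qed auto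
    also have "\<dots> = (\<Sum>m\<in>{0..n - i}. poly.coeff F (i + m) * poly.coeff ([:z, 1:] ^ (i + m)) i)"
      using i sum.shift_bounds_cl_nat_ivl[of "\<lambda>j. poly.coeff F j * poly.coeff ([:z, 1:] ^ j) i" 0 i "n - i"]
      by (simp add: n_def add.commute)
    also have "\<dots> = (\<Sum>m\<le>n - i. of_nat ((i + m) choose i) * poly.coeff F (i + m) * z ^ m)"
      unfolding atLeast0AtMost by (intro sum.cong refl) (simp add: coeff_linear_poly_power algebra_simps)
    finally show ?thesis ..
  qed
  finally show ?thesis .
qed

end

text \<open>Both homomorphisms may have different sources; the coefficients arise from the constant
  terms of the factors by ring operations alone, so agreement on these is enough.\<close>

lemma hom_to_field_coeff_prod_eq:
  assumes "hom_to_field K g" "hom_to_field K h" "\<And>j. j \<in> J \<Longrightarrow> g (u j) = h (v j)"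
  shows "g (poly.coeff (\<Prod>j\<in>J. [:u j, 1:]) l) = h (poly.coeff (\<Prod>j\<in>J. [:v j, 1:]) l)"
proof -
  interpret g: hom_to_field K g by fact
  interpret h: hom_to_field K h by fact
  show ?thesis
    using assms(3)
    by (induction J arbitrary: l rule: infinite_finite_induct)
       (auto simp: coeff_pCons one_pCons g.h_add h.h_add g.h_mult h.h_mult split: nat.split)
qed

text \<open>The universal property of integer polynomials, for a field that is a record rather than
  a type, where \<open>ev\<close> does not apply.\<close>

lemma (in field) exists_mpoly_hom:
  assumes \<alpha>: "\<And>i :: nat. \<alpha> i \<in> carrier R"
  shows "\<exists>h :: int mpoly \<Rightarrow> 'a. hom_to_field R h \<and> (\<forall>i. h (var i) = \<alpha> i)"
proof -
  define mon where "mon m = (\<Otimes>i\<in>keys m. \<alpha> i [^] (lookup m i :: nat))" for m :: "nat \<Rightarrow>\<^sub>0 nat"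
  have mon_closed [simp]: "mon m \<in> carrier R" for m
    unfolding mon_def using \<alpha> by (intro finprod_closed) auto
  have mon_superset: "mon m = (\<Otimes>i\<in>S. \<alpha> i [^] lookup m i)" if "finite S" "keys m \<subseteq> S" for m S
    unfolding mon_def using that \<alpha>
    by (intro add.finprod_mono_neutral_cong_left finprod_mono_neutral_cong_left) (auto simp: in_keys_iff)
  have mon_add: "mon (m + m') = mon m \<otimes> mon m'" for m m'
  proof -
    let ?S = "keys m \<union> keys m'"
    have "keys (m + m') \<subseteq> ?S" by (rule keys_add)
    then have "mon (m + m') = (\<Otimes>i\<in>?S. \<alpha> i [^] lookup m i \<otimes> \<alpha> i [^] lookup m' i)"
      using \<alpha> by (subst mon_superset[of ?S]) (auto simp: lookup_add nat_pow_mult intro!: finprod_cong)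
    also have "\<dots> = mon m \<otimes> mon m'"
      using \<alpha> by (subst finprod_multf) (auto simp: mon_superset[of ?S])
    finally show ?thesis .
  qed
  define h :: "int mpoly \<Rightarrow> 'a" where "h p = (\<Oplus>m\<in>keys p. [lookup p m] \<cdot> mon m)" for p
  have zero_mult: "[(0 :: int)] \<cdot> x = \<zero>" for x
    by (simp add: add_pow_def int_pow_0)
  have h_superset: "h p = (\<Oplus>m\<in>S. [lookup p m] \<cdot> mon m)" if "finite S" "keys p \<subseteq> S" for p S
    unfolding h_def using that
    by (intro add.finprod_mono_neutral_cong_left) (auto simp: in_keys_iff zero_mult)
  have h_closed: "h p \<in> carrier R" for p unfolding h_def by (intro finsum_closed) auto
  have h_add: "h (p + q) = h p \<oplus> h q" for p q
  proof -
    let ?S = "keys p \<union> keys q"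
    have "keys (p + q) \<subseteq> ?S" by (rule keys_add)
    then have "h (p + q) = (\<Oplus>m\<in>?S. [lookup p m] \<cdot> mon m \<oplus> [lookup q m] \<cdot> mon m)"
      by (subst h_superset[of ?S]) (auto simp: lookup_add add.int_pow_mult intro!: finsum_cong)
    also have "\<dots> = h p \<oplus> h q"
      by (subst finsum_addf) (auto simp: h_superset[of ?S])
    finally show ?thesis .
  qed
  have h_term: "h (term_of m c) = [c] \<cdot> mon m" for m c
    by (subst h_superset[of "{m}"]) auto
  have h_mult: "h (p * q) = h p \<otimes> h q" for p q
  proof (induction p rule: mpoly_induct)
    case (single m c)
    show ?case
    proof (induction q rule: mpoly_induct)
      case (single m' c')
      have "([c] \<cdot> mon m) \<otimes> ([c'] \<cdot> mon m') = [(c * c')] \<cdot> (mon m \<otimes> mon m')"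
        by (simp add: add_pow_ldistr_int add_pow_rdistr_int add.int_pow_pow mult.commute)
      then show ?case by (simp add: h_term mult_single mon_add)
    qed (simp add: distrib_left h_add r_distr h_closed)
  qed (simp add: distrib_right h_add l_distr h_closed)
  have "hom_to_field R h"
  proof
    show "h 0 = \<zero>" by (simp add: h_def)
    show "h 1 = \<one>" using h_term[of 0 1] by (simp add: mon_def add.int_pow_1)
  qed (auto simp: h_closed h_add h_mult)
  moreover have "h (var i) = \<alpha> i" for i
    using \<alpha> by (simp add: h_term mon_def)
  ultimately show ?thesis by blast
qed

subsection \<open>Casas--Alvero polynomials over an algebraically closed field\<close>

primrec root_prod :: "('a, 'b) ring_scheme \<Rightarrow> (nat \<Rightarrow> 'a) \<Rightarrow> nat \<Rightarrow> 'a list" where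
  "root_prod K \<alpha> 0 = \<one>\<^bsub>poly_ring K\<^esub>"
| "root_prod K \<alpha> (Suc n) = root_prod K \<alpha> n \<otimes>\<^bsub>poly_ring K\<^esub> [\<one>\<^bsub>K\<^esub>, \<ominus>\<^bsub>K\<^esub> \<alpha> n]"

context field
begin

lemma linear_in_carrier: "x \<in> carrier R \<Longrightarrow> [\<one>, \<ominus> x] \<in> carrier (poly_ring R)"
  unfolding univ_poly_carrier[symmetric] polynomial_def by auto

lemma root_prod_closed: "(\<And>j. j < n \<Longrightarrow> \<alpha> j \<in> carrier R) \<Longrightarrow> root_prod R \<alpha> n \<in> carrier (poly_ring R)"
proof (induction n)
  interpret UP: domain "poly_ring R" using univ_poly_is_domain[OF carrier_is_subring] .
  case 0
  show ?case by simp
next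
  interpret UP: domain "poly_ring R" using univ_poly_is_domain[OF carrier_is_subring] .
  case (Suc n)
  then show ?case by (simp add: linear_in_carrier)
qed

lemma root_prod_const: "root_prod R (\<lambda>_. b) n = [\<one>, \<ominus> b] [^]\<^bsub>poly_ring R\<^esub> n"
  by (induction n) simp_all

lemma root_prod_cong: "(\<And>j. j < n \<Longrightarrow> \<alpha> j = \<beta> j) \<Longrightarrow> root_prod R \<alpha> n = root_prod R \<beta> n"
  by (induction n) simp_all

lemma eval_root_prod_eq_0_iff:
  assumes "\<And>j. j < n \<Longrightarrow> \<alpha> j \<in> carrier R" "y \<in> carrier R"
  shows "eval (root_prod R \<alpha> n) y = \<zero> \<longleftrightarrow> (\<exists>j<n. y = \<alpha> j)"
  using assms(1)
proof (induction n)
  case 0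
  then show ?case using assms(2) by (simp add: univ_poly_one)
next
  case (Suc n)
  have hom: "(\<lambda>p. eval p y) \<in> Ring.ring_hom (poly_ring R) R"
    by (rule eval_is_hom[OF carrier_is_subring assms(2)])
  have cl: "root_prod R \<alpha> n \<in> carrier (poly_ring R)" using Suc.prems by (intro root_prod_closed) auto
  have "eval (root_prod R \<alpha> (Suc n)) y = eval (root_prod R \<alpha> n) y \<otimes> (y \<ominus> \<alpha> n)"
    using ring_hom_mult[OF hom cl linear_in_carrier[of "\<alpha> n"]] Suc.prems[of n] assms(2) by (simp add: minus_eq)
  moreover have "eval (root_prod R \<alpha> n) y \<in> carrier R"
    using ring_hom_closed[OF hom cl] .
  ultimately have "eval (root_prod R \<alpha> (Suc n)) y = \<zero> \<longleftrightarrow> eval (root_prod R \<alpha> n) y = \<zero> \<or> y \<ominus> \<alpha> n = \<zero>"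
    using Suc.prems[of n] assms(2) by (simp add: integral_iff)
  then show ?case
    using Suc r_right_minus_eq[OF assms(2) Suc.prems[of n]] by (auto simp: less_Suc_eq)
qed

end

lemma (in algebraically_closed) polynomial_has_root:
  assumes "p \<in> carrier (poly_ring L)" "Polynomials.degree p \<ge> 1"
  shows "\<exists>y\<in>carrier L. eval p y = \<zero>"
proof -
  have "roots p \<noteq> {#}" using roots_over_carrier[OF assms(1)] assms(2) by (auto simp: splitted_def)
  then obtain y where "y \<in># roots p" by auto
  then have "is_root p y" using roots_mem_iff_is_root[OF assms(1)] by simp
  then show ?thesis by (auto simp: is_root_def)
qed

text \<open>The map sending x to x(x - 1) is onto, as each equation x(x - 1) = c is solvable, but it
  identifies 0 and 1; a finite set admits no such self-map.\<close>

lemma (in algebraically_closed) infinite_carrier: "infinite (carrier L)"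
proof
  assume fin: "finite (carrier L)"
  define f where "f x = x \<otimes> (x \<ominus> \<one>)" for x
  have surj: "\<exists>x\<in>carrier L. f x = c" if c: "c \<in> carrier L" for c
  proof -
    have "[\<one>, \<ominus> \<one>, \<ominus> c] \<in> carrier (poly_ring L)"
      unfolding univ_poly_carrier[symmetric] polynomial_def using c by auto
    from polynomial_has_root[OF this] obtain x where x: "x \<in> carrier L" "eval [\<one>, \<ominus> \<one>, \<ominus> c] x = \<zero>" by auto
    have "f x \<ominus> c = eval [\<one>, \<ominus> \<one>, \<ominus> c] x"
      using x(1) c by (simp add: f_def numeral_2_eq_2) algebra
    then have "f x \<ominus> c = \<zero>" using x(2) by simp
    then show ?thesis using x(1) c by (intro bexI[of _ x]) (auto simp: f_def)
  qed
  have "carrier L \<subseteq> f ` (carrier L - {\<one>})"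
  proof
    fix c assume "c \<in> carrier L"
    then obtain x where x: "x \<in> carrier L" "f x = c" using surj by blast
    show "c \<in> f ` (carrier L - {\<one>})"
    proof (cases "x = \<one>")
      case True
      then have "c = \<zero>" using x by (simp add: f_def minus_eq r_neg)
      then show ?thesis by (intro image_eqI[of _ _ \<zero>]) (auto simp: f_def)
    qed (use x in auto)
  qed
  then have "card (carrier L) \<le> card (f ` (carrier L - {\<one>}))" using fin by (intro card_mono) auto
  also have "\<dots> \<le> card (carrier L - {\<one>})" using fin by (intro card_image_le) auto
  also have "\<dots> < card (carrier L)" using fin by (intro psubset_card_mono) auto
  finally show False by simp
qed

lemma (in algebraically_closed) monic_eq_root_prod:
  assumes "monic_poly L f"
  shows "\<exists>\<alpha>. (\<forall>j. \<alpha> j \<in> carrier L) \<and> f = root_prod L \<alpha> (Polynomials.degree f)"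
  using assms
proof (induction "Polynomials.degree f" arbitrary: f)
  case 0
  then have "f = [\<one>]" by (cases f) (auto simp: monic_poly_def)
  then show ?case by (intro exI[of _ "\<lambda>_. \<zero>"]) (simp add: univ_poly_one)
next
  case (Suc n)
  interpret UP: domain "poly_ring L" using univ_poly_is_domain[OF carrier_is_subring] .
  have f: "f \<in> carrier (poly_ring L)" "f \<noteq> []" "Polynomials.lead_coeff f = \<one>" using Suc.prems by (auto simp: monic_poly_def)
  obtain y where y: "y \<in> carrier L" "eval f y = \<zero>" using polynomial_has_root[OF f(1)] Suc.hyps(2) by auto
  then have "[\<one>, \<ominus> y] pdivides f" using f by (intro is_root_imp_pdivides) (auto simp: is_root_def)
  then obtain q where q: "q \<in> carrier (poly_ring L)" "f = [\<one>, \<ominus> y] \<otimes>\<^bsub>poly_ring L\<^esub> q"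
    unfolding pdivides_def factor_def by auto
  have lin: "[\<one>, \<ominus> y] \<in> carrier (poly_ring L)" using linear_in_carrier[OF y(1)] .
  have "q \<noteq> []"
  proof
    assume "q = []"
    then have "f = []" using q lin by (metis UP.r_null univ_poly_zero)
    then show False using f(2) by simp
  qed
  have mult: "polynomial (carrier L) [\<one>, \<ominus> y]" "polynomial (carrier L) q" "f = poly_mult [\<one>, \<ominus> y] q"
    using lin q by (simp_all add: univ_poly_carrier univ_poly_mult)
  have "Polynomials.degree f = Polynomials.degree [\<one>, \<ominus> y] + Polynomials.degree q"
    using poly_mult_degree_eq[OF carrier_is_subring mult(1,2)] \<open>q \<noteq> []\<close> mult(3) by simp
  then have deg: "Polynomials.degree q = n" using Suc.hyps(2) by simp
  have "Polynomials.lead_coeff f = \<one> \<otimes> Polynomials.lead_coeff q"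
    using poly_mult_lead_coeff[OF carrier_is_subring mult(1,2)] \<open>q \<noteq> []\<close> mult(3) by simp
  moreover have "Polynomials.lead_coeff q \<in> carrier L"
    using mult(2) \<open>q \<noteq> []\<close> by (cases q) (auto simp: polynomial_def)
  ultimately have "monic_poly L q" using f(3) q(1) \<open>q \<noteq> []\<close> by (simp add: monic_poly_def)
  then obtain \<alpha> where \<alpha>: "\<And>j. \<alpha> j \<in> carrier L" "q = root_prod L \<alpha> n"
    using Suc.hyps(1)[of q] deg by auto
  have "f = root_prod L (\<alpha>(n := y)) (Suc n)"
    using q lin root_prod_cong[of n \<alpha> "\<alpha>(n := y)"] UP.m_comm[OF lin q(1)] by (simp add: \<alpha>(2))
  then show ?case
    using \<alpha>(1) y(1) Suc.hyps(2) by (intro exI[of _ "\<alpha>(n := y)"]) auto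
qed

text \<open>A nonconstant common factor has a root, and conversely a common root gives a linear
  common factor.\<close>

lemma (in algebraically_closed) casas_alvero_iff:
  assumes f: "monic_poly L f"
  shows "casas_alvero L f \<longleftrightarrow>
    (\<forall>i\<in>{1..Polynomials.degree f - 1}. \<exists>y\<in>carrier L. eval f y = \<zero> \<and> eval (hasse_deriv L i f) y = \<zero>)"
proof -
  have f': "f \<in> carrier (poly_ring L)" "f \<noteq> []" using f by (auto simp: monic_poly_def)
  have "(\<exists>g\<in>carrier (poly_ring L). Polynomials.degree g \<ge> 1 \<and> g pdivides f \<and> g pdivides hasse_deriv L i f) \<longleftrightarrow>
      (\<exists>y\<in>carrier L. eval f y = \<zero> \<and> eval (hasse_deriv L i f) y = \<zero>)" (is "?l = ?r") for i
  proof
    assume ?l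
    then show ?r using polynomial_has_root pdivides_imp_root_sharing by metis
  next
    assume ?r
    then obtain y where y: "y \<in> carrier L" "eval f y = \<zero>" "eval (hasse_deriv L i f) y = \<zero>" by blast
    have cl: "hasse_deriv L i f \<in> carrier (poly_ring L)"
    proof -
      have "set f \<subseteq> carrier L"
        using f'(1) by (auto simp: polynomial_def simp flip: univ_poly_carrier)
      then have "f ! k \<in> carrier L" if "k < Polynomials.degree f - i + 1" for k
      proof -
        have "k < length f" using that f'(2) length_greater_0_conv[of f] by arith
        then show ?thesis using \<open>set f \<subseteq> carrier L\<close> nth_mem by blast
      qed
      then show ?thesis
        unfolding hasse_deriv_def univ_poly_carrier[symmetric]
        by (intro normalize_gives_polynomial) auto
    qed
    have "[\<one>, \<ominus> y] pdivides hasse_deriv L i f"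
    \<comment> \<open>In positive characteristic the derivative may vanish identically;
      \<open>is_root\<close> excludes the zero polynomial, which is divisible by everything.\<close>
    proof (cases "hasse_deriv L i f = []")
      case True
      then show ?thesis using pdivides_zero[OF carrier_is_subring linear_in_carrier[OF y(1)]] by simp
    qed (use y cl in \<open>auto intro!: is_root_imp_pdivides simp: is_root_def\<close>)
    moreover have "[\<one>, \<ominus> y] pdivides f"
      using y f' by (intro is_root_imp_pdivides) (auto simp: is_root_def)
    ultimately show ?l using linear_in_carrier[OF y(1)] by (intro bexI[of _ "[\<one>, \<ominus> y]"]) auto
  qed
  then show ?thesis by (simp add: casas_alvero_def)
qed

lemma
  fixes x :: "nat \<Rightarrow> 'a::comm_ring_1"
  shows degree_prod_linear: "Polynomial.degree (\<Prod>j<n. [:- x j, 1:]) = n"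
    and lead_coeff_prod_linear: "Polynomial.lead_coeff (\<Prod>j<n. [:- x j, 1:]) = 1"
proof -
  have "Polynomial.degree (\<Prod>j<n. [:- x j, 1:]) = n \<and> poly.coeff (\<Prod>j<n. [:- x j, 1:]) n = 1"
  proof (induction n)
    case (Suc n)
    define p q where "p = (\<Prod>j<n. [:- x j, 1:])" and "q = [:- x n, 1:]"
    have pq: "poly.coeff p n = 1" "Polynomial.degree p = n" "poly.coeff q 1 = 1" "Polynomial.degree q = 1"
      using Suc by (auto simp: p_def q_def)
    have "poly.coeff (p * q) (Suc n) = 1"
      using coeff_mult_degree_sum[of p q] pq by simp
    moreover from this have "Polynomial.degree (p * q) = Suc n"
      using pq degree_mult_le[of p q] by (intro antisym le_degree) auto
    ultimately show ?case by (simp only: prod.lessThan_Suc p_def q_def)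
  qed simp
  then show "Polynomial.degree (\<Prod>j<n. [:- x j, 1:]) = n"
    "Polynomial.lead_coeff (\<Prod>j<n. [:- x j, 1:]) = 1" by simp_all
qed

lemma (in hom_to_field) list_of_prod:
  "list_of (\<Prod>j<n. [:- x j, 1:]) = root_prod K (\<lambda>j. h (x j)) n"
proof (induction n)
  case (Suc n)
  then show ?case by (simp add: list_of_mult list_of_linear lead_coeff_prod_linear del: mult_pCons_right mult_pCons_left)
qed (simp add: list_of_def univ_poly_one)


text \<open>Inherited from the generic product over \<open>int mpoly\<close>, specialized at the
  roots.\<close>

lemma (in field) monic_root_prod:
  assumes \<alpha>: "\<And>j. \<alpha> j \<in> carrier R"
  shows "monic_poly R (root_prod R \<alpha> n) \<and> Polynomials.degree (root_prod R \<alpha> n) = n"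
proof -
  obtain g :: "int mpoly \<Rightarrow> 'a" where g: "hom_to_field R g" "\<And>i. g (var i) = \<alpha> i"
    using exists_mpoly_hom[of \<alpha>] \<alpha> by auto
  interpret g: hom_to_field R g by fact
  have "root_prod R \<alpha> n = g.list_of (\<Prod>j<n. [:- var j, 1:])"
    unfolding g.list_of_prod g(2) ..
  then show ?thesis
    using g.polynomial_list_of[OF lead_coeff_prod_linear[of var n]] degree_prod_linear[of var n]
    by (auto simp: monic_poly_def univ_poly_carrier)
qed

text \<open>Hasse derivatives at a root depend only on differences of roots. Hence the translated
  roots used by h give the same values as the actual roots used by g.\<close>

theorem (in algebraically_closed) casas_alvero_root_prod_iff:
  fixes h :: "int mpoly \<Rightarrow> 'a"
  assumes \<alpha>: "\<And>j. \<alpha> j \<in> carrier L" and h: "hom_to_field L h"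
    and h_root: "\<And>j. j \<le> r \<Longrightarrow> h (root_var r j) = \<alpha> j \<ominus> \<alpha> r"
  shows "casas_alvero L (root_prod L \<alpha> (Suc r)) \<longleftrightarrow> (\<forall>i\<in>{1..r}. \<exists>k\<le>r. h (hasse_form r i k) = \<zero>)"
proof -
  obtain g :: "int mpoly \<Rightarrow> 'a" where g: "hom_to_field L g" "\<And>i. g (var i) = \<alpha> i"
    using exists_mpoly_hom[of \<alpha>] \<alpha> by auto
  interpret g: hom_to_field L g by fact
  interpret h: hom_to_field L h by fact
  define F :: "int mpoly poly" where "F = (\<Prod>j<Suc r. [:- var j, 1:])"
  have F1: "Polynomial.lead_coeff F = 1" "Polynomial.degree F = Suc r"
    unfolding F_def by (rule lead_coeff_prod_linear degree_prod_linear)+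
  define f where "f = root_prod L \<alpha> (Suc r)"
  have f: "f = g.list_of F" unfolding f_def F_def g.list_of_prod g(2) ..
  have monic: "monic_poly L f" "length f - 1 = Suc r"
    using monic_root_prod[of \<alpha> "Suc r", OF \<alpha>] unfolding f_def by blast+
  have hasse: "eval (hasse_deriv L i f) (\<alpha> k) = h (hasse_form r i k)" if "i \<le> r" "k \<le> r" for i k
  proof -
    have "eval (hasse_deriv L i f) (\<alpha> k) = g (poly.coeff (F \<circ>\<^sub>p [:var k, 1:]) i)"
      using g.eval_hasse_deriv[OF F1(1), of i "var k"] that F1(2) by (simp add: f g(2))
    also have "F \<circ>\<^sub>p [:var k, 1:] = (\<Prod>j<Suc r. [:var k - var j, 1:])"
      unfolding F_def pcompose_prod by (intro prod.cong refl) (simp add: pcompose_pCons)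
    also have "g (poly.coeff (\<Prod>j<Suc r. [:var k - var j, 1:]) i) = h (hasse_form r i k)"
      unfolding hasse_form_def
    proof (rule hom_to_field_coeff_prod_eq[OF g(1) h])
      fix j assume "j \<in> {..<Suc r}"
      then have "h (root_var r k - root_var r j) = (\<alpha> k \<ominus> \<alpha> r) \<ominus> (\<alpha> j \<ominus> \<alpha> r)"
        using that by (simp add: h.h_diff h_root)
      also have "\<dots> = \<alpha> k \<ominus> \<alpha> j" using \<alpha>[of j] \<alpha>[of k] \<alpha>[of r] by algebra
      finally show "g (var k - var j) = h (root_var r k - root_var r j)"
        by (simp add: g.h_diff g(2))
    qed
    finally show ?thesis .
  qed
  have "(\<exists>y\<in>carrier L. eval f y = \<zero> \<and> eval (hasse_deriv L i f) y = \<zero>) \<longleftrightarrow>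
      (\<exists>k\<le>r. h (hasse_form r i k) = \<zero>)" if "i \<in> {1..r}" for i
  proof -
    have "(\<exists>y\<in>carrier L. eval f y = \<zero> \<and> eval (hasse_deriv L i f) y = \<zero>) \<longleftrightarrow>
        (\<exists>k<Suc r. eval (hasse_deriv L i f) (\<alpha> k) = \<zero>)"
      using eval_root_prod_eq_0_iff[of "Suc r" \<alpha>] \<alpha> unfolding f_def[symmetric] by blast
    also have "\<dots> \<longleftrightarrow> (\<exists>k\<le>r. h (hasse_form r i k) = \<zero>)"
      using hasse that by (auto simp: less_Suc_eq_le)
    finally show ?thesis .
  qed
  then show ?thesis
    unfolding f_def[symmetric] casas_alvero_iff[OF monic(1)] using monic(2) by simp
qed

subsection \<open>A countable algebraically closed field inside an infinite type\<close>

text \<open>Transport of structure along an injection, turning a field type into a record over 'u to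
  which \<open>CA\<close> can be applied.\<close>

definition image_field :: "('k::field \<Rightarrow> 'u) \<Rightarrow> 'u ring" where
  "image_field \<phi> = \<lparr>carrier = range \<phi>, monoid.mult = (\<lambda>x y. \<phi> (inv_into UNIV \<phi> x * inv_into UNIV \<phi> y)),
    one = \<phi> 1, ring.zero = \<phi> 0, add = (\<lambda>x y. \<phi> (inv_into UNIV \<phi> x + inv_into UNIV \<phi> y))\<rparr>"

lemma field_image_field:
  assumes "inj (\<phi> :: 'k::field \<Rightarrow> 'u)"
  shows "field (image_field \<phi>)"
proof -
  have [simp]: "inv_into UNIV \<phi> (\<phi> x) = x" "\<phi> x = \<phi> y \<longleftrightarrow> x = y" for x y
    using assms by (auto simp: inj_eq)
  have "\<exists>y. x + y = 0" for x :: 'k using add.right_inverse by blast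
  moreover have "x \<noteq> 0 \<Longrightarrow> \<exists>y. x * y = 1" for x :: 'k by (rule exI[of _ "inverse x"]) auto
  ultimately show ?thesis
    unfolding image_field_def
    by unfold_locales (auto simp: algebra_simps Units_def)
qed

lemma hom_to_image_field:
  assumes "inj \<phi>" "comm_ring_hom f"
  shows "hom_to_field (image_field \<phi>) (\<lambda>x. \<phi> (f x))"
proof -
  interpret f: comm_ring_hom f by fact
  interpret field "image_field \<phi>" by (rule field_image_field[OF assms(1)])
  show ?thesis
    by unfold_locales
       (auto simp: image_field_def f.hom_add f.hom_mult inv_into_f_f[OF assms(1)])
qed

lemma algebraically_closed_image_field:
  assumes "inj (\<phi> :: 'k::alg_closed_field \<Rightarrow> 'u)"
  shows "algebraically_closed (image_field \<phi>)"
proof -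
  interpret hom_to_field "image_field \<phi>" \<phi>
    using hom_to_image_field[OF assms comm_ring_hom_id] by simp
  have carrier: "carrier (image_field \<phi>) = range \<phi>" by (simp only: image_field_def partial_object.simps)
  show ?thesis
  proof (rule algebraically_closedI)
    fix p assume p: "p \<in> carrier (poly_ring (image_field \<phi>))" "Polynomials.degree p > 1"
    have p': "p \<noteq> []" "set p \<subseteq> range \<phi>" "hd p \<noteq> \<phi> 0"
      using p by (auto simp: polynomial_def carrier simp flip: univ_poly_carrier)
    define cs where "cs = rev (map (inv_into UNIV \<phi>) p)"
    have p_eq: "p = map \<phi> (rev cs)"
      using p'(2) by (auto simp: cs_def f_inv_into_f subset_iff intro!: map_idI[symmetric])
    have cs: "length cs = length p" "\<phi> (last cs) = hd p"
    proof -
      have "hd p \<in> range \<phi>" using p'(2) hd_in_set[OF p'(1)] by blast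
      then show "\<phi> (last cs) = hd p"
        using p'(1) by (simp only: cs_def last_rev hd_map map_is_Nil_conv f_inv_into_f not_False_eq_True)
    qed (simp add: cs_def)
    have "last cs \<noteq> 0" using cs(2) p'(3) by metis
    moreover have "cs \<noteq> []" using cs(1) p'(1) by auto
    moreover have "length p - 1 < length cs" using cs(1) p'(1) by (cases p) auto
    ultimately have "poly.coeff (Poly cs) (length p - 1) \<noteq> 0"
      using cs(1) by (simp add: nth_default_def last_conv_nth)
    then have "Polynomial.degree (Poly cs) > 0" using le_degree p(2) by fastforce
    then obtain z where "poly (Poly cs) z = 0" using alg_closed_imp_poly_has_root by blast
    then have "eval p (\<phi> z) = \<zero>\<^bsub>image_field \<phi>\<^esub>" unfolding p_eq eval_map_rev by simp
    then show "\<exists>x\<in>carrier (image_field \<phi>). eval p x = \<zero>\<^bsub>image_field \<phi>\<^esub>" by blast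
  qed
qed

text \<open>Every element is a root of one of countably many nonzero polynomials, each of which has
  finitely many roots.\<close>

lemma countable_alg_closure: "countable (UNIV :: 'a::{field, countable} alg_closure set)"
proof -
  have "countable (range (Poly :: 'a list \<Rightarrow> 'a poly))" by (rule countable_image) simp
  moreover have "range (Poly :: 'a list \<Rightarrow> 'a poly) = UNIV" by (metis Poly_coeffs surjI)
  ultimately have "countable {p :: 'a poly. p \<noteq> 0}" by (metis countable_subset subset_UNIV)
  moreover have "countable {x. poly (map_poly to_ac p) x = 0}" if "p \<noteq> 0" for p :: "'a poly"
  proof -
    have "map_poly to_ac p \<noteq> 0" using that by (simp add: map_poly_eq_0_iff)
    then show ?thesis by (intro countable_finite poly_roots_finite)
  qed
  ultimately have "countable (\<Union>p\<in>{p :: 'a poly. p \<noteq> 0}. {x. poly (map_poly to_ac p) x = 0})"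
    by (intro countable_UN) auto
  moreover have "(UNIV :: 'a alg_closure set) \<subseteq> (\<Union>p\<in>{p :: 'a poly. p \<noteq> 0}. {x. poly (map_poly to_ac p) x = 0})"
  proof
    fix x :: "'a alg_closure"
    obtain p :: "'a poly" where "p \<noteq> 0" "poly (map_poly to_ac p) x = 0" by (rule alg_closure_algebraic)
    then show "x \<in> (\<Union>p\<in>{p :: 'a poly. p \<noteq> 0}. {x. poly (map_poly to_ac p) x = 0})" by blast
  qed
  ultimately show ?thesis by (rule countable_subset[rotated])
qed

text \<open>A common zero of the forms provides the roots of a Casas--Alvero polynomial that also
  has the root 0. Being the n-th power of a linear polynomial, it has no other root.\<close>

lemma CA_0_hasse_forms:
  fixes a :: "nat \<Rightarrow> rat alg_closure"
  assumes CA: "CA TYPE('u) (Suc r) 0" and inf: "infinite (UNIV :: 'u set)"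
    and \<kappa>: "\<And>i. 1 \<le> i \<Longrightarrow> i \<le> r \<Longrightarrow> \<kappa> i \<le> r"
    and forms_0: "\<And>i. 1 \<le> i \<Longrightarrow> i \<le> r \<Longrightarrow> ev of_int a (hasse_form r i (\<kappa> i)) = 0" and j: "j < r"
  shows "a j = 0"
proof -
  obtain e :: "nat \<Rightarrow> 'u" where e: "inj e"
    using infinite_countable_subset[OF inf] by auto
  define \<phi> :: "rat alg_closure \<Rightarrow> 'u" where "\<phi> x = e (to_nat_on UNIV x)" for x
  have \<phi>: "inj \<phi>"
    using e inj_on_to_nat_on[OF countable_alg_closure] by (auto simp: \<phi>_def inj_on_def)
  define K where "K = image_field \<phi>"
  interpret algebraically_closed K
    unfolding K_def by (rule algebraically_closed_image_field[OF \<phi>])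
  interpret \<phi>: hom_to_field K \<phi>
    using hom_to_image_field[OF \<phi> comm_ring_hom_id] by (simp add: K_def)
  have ev_hom: "comm_ring_hom (ev of_int a :: int mpoly \<Rightarrow> rat alg_closure)"
    by (intro comm_ring_hom.ev_hom comm_ring_hom_of_int)
  interpret ev: comm_ring_hom "ev of_int a :: int mpoly \<Rightarrow> rat alg_closure" by (rule ev_hom)
  define h where "h p = \<phi> (ev of_int a p)" for p
  have h: "hom_to_field K h"
    unfolding h_def K_def by (rule hom_to_image_field[OF \<phi> ev_hom])
  \<comment> \<open>Index r receives the root 0 of the normalization.\<close>
  define \<alpha> where "\<alpha> j = \<phi> (if j < r then a j else 0)" for j
  have \<alpha>: "\<alpha> j \<in> carrier K" for j by (simp add: \<alpha>_def)
  have root: "h (root_var r j) = \<alpha> j \<ominus>\<^bsub>K\<^esub> \<alpha> r" if "j \<le> r" for j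
    by (auto simp: h_def root_var_def \<alpha>_def comm_ring_hom.ev_term[OF comm_ring_hom_of_int] minus_eq)
  have "\<exists>k\<le>r. h (hasse_form r i k) = \<zero>\<^bsub>K\<^esub>" if "i \<in> {1..r}" for i
    using that \<kappa>[of i] forms_0[of i] by (intro exI[of _ "\<kappa> i"]) (simp add: h_def)
  then have "casas_alvero K (root_prod K \<alpha> (Suc r))"
    using casas_alvero_root_prod_iff[OF \<alpha> h root] by blast
  moreover have "monic_poly K (root_prod K \<alpha> (Suc r)) \<and> Polynomials.degree (root_prod K \<alpha> (Suc r)) = Suc r"
    by (rule monic_root_prod[OF \<alpha>])
  moreover have "has_char K 0"
  proof -
    have "[m] \<cdot>\<^bsub>K\<^esub> \<one>\<^bsub>K\<^esub> = \<zero>\<^bsub>K\<^esub> \<longleftrightarrow> m = 0" for m :: nat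
      using \<phi>.h_of_nat[of m] \<phi>.h_0 \<phi> by (metis inj_eq of_nat_eq_0_iff)
    then show ?thesis by (simp add: has_char_def)
  qed
  ultimately obtain b where b: "b \<in> carrier K" "root_prod K \<alpha> (Suc r) = root_prod K (\<lambda>_. b) (Suc r)"
    using CA algebraically_closed_axioms unfolding CA_def root_prod_const by metis
  have "\<alpha> i = b" if "i \<le> r" for i
    using eval_root_prod_eq_0_iff[of "Suc r" \<alpha> "\<alpha> i"] eval_root_prod_eq_0_iff[of "Suc r" "\<lambda>_. b" "\<alpha> i"]
      \<alpha> b that by (auto simp: less_Suc_eq_le)
  from this[of j] this[of r] have "\<alpha> j = \<alpha> r" using j by simp
  then have "\<phi> (a j) = \<phi> 0" using j by (simp add: \<alpha>_def)
  then show ?thesis by (rule injD[OF \<phi>])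
qed

section \<open>The bound on bad primes\<close>

theorem corollary3p2:
  fixes n d C p :: nat
  assumes "n \<ge> 2"
    and "d = (n\<^sup>2 + 4 - 3 * n) div 2"
    and "C = ((n\<^sup>2 - n) div 2) choose (n - 2)"
    and "CA TYPE('u) n 0"
    and "bad_prime TYPE('u) n p"
  shows "p < fact C *
           (\<Prod>i = 1..n - 1. ((i + n - 2) choose (n - 2)) ^ ((d - i + n - 2) choose (n - 2)))"
proof -
  define r' where "r' = n - 2"
  define r where "r = Suc r'"
  have n: "n = Suc r" and n': "n = Suc (Suc r')" using assms(1) by (auto simp: r_def r'_def)
  have sum: "(\<Sum>t<r. t) = (r' * Suc r') div 2"
    using gauss_sum_nat[of r'] by (simp only: r_def lessThan_Suc_atMost atLeast0AtMost)
  \<comment> \<open>Halving gives d as one plus the sum of 0, ..., r - 1, and \<open>d + r'\<close>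
    for the upper index of the binomial in C.\<close>
  have "n\<^sup>2 + 4 - 3 * n = r' * Suc r' + 2" "n\<^sup>2 - n = r' * Suc r' + 2 * (r' + 1)"
    by (auto simp: n' power2_eq_square algebra_simps)
  then have d: "d = Suc (\<Sum>t<r. t)" and C: "C = (d + r') choose r'"
  proof -
    have half: "(x + 2 * y) div 2 = x div 2 + y" for x y :: nat by simp
    show "d = Suc (\<Sum>t<r. t)"
      unfolding assms(2) sum \<open>n\<^sup>2 + 4 - 3 * n = _\<close> using half[of "r' * Suc r'" 1] by simp
    then show "C = (d + r') choose r'"
      unfolding assms(3) \<open>n\<^sup>2 - n = _\<close> half r'_def[symmetric] by (simp only: sum) simp
  qed
  define B where "B = fact C * (\<Prod>i = 1..r. ((i + r') choose r') ^ ((d - i + r') choose r'))"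
  have p: "Factorial_Ring.prime p" using assms(5) by (simp add: bad_prime_def)
  obtain K :: "'u ring" and f where K: "algebraically_closed K" "has_char K p"
    and f: "monic_poly K f" "Polynomials.degree f = n" "casas_alvero K f"
    and not_power: "\<And>b. b \<in> carrier K \<Longrightarrow> f \<noteq> [\<one>\<^bsub>K\<^esub>, \<ominus>\<^bsub>K\<^esub> b] [^]\<^bsub>poly_ring K\<^esub> n"
    using assms(5) unfolding bad_prime_def CA_def by auto
  interpret algebraically_closed K by (fact K(1))
  obtain \<alpha> where \<alpha>: "\<And>j. \<alpha> j \<in> carrier K" "f = root_prod K \<alpha> (Suc r)"
    using monic_eq_root_prod[OF f(1)] f(2) n by auto
  obtain h :: "int mpoly \<Rightarrow> 'u" where h: "hom_to_field K h" "\<And>i. h (var i) = \<alpha> i \<ominus>\<^bsub>K\<^esub> \<alpha> r"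
    using exists_mpoly_hom[of "\<lambda>i. \<alpha> i \<ominus>\<^bsub>K\<^esub> \<alpha> r"] \<alpha>(1) by auto
  interpret h: hom_to_field K h by fact
  have h_root: "h (root_var r j) = \<alpha> j \<ominus>\<^bsub>K\<^esub> \<alpha> r" if "j \<le> r" for j
    using that \<alpha>(1) by (auto simp: root_var_def h(2) minus_eq r_neg)
  have "\<forall>i\<in>{1..r}. \<exists>k\<le>r. h (hasse_form r i k) = \<zero>\<^bsub>K\<^esub>"
    by (rule iffD1[OF casas_alvero_root_prod_iff[OF \<alpha>(1) h(1) h_root] f(3)[unfolded \<alpha>(2)]])
  from bchoice[OF this] obtain \<kappa>
    where \<kappa>: "\<And>i. i \<in> {1..r} \<Longrightarrow> \<kappa> i \<le> r \<and> h (hasse_form r i (\<kappa> i)) = \<zero>\<^bsub>K\<^esub>" by blast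
  obtain \<Delta> :: int where \<Delta>: "\<Delta> \<noteq> 0" "\<bar>\<Delta>\<bar> \<le> int B"
    "\<And>m. m \<in> monomials r d \<Longrightarrow>
      \<exists>c. cst \<Delta> * monom_of m = (\<Sum>t<r. c t * hasse_form r (r - t) (\<kappa> (r - t)))"
  proof -
    \<comment> \<open>The characteristic p counterexample itself makes the type large enough for a
      field of characteristic 0.\<close>
    have "infinite (UNIV :: 'u set)" using infinite_carrier by (metis finite_subset subset_UNIV)
    then have "a j = 0" if "\<And>i. 1 \<le> i \<Longrightarrow> i \<le> r \<Longrightarrow> ev of_int a (hasse_form r i (\<kappa> i)) = 0" "j < r"
      for a :: "nat \<Rightarrow> rat alg_closure" and j
      using CA_0_hasse_forms[OF assms(4)[unfolded n], of \<kappa> a j] \<kappa> that by auto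
    then show ?thesis
      using hasse_forms_nullstellensatz[OF r_def, of \<kappa> d, where 'k = "rat alg_closure"] \<kappa> d that
      unfolding B_def C by auto
  qed
  obtain j where j: "j < r" "h (var j) \<noteq> \<zero>\<^bsub>K\<^esub>"
  proof -
    \<comment> \<open>A nontrivial zero of the forms: if all roots coincided, f would be the power
      of a linear polynomial.\<close>
    have "\<exists>j<r. \<alpha> j \<noteq> \<alpha> r"
    proof (rule ccontr)
      assume "\<not> (\<exists>j<r. \<alpha> j \<noteq> \<alpha> r)"
      then have "root_prod K \<alpha> (Suc r) = root_prod K (\<lambda>_. \<alpha> r) (Suc r)"
        by (intro root_prod_cong) (auto simp: less_Suc_eq)
      then have "f = [\<one>\<^bsub>K\<^esub>, \<ominus>\<^bsub>K\<^esub> \<alpha> r] [^]\<^bsub>poly_ring K\<^esub> n"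
        unfolding \<alpha>(2) n root_prod_const .
      then show False using not_power[OF \<alpha>(1)] by blast
    qed
    then show ?thesis using that \<alpha>(1) by (auto simp: h(2))
  qed
  have "p dvd nat \<bar>\<Delta>\<bar>"
  proof -
    \<comment> \<open>For the d-th power of this variable the right-hand side of the identity is
      killed by h, while the power itself is not; so h kills the constant \<Delta>.\<close>
    define m where "m = Poly_Mapping.single j d"
    have "m \<in> monomials r d" using j by (auto simp: monomials_def m_def)
    then obtain c where c: "cst \<Delta> * monom_of m = (\<Sum>t<r. c t * hasse_form r (r - t) (\<kappa> (r - t)))"
      using \<Delta>(3) by blast
    have "h (c t * hasse_form r (r - t) (\<kappa> (r - t))) = \<zero>\<^bsub>K\<^esub>" if "t < r" for t
      using \<kappa>[of "r - t"] that by (simp add: h.h_mult)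
    then have "h (cst \<Delta> * monom_of m) = \<zero>\<^bsub>K\<^esub>"
      unfolding c by (simp add: h.h_sum cong: finsum_cong)
    moreover have "monom_of m = (var j :: int mpoly) ^ d" by (simp add: m_def var_power)
    ultimately have "h (cst \<Delta>) \<otimes>\<^bsub>K\<^esub> h (var j) [^]\<^bsub>K\<^esub> d = \<zero>\<^bsub>K\<^esub>"
      by (simp only: h.h_mult h.h_power)
    moreover have "h (var j) [^]\<^bsub>K\<^esub> k \<noteq> \<zero>\<^bsub>K\<^esub>" for k :: nat
      using j(2) by (induction k) (simp_all add: integral_iff)
    ultimately have "h (cst \<Delta>) = \<zero>\<^bsub>K\<^esub>" by (metis integral h.h_closed nat_pow_closed)
    moreover have "cst \<Delta> = (of_int \<Delta> :: int mpoly)"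
      using single_of_int[of \<Delta>, where 'b = int] by simp
    \<comment> \<open>\<open>has_char\<close> concerns natural multiples of one, so the sign of
      \<Delta> is removed first.\<close>
    moreover have "of_nat (nat \<bar>\<Delta>\<bar>) = (of_int \<bar>\<Delta>\<bar> :: int mpoly)" by simp
    ultimately have "h (of_nat (nat \<bar>\<Delta>\<bar>)) = \<zero>\<^bsub>K\<^esub>"
      by (cases "\<Delta> \<ge> 0") (simp_all add: h.h_uminus)
    then show ?thesis using K(2) unfolding has_char_def h.h_of_nat by blast
  qed
  then have "p \<le> nat \<bar>\<Delta>\<bar>" using \<Delta>(1) by (intro dvd_imp_le) auto
  also have "\<dots> \<le> B" using \<Delta>(2) by simp
  finally have "p \<le> B" .
  \<comment> \<open>For n = 2 the bound B equals 1; for larger n, C is at least 3, so both 2 and 3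
    divide B. In neither case is B a prime.\<close>
  moreover have "p \<noteq> B"
  proof (cases "r' = 0")
    case True
    then have "B = 1" by (simp add: B_def C)
    then show ?thesis using p by auto
  next
    case False
    have "r' * Suc r' div 2 \<ge> 1" using False by (cases r') auto
    then have "r' + 2 \<le> d + r'" unfolding d sum by simp
    have "(3 :: nat) = 3 choose 2" by (simp add: numeral_eq_Suc)
    also have "\<dots> \<le> (r' + 2) choose 2" using False by (intro binomial_right_mono) simp
    also have "\<dots> = (r' + 2) choose r'" using binomial_symmetric[of 2 "r' + 2"] by simp
    also have "\<dots> \<le> C" unfolding C by (rule binomial_right_mono) fact
    finally have "3 \<le> C" .
    then have "2 dvd B" "3 dvd B" by (auto simp: B_def dvd_fact)
    then show ?thesis using p by (auto simp: prime_nat_iff)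
  qed
  moreover have "n - 1 = r" "n - 2 = r'" "i + n - 2 = i + r'" for i by (simp_all add: n' r_def)
  ultimately show ?thesis unfolding B_def by (simp only: le_neq_implies_less)
qed

end
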